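(* Let $f:(A,\partial)\to(B,\partial)$, $g:(B,\partial)\to(C,\partial)$ and $h:(A,\partial)\to(C,\partial)$ be chain homotopy equivalences such that $h$ is chain homotopic to $gf$. Suppose given: an $A_\infty$-structure $(A,\partial,\boldsymbol\mu)$ on $(A,\partial)$; an $A_\infty$-morphism $F=(f,f_2,f_3,\ldots):(A,\partial,\boldsymbol\mu)\to(B,\partial,\boldsymbol\nu)$ extending $f$; an $A_\infty$-morphism $G=(g,g_2,g_3,\ldots):(B,\partial,\boldsymbol\nu)\to(C,\partial,\boldsymbol\omega')$ extending $g$; and an $A_\infty$-morphism $H=(h,h_2,h_3,\ldots):(A,\partial,\boldsymbol\mu)\to(C,\partial,\boldsymbol\omega'')$ extending $h$. Then there exists an isotopy $T:(C,\partial,\boldsymbol\omega')\to(C,\partial,\boldsymbol\omega'')$ such that the $A_\infty$-morphisms $TGF$ and $H$ are $A_\infty$-homotopic.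
   Context: Fix an arbitrary commutative unital ring $R$; all modules are over $R$ and $\otimes$ is over $R$. Chain complexes $(A,\partial)$ are $\mathbb{Z}$-graded, possibly unbounded, with differential of degree $-1$; the symbol $\partial$ is used for all differentials. For a graded module $A$, $T^c(\uparrow A)=\bigoplus_{n\ge1}(\uparrow A)^{\otimes n}$ is the tensor coalgebra (deconcatenation coproduct) on the suspension of $A$. An $A_\infty$-algebra $(A,\partial,\boldsymbol\mu)$ is a chain complex $(A,\partial)$ with linear maps $\mu_k:A^{\otimes k}\to A$, $k\ge2$, of degree $k-2$, such that the degree $-1$ coderivation $\delta$ of $T^c(\uparrow A)$ determined (after the usual suspension) by $\partial,\mu_2,\mu_3,\ldots$ satisfies $\delta^2=0$. An $A_\infty$-morphism $F=(f,f_2,f_3,\ldots):(A',\partial,\boldsymbol\mu')\to(A'',\partial,\boldsymbol\mu'')$ consists of linear maps $f:A'\to A''$ of degree $0$ and $f_k:A'^{\otimes k}\to A''$ of degree $k-1$, $k\ge 2$, such that the coalgebra morphism $\phi:T^c(\uparrow A')\to T^c(\uparrow A'')$ they determine satisfies $\delta''\phi=\phi\delta'$. Then $f$ is a chain map, called the linear part of $F$, and $F$ is said to extend $f$. Composition is composition of coalgebra morphisms. An $A_\infty$-homotopy between $G=(g,g_2,\ldots)$ and $F=(f,f_2,\ldots)$ is a family $h:A'\to A''$ of degree $1$, $h_k:A'^{\otimes k}\to A''$ of degree $k$ ($k\geq 2$), whose associated degree $+1$ map $\eta:T^c(\uparrow A')\to T^c(\uparrow A'')$ satisfying $\Delta''\eta=(\phi\otimes\eta)\Delta'+(\eta\otimes\psi)\Delta'$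 fulfills $\psi-\phi=\delta''\eta+\eta\delta'$, where $\phi,\psi$ are the coalgebra morphisms of $F,G$ and $\Delta',\Delta''$ are the coproducts. An isotopy is an $A_\infty$-morphism whose linear part is the identity. *)

theory Defs
  imports Main "HOL.Modules" "HOL-Library.Poly_Mapping"
begin

section \<open>Graded modules and chain complexes\<close>

text \<open>The ground ring is the type \<open>'r\<close>. A graded module is a module that is the internal direct sum
  of a family of submodules indexed by the integers.\<close>

record ('r, 'a) graded_mod =
  gscale :: "'r \<Rightarrow> 'a \<Rightarrow> 'a"
  gcomp :: "int \<Rightarrow> 'a set"

record ('r, 'a) complex = "('r, 'a) graded_mod" +
  bd :: "'a \<Rightarrow> 'a"

definition is_decomp ::
    "('r::comm_ring_1, 'a::ab_group_add, 'm) graded_mod_scheme \<Rightarrow> 'a \<Rightarrow> (int \<Rightarrow>\<^sub>0 'a) \<Rightarrow> bool" where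
  "is_decomp V x c \<longleftrightarrow>
     (\<forall>n. Poly_Mapping.lookup c n \<in> gcomp V n) \<and>
     x = (\<Sum>n\<in>Poly_Mapping.keys c. Poly_Mapping.lookup c n)"

definition graded_module ::
    "('r::comm_ring_1, 'a::ab_group_add, 'm) graded_mod_scheme \<Rightarrow> bool" where
  "graded_module V \<longleftrightarrow>
     module (gscale V) \<and>
     (\<forall>n. module.subspace (gscale V) (gcomp V n)) \<and>
     (\<forall>x. \<exists>!c. is_decomp V x c)"

definition graded_hom ::
    "('r::comm_ring_1, 'a::ab_group_add, 'm) graded_mod_scheme \<Rightarrow>
     ('r, 'b::ab_group_add, 'n) graded_mod_scheme \<Rightarrow> int \<Rightarrow> ('a \<Rightarrow> 'b) \<Rightarrow> bool" where
  "graded_hom V W d f \<longleftrightarrow>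
     module_hom (gscale V) (gscale W) f \<and> (\<forall>n. \<forall>x\<in>gcomp V n. f x \<in> gcomp W (n + d))"

definition chain_complex :: "('r::comm_ring_1, 'a::ab_group_add) complex \<Rightarrow> bool" where
  "chain_complex A \<longleftrightarrow>
     graded_module A \<and> graded_hom A A (-1) (bd A) \<and> (\<forall>x. bd A (bd A x) = 0)"

definition chain_map ::
    "('r::comm_ring_1, 'a::ab_group_add) complex \<Rightarrow> ('r, 'b::ab_group_add) complex \<Rightarrow>
     ('a \<Rightarrow> 'b) \<Rightarrow> bool" where
  "chain_map A B f \<longleftrightarrow>
     chain_complex A \<and> chain_complex B \<and> graded_hom A B 0 f \<and> (\<forall>x. f (bd A x) = bd B (f x))"

definition chain_homotopic ::
    "('r::comm_ring_1, 'a::ab_group_add) complex \<Rightarrow> ('r, 'b::ab_group_add) complex \<Rightarrow>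
     ('a \<Rightarrow> 'b) \<Rightarrow> ('a \<Rightarrow> 'b) \<Rightarrow> bool" where
  "chain_homotopic A B f g \<longleftrightarrow>
     chain_map A B f \<and> chain_map A B g \<and>
     (\<exists>s. graded_hom A B 1 s \<and> (\<forall>x. g x - f x = bd B (s x) + s (bd A x)))"

definition chain_equivalence ::
    "('r::comm_ring_1, 'a::ab_group_add) complex \<Rightarrow> ('r, 'b::ab_group_add) complex \<Rightarrow>
     ('a \<Rightarrow> 'b) \<Rightarrow> bool" where
  "chain_equivalence A B f \<longleftrightarrow>
     chain_map A B f \<and>
     (\<exists>k. chain_map B A k \<and> chain_homotopic A A (k \<circ> f) id \<and> chain_homotopic B B (f \<circ> k) id)"

text \<open>The suspension has the same underlying module, regraded; the suspension map is the identity
  of the underlying module, viewed as a map of degree 1.\<close>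

definition susp ::
    "('r, 'a, 'm) graded_mod_scheme \<Rightarrow> ('r, 'a, 'm) graded_mod_scheme" where
  "susp A = A\<lparr>gcomp := \<lambda>n. gcomp A (n - 1)\<rparr>"

text \<open>The linear involution that is multiplication by \<open>(-1)^n\<close> in degree \<open>n\<close>. All Koszul signs are
  expressed through it.\<close>

definition gsign ::
    "('r::comm_ring_1, 'a::ab_group_add, 'm) graded_mod_scheme \<Rightarrow> 'a \<Rightarrow> 'a" where
  "gsign V x =
     (let c = (THE c. is_decomp V x c)
      in \<Sum>n\<in>Poly_Mapping.keys c.
           if even n then Poly_Mapping.lookup c n else - Poly_Mapping.lookup c n)"


section \<open>The tensor coalgebra\<close>

text \<open>\<open>'w \<Rightarrow>\<^sub>0 'r\<close> is the free module on the set of all \<open>w :: 'w\<close>; \<open>lin s g\<close> extends \<open>g\<close> linearly to it.\<close>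

definition fscale :: "'r::comm_ring_1 \<Rightarrow> ('w \<Rightarrow>\<^sub>0 'r) \<Rightarrow> ('w \<Rightarrow>\<^sub>0 'r)" where
  "fscale r p = Poly_Mapping.map ((*) r) p"

lemma lookup_fscale: "Poly_Mapping.lookup (fscale r p) w = r * Poly_Mapping.lookup p w"
  by (simp add: fscale_def Poly_Mapping.map.rep_eq when_def)

lemma module_fscale: "module fscale"
  by standard (auto intro!: poly_mapping_eqI simp: lookup_fscale lookup_add algebra_simps)

abbreviation basis :: "'w \<Rightarrow> ('w \<Rightarrow>\<^sub>0 'r::comm_ring_1)" where
  "basis w \<equiv> Poly_Mapping.single w 1"

definition lin ::
    "('r::comm_ring_1 \<Rightarrow> 'b::ab_group_add \<Rightarrow> 'b) \<Rightarrow> ('w \<Rightarrow> 'b) \<Rightarrow> ('w \<Rightarrow>\<^sub>0 'r) \<Rightarrow> 'b" where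
  "lin s g p = (\<Sum>w\<in>Poly_Mapping.keys p. s (Poly_Mapping.lookup p w) (g w))"

text \<open>The tensor coalgebra of \<open>V\<close> is presented as the free module on words (lists) in \<open>V\<close> modulo the
  submodule \<open>tc_rel V\<close> of multilinearity relations; the class of the word \<open>[x\<^sub>1, \<dots>, x\<^sub>n]\<close> is the tensor
  \<open>x\<^sub>1 \<otimes> \<dots> \<otimes> x\<^sub>n\<close>. The empty word is a relation as well, since only tensor powers with \<open>n \<ge> 1\<close> occur.
  Elements of quotients are handled through representatives: a linear map between the quotients is
  given by a linear map of the free modules that preserves the relations (every linear map of the
  quotients arises so, the free modules being free), and equality is congruence modulo the relations.\<close>

definition tc_rel ::
    "('r::comm_ring_1, 'a::ab_group_add, 'm) graded_mod_scheme \<Rightarrow> ('a list \<Rightarrow>\<^sub>0 'r) set" where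
  "tc_rel V = module.span fscale
     ({basis []}
      \<union> {basis (u @ [x + y] @ v) - basis (u @ [x] @ v) - basis (u @ [y] @ v) | u v x y. True}
      \<union> {basis (u @ [gscale V r x] @ v) - fscale r (basis (u @ [x] @ v)) | u v r x. True})"

text \<open>The degree \<open>n\<close> part of the tensor coalgebra, as a submodule of the free module containing
  the relations.\<close>

definition tc_comp ::
    "('r::comm_ring_1, 'a::ab_group_add, 'm) graded_mod_scheme \<Rightarrow> int \<Rightarrow> ('a list \<Rightarrow>\<^sub>0 'r) set" where
  "tc_comp V n = module.span fscale
     (tc_rel V \<union>
      {basis w | w ds. list_all2 (\<lambda>x d. x \<in> gcomp V d) w ds \<and> sum_list ds = n})"

definition tc_hom ::
    "('r::comm_ring_1, 'a::ab_group_add, 'm) graded_mod_scheme \<Rightarrow>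
     ('r, 'b::ab_group_add, 'n) graded_mod_scheme \<Rightarrow> int \<Rightarrow>
     (('a list \<Rightarrow>\<^sub>0 'r) \<Rightarrow> ('b list \<Rightarrow>\<^sub>0 'r)) \<Rightarrow> bool" where
  "tc_hom V W d \<phi> \<longleftrightarrow>
     module_hom fscale fscale \<phi> \<and> \<phi> ` tc_rel V \<subseteq> tc_rel W \<and>
     (\<forall>n. \<phi> ` tc_comp V n \<subseteq> tc_comp W (n + d))"

definition tc_eq ::
    "('r::comm_ring_1, 'a::ab_group_add, 'm) graded_mod_scheme \<Rightarrow>
     ('a list \<Rightarrow>\<^sub>0 'r) \<Rightarrow> ('a list \<Rightarrow>\<^sub>0 'r) \<Rightarrow> bool" where
  "tc_eq V p q \<longleftrightarrow> p - q \<in> tc_rel V"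

text \<open>The projection of the tensor coalgebra onto its cogenerators \<open>V\<close>.\<close>

definition tc_proj ::
    "('r::comm_ring_1, 'a::ab_group_add, 'm) graded_mod_scheme \<Rightarrow> ('a list \<Rightarrow>\<^sub>0 'r) \<Rightarrow> 'a" where
  "tc_proj V = lin (gscale V) (\<lambda>w. if length w = 1 then hd w else 0)"

text \<open>The tensor square of the tensor coalgebra is presented in the same way, with pairs of words
  as generators.\<close>

definition tens :: "('u \<Rightarrow>\<^sub>0 'r::comm_ring_1) \<Rightarrow> ('v \<Rightarrow>\<^sub>0 'r) \<Rightarrow> ('u \<times> 'v \<Rightarrow>\<^sub>0 'r)" where
  "tens p q = lin fscale (\<lambda>u. lin fscale (\<lambda>v. basis (u, v)) q) p"

definition tc2_rel ::
    "('r::comm_ring_1, 'a::ab_group_add, 'm) graded_mod_scheme \<Rightarrow> ('a list \<times> 'a list \<Rightarrow>\<^sub>0 'r) set" where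
  "tc2_rel V = module.span fscale
     ({tens p q | p q. p \<in> tc_rel V} \<union> {tens p q | p q. q \<in> tc_rel V})"

definition tc2_eq ::
    "('r::comm_ring_1, 'a::ab_group_add, 'm) graded_mod_scheme \<Rightarrow>
     ('a list \<times> 'a list \<Rightarrow>\<^sub>0 'r) \<Rightarrow> ('a list \<times> 'a list \<Rightarrow>\<^sub>0 'r) \<Rightarrow> bool" where
  "tc2_eq V p q \<longleftrightarrow> p - q \<in> tc2_rel V"

definition deconc :: "('a list \<Rightarrow>\<^sub>0 'r::comm_ring_1) \<Rightarrow> ('a list \<times> 'a list \<Rightarrow>\<^sub>0 'r)" where
  "deconc = lin fscale (\<lambda>w. \<Sum>i\<in>{1..<length w}. basis (take i w, drop i w))"

definition tc_sign ::
    "('r::comm_ring_1, 'a::ab_group_add, 'm) graded_mod_scheme \<Rightarrow>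
     ('a list \<Rightarrow>\<^sub>0 'r) \<Rightarrow> ('a list \<Rightarrow>\<^sub>0 'r)" where
  "tc_sign V = lin fscale (\<lambda>w. basis (map (gsign V) w))"

text \<open>\<open>tens_map V d \<alpha> \<beta>\<close> is the tensor product of \<open>\<alpha>\<close> and \<open>\<beta>\<close> for \<open>\<beta>\<close> of degree \<open>d\<close>: it sends
  \<open>u \<otimes> v\<close> to \<open>(-1)^(d * deg u) * \<alpha> u \<otimes> \<beta> v\<close>.\<close>

definition tens_map ::
    "('r::comm_ring_1, 'a::ab_group_add, 'm) graded_mod_scheme \<Rightarrow> int \<Rightarrow>
     (('a list \<Rightarrow>\<^sub>0 'r) \<Rightarrow> ('b list \<Rightarrow>\<^sub>0 'r)) \<Rightarrow> (('a list \<Rightarrow>\<^sub>0 'r) \<Rightarrow> ('b list \<Rightarrow>\<^sub>0 'r)) \<Rightarrow>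
     ('a list \<times> 'a list \<Rightarrow>\<^sub>0 'r) \<Rightarrow> ('b list \<times> 'b list \<Rightarrow>\<^sub>0 'r)" where
  "tens_map V d \<alpha> \<beta> =
     lin fscale (\<lambda>(u, v).
       tens (\<alpha> (if even d then basis u else tc_sign V (basis u))) (\<beta> (basis v)))"

definition tc_coderivation ::
    "('r::comm_ring_1, 'a::ab_group_add, 'm) graded_mod_scheme \<Rightarrow>
     (('a list \<Rightarrow>\<^sub>0 'r) \<Rightarrow> ('a list \<Rightarrow>\<^sub>0 'r)) \<Rightarrow> bool" where
  "tc_coderivation V \<delta> \<longleftrightarrow>
     tc_hom V V (-1) \<delta> \<and>
     (\<forall>p. tc2_eq V (deconc (\<delta> p)) (tens_map V 0 \<delta> id (deconc p) + tens_map V (-1) id \<delta> (deconc p)))"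

definition tc_coalg_hom ::
    "('r::comm_ring_1, 'a::ab_group_add, 'm) graded_mod_scheme \<Rightarrow>
     ('r, 'b::ab_group_add, 'n) graded_mod_scheme \<Rightarrow>
     (('a list \<Rightarrow>\<^sub>0 'r) \<Rightarrow> ('b list \<Rightarrow>\<^sub>0 'r)) \<Rightarrow> bool" where
  "tc_coalg_hom V W \<phi> \<longleftrightarrow>
     tc_hom V W 0 \<phi> \<and> (\<forall>p. tc2_eq W (deconc (\<phi> p)) (tens_map V 0 \<phi> \<phi> (deconc p)))"

text \<open>The maps from a coalgebra \<open>T\<^sup>c V\<close> to \<open>T\<^sup>c W\<close> satisfying \<open>\<Delta> \<eta> = (\<phi> \<otimes> \<eta>) \<Delta> + (\<eta> \<otimes> \<psi>) \<Delta>\<close>.\<close>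

definition tc_homotopy_map ::
    "('r::comm_ring_1, 'a::ab_group_add, 'm) graded_mod_scheme \<Rightarrow>
     ('r, 'b::ab_group_add, 'n) graded_mod_scheme \<Rightarrow>
     (('a list \<Rightarrow>\<^sub>0 'r) \<Rightarrow> ('b list \<Rightarrow>\<^sub>0 'r)) \<Rightarrow> (('a list \<Rightarrow>\<^sub>0 'r) \<Rightarrow> ('b list \<Rightarrow>\<^sub>0 'r)) \<Rightarrow>
     (('a list \<Rightarrow>\<^sub>0 'r) \<Rightarrow> ('b list \<Rightarrow>\<^sub>0 'r)) \<Rightarrow> bool" where
  "tc_homotopy_map V W \<phi> \<psi> \<eta> \<longleftrightarrow>
     tc_hom V W 1 \<eta> \<and>
     (\<forall>p. tc2_eq W (deconc (\<eta> p)) (tens_map V 1 \<phi> \<eta> (deconc p) + tens_map V 0 \<eta> \<psi> (deconc p)))"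


section \<open>A-infinity structures\<close>

text \<open>A linear map from the \<open>k\<close>-th tensor power is a multilinear function on words of length \<open>k\<close>. A
  family of such maps is a single function on words, whose restriction to words of length \<open>k\<close> is
  the member of arity \<open>k\<close>.\<close>

definition multilinear ::
    "('r::comm_ring_1, 'a::ab_group_add, 'm) graded_mod_scheme \<Rightarrow>
     ('r, 'b::ab_group_add, 'n) graded_mod_scheme \<Rightarrow> nat \<Rightarrow> int \<Rightarrow> ('a list \<Rightarrow> 'b) \<Rightarrow> bool" where
  "multilinear V W k d F \<longleftrightarrow>
     (\<forall>u v. length u + 1 + length v = k \<longrightarrow>
        module_hom (gscale V) (gscale W) (\<lambda>x. F (u @ [x] @ v))) \<and>
     (\<forall>w ds. length w = k \<and> list_all2 (\<lambda>x n. x \<in> gcomp V n) w ds \<longrightarrow>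
        F w \<in> gcomp W (sum_list ds + d))"

text \<open>The tensor power of the desuspension map with its Koszul sign: since that map has odd degree,
  \<open>x\<^sub>1 \<otimes> \<dots> \<otimes> x\<^sub>k\<close> is multiplied by \<open>(-1)^((k - i) * deg x\<^sub>i)\<close> for every \<open>i\<close>. On underlying words this is
  an involution. \<open>V\<close> is the suspended module.\<close>

fun desusp_word ::
    "('r::comm_ring_1, 'a::ab_group_add, 'm) graded_mod_scheme \<Rightarrow> 'a list \<Rightarrow> 'a list" where
  "desusp_word V [] = []"
| "desusp_word V (x # xs) = (gsign V ^^ length xs) x # desusp_word V xs"

text \<open>\<open>\<theta>\<close> has as its component on the cogenerators the suspension of the family \<open>F\<close>.\<close>

definition has_components ::
    "('r::comm_ring_1, 'a::ab_group_add, 'm) graded_mod_scheme \<Rightarrow>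
     ('r, 'b::ab_group_add, 'n) graded_mod_scheme \<Rightarrow> ('a list \<Rightarrow> 'b) \<Rightarrow>
     (('a list \<Rightarrow>\<^sub>0 'r) \<Rightarrow> ('b list \<Rightarrow>\<^sub>0 'r)) \<Rightarrow> bool" where
  "has_components A B F \<theta> \<longleftrightarrow>
     (\<forall>w. w \<noteq> [] \<longrightarrow> tc_proj (susp B) (\<theta> (basis w)) = F (desusp_word (susp A) w))"

definition ainf_coder ::
    "('r::comm_ring_1, 'a::ab_group_add) complex \<Rightarrow> ('a list \<Rightarrow> 'a) \<Rightarrow>
     (('a list \<Rightarrow>\<^sub>0 'r) \<Rightarrow> ('a list \<Rightarrow>\<^sub>0 'r)) \<Rightarrow> bool" where
  "ainf_coder A \<mu> \<delta> \<longleftrightarrow>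
     tc_coderivation (susp A) \<delta> \<and>
     has_components A A (\<lambda>w. if length w = 1 then bd A (hd w) else \<mu> w) \<delta>"

text \<open>Coderivations, coalgebra morphisms and homotopy maps are determined by their components up to
  congruence modulo the relations, so quantifying existentially over them is harmless.\<close>

definition ainf_algebra ::
    "('r::comm_ring_1, 'a::ab_group_add) complex \<Rightarrow> ('a list \<Rightarrow> 'a) \<Rightarrow> bool" where
  "ainf_algebra A \<mu> \<longleftrightarrow>
     chain_complex A \<and> (\<forall>k\<ge>2. multilinear A A k (int k - 2) \<mu>) \<and>
     (\<exists>\<delta>. ainf_coder A \<mu> \<delta> \<and> (\<forall>p. tc_eq (susp A) (\<delta> (\<delta> p)) 0))"

definition ainf_coalg_hom ::
    "('r::comm_ring_1, 'a::ab_group_add) complex \<Rightarrow> ('r, 'b::ab_group_add) complex \<Rightarrow>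
     ('a list \<Rightarrow> 'b) \<Rightarrow> (('a list \<Rightarrow>\<^sub>0 'r) \<Rightarrow> ('b list \<Rightarrow>\<^sub>0 'r)) \<Rightarrow> bool" where
  "ainf_coalg_hom A B F \<phi> \<longleftrightarrow> tc_coalg_hom (susp A) (susp B) \<phi> \<and> has_components A B F \<phi>"

definition ainf_morphism ::
    "('r::comm_ring_1, 'a::ab_group_add) complex \<Rightarrow> ('a list \<Rightarrow> 'a) \<Rightarrow>
     ('r, 'b::ab_group_add) complex \<Rightarrow> ('b list \<Rightarrow> 'b) \<Rightarrow> ('a list \<Rightarrow> 'b) \<Rightarrow> bool" where
  "ainf_morphism A \<mu> B \<nu> F \<longleftrightarrow>
     ainf_algebra A \<mu> \<and> ainf_algebra B \<nu> \<and>
     (\<forall>k\<ge>1. multilinear A B k (int k - 1) F) \<and>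
     (\<exists>\<delta> \<delta>' \<phi>. ainf_coder A \<mu> \<delta> \<and> ainf_coder B \<nu> \<delta>' \<and> ainf_coalg_hom A B F \<phi> \<and>
        (\<forall>p. tc_eq (susp B) (\<delta>' (\<phi> p)) (\<phi> (\<delta> p))))"

definition linear_part :: "('a list \<Rightarrow> 'b) \<Rightarrow> 'a \<Rightarrow> 'b" where
  "linear_part F x = F [x]"

definition ainf_isotopy ::
    "('r::comm_ring_1, 'a::ab_group_add) complex \<Rightarrow> ('a list \<Rightarrow> 'a) \<Rightarrow> ('a list \<Rightarrow> 'a) \<Rightarrow>
     ('a list \<Rightarrow> 'a) \<Rightarrow> bool" where
  "ainf_isotopy A \<mu> \<mu>' T \<longleftrightarrow> ainf_morphism A \<mu> A \<mu>' T \<and> linear_part T = id"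

text \<open>The composite is read off from the composite of the coalgebra morphisms; \<open>desusp_word\<close> is its
  own inverse. The value does not depend on the choice of representatives.\<close>

definition ainf_comp ::
    "('r::comm_ring_1, 'a::ab_group_add) complex \<Rightarrow> ('r, 'b::ab_group_add) complex \<Rightarrow>
     ('r, 'c::ab_group_add) complex \<Rightarrow> ('b list \<Rightarrow> 'c) \<Rightarrow> ('a list \<Rightarrow> 'b) \<Rightarrow> 'a list \<Rightarrow> 'c" where
  "ainf_comp A B C G F w =
     (let \<phi> = (SOME \<phi>. ainf_coalg_hom A B F \<phi>);
          \<psi> = (SOME \<psi>. ainf_coalg_hom B C G \<psi>)
      in tc_proj (susp C) (\<psi> (\<phi> (basis (desusp_word (susp A) w)))))"

definition ainf_homotopy ::
    "('r::comm_ring_1, 'a::ab_group_add) complex \<Rightarrow> ('a list \<Rightarrow> 'a) \<Rightarrow>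
     ('r, 'b::ab_group_add) complex \<Rightarrow> ('b list \<Rightarrow> 'b) \<Rightarrow>
     ('a list \<Rightarrow> 'b) \<Rightarrow> ('a list \<Rightarrow> 'b) \<Rightarrow> ('a list \<Rightarrow> 'b) \<Rightarrow> bool" where
  "ainf_homotopy A \<mu> B \<nu> G F h \<longleftrightarrow>
     (\<forall>k\<ge>1. multilinear A B k (int k) h) \<and>
     (\<exists>\<delta> \<delta>' \<phi> \<psi> \<eta>. ainf_coder A \<mu> \<delta> \<and> ainf_coder B \<nu> \<delta>' \<and>
        ainf_coalg_hom A B F \<phi> \<and> ainf_coalg_hom A B G \<psi> \<and>
        tc_homotopy_map (susp A) (susp B) \<phi> \<psi> \<eta> \<and> has_components A B h \<eta> \<and>
        (\<forall>p. tc_eq (susp B) (\<psi> p - \<phi> p) (\<delta>' (\<eta> p) + \<eta> (\<delta> p))))"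

definition ainf_homotopic ::
    "('r::comm_ring_1, 'a::ab_group_add) complex \<Rightarrow> ('a list \<Rightarrow> 'a) \<Rightarrow>
     ('r, 'b::ab_group_add) complex \<Rightarrow> ('b list \<Rightarrow> 'b) \<Rightarrow>
     ('a list \<Rightarrow> 'b) \<Rightarrow> ('a list \<Rightarrow> 'b) \<Rightarrow> bool" where
  "ainf_homotopic A \<mu> B \<nu> G F \<longleftrightarrow>
     ainf_morphism A \<mu> B \<nu> G \<and> ainf_morphism A \<mu> B \<nu> F \<and> (\<exists>h. ainf_homotopy A \<mu> B \<nu> G F h)"

end

theory Submission
  imports Defs
begin

text \<open>
  Write \<open>\<kappa>\<close> and \<open>\<chi>\<close> for the coalgebra morphisms of \<open>GF\<close> and \<open>H\<close>, \<open>\<delta>\<close>, \<open>\<delta>'\<close> and \<open>\<delta>''\<close> for the codifferentials that belong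
  to \<open>\<mu>\<close>, \<open>\<omega>'\<close> and \<open>\<omega>''\<close>, and \<open>k = g f\<close>. The isotopy, with coalgebra morphism \<open>\<tau>\<close>, and the homotopy, with
  associated map \<open>\<eta>\<close>, are constructed together, arity by arity. They start with the identity of \<open>C\<close> and with
  the given chain homotopy between \<open>h\<close> and \<open>k\<close>. Suppose that the components of arity less than \<open>n\<close> are chosen
  such that the two defects \<open>D = \<delta>'' \<tau> - \<tau> \<delta>'\<close> and \<open>E = \<tau> \<kappa> - \<chi> - (\<delta>'' \<eta> + \<eta> \<delta>)\<close> vanish on words of length less than
  \<open>n\<close>. On words of length \<open>n\<close> the coproducts of the defects vanish (\<open>deconc_chain_defect\<close>,
  \<open>deconc_homotopy_defect\<close>), so the defects take values in single letters (\<open>primitive_eq_single\<close>): they are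
  maps \<open>d\<close> from \<open>C\<^sup>\<otimes>\<^sup>n\<close> to \<open>C\<close> and \<open>e\<close> from \<open>A\<^sup>\<otimes>\<^sup>n\<close> to \<open>C\<close>. Because the codifferentials square to zero,
  \<open>\<partial> d + d \<partial> = 0\<close> and \<open>\<partial> e - e \<partial> = d k\<^sup>\<otimes>\<^sup>n\<close>. So \<open>(d, e)\<close> is a cycle in the mapping cone of precomposition with
  \<open>k\<^sup>\<otimes>\<^sup>n\<close>. Tensor powers of homotopy equivalences are homotopy equivalences (\<open>linear_homotopy\<close>), hence the cone is
  contractible and the cycle is a boundary (\<open>cone_cycle_is_boundary\<close>). A bounding pair provides the components of
  arity \<open>n\<close> for which both defects vanish on words of length \<open>n\<close> as well (\<open>solution_extends\<close>).

  Only the passage between maps of tensor coalgebras and their components needs care. A word of length at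
  least two is recovered from its coproduct through the cut after the first letter (\<open>decompose\<close>), which works
  over every ring. This turns the defining coproduct formulas into a recursion on word length
  (\<open>gcoder_recursion\<close>). From it follow uniqueness (\<open>gcoder_unique\<close>), the effect of a change of components
  (\<open>gcoder_variation\<close>) and the fact that modulo shorter words only the linear components count
  (\<open>gcoder_leading\<close>). Conversely the recursion is used as a definition, and coassociativity shows that the maps
  so defined have the right coproduct (\<open>deconc_wrec\<close>).
\<close>

interpretation fm: module "fscale :: 'r::comm_ring_1 \<Rightarrow> ('w \<Rightarrow>\<^sub>0 'r) \<Rightarrow> ('w \<Rightarrow>\<^sub>0 'r)"
  by (rule module_fscale)

section \<open>Linear extension\<close>

abbreviation flinear where "flinear \<equiv> module_hom fscale fscale"

lemma lin_superset:
  assumes "module s" "finite K" "Poly_Mapping.keys p \<subseteq> K"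
  shows "lin s g p = (\<Sum>w\<in>K. s (Poly_Mapping.lookup p w) (g w))"
proof -
  interpret module s by fact
  show ?thesis
    unfolding lin_def using assms(2,3)
    by (intro sum.mono_neutral_left) (auto simp: in_keys_iff)
qed

lemma lin_basis [simp]: "module s \<Longrightarrow> lin s g (basis w) = g w"
  using lin_superset[of s "{w}" "basis w" g] by (simp add: module_def)

lemma module_hom_lin [simp, intro]:
  assumes "module s"
  shows "module_hom fscale s (lin s g)"
proof -
  interpret module s by fact
  show ?thesis
  proof
    fix p q :: "'c \<Rightarrow>\<^sub>0 'a" and r
    let ?K = "Poly_Mapping.keys p \<union> Poly_Mapping.keys q"
    have "Poly_Mapping.keys (p + q) \<subseteq> ?K" by (rule Poly_Mapping.keys_add)
    then show "lin s g (p + q) = lin s g p + lin s g q"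
      by (subst (1 2 3) lin_superset[OF assms, of ?K])
        (auto simp: lookup_add scale_left_distrib sum.distrib)
    have "Poly_Mapping.keys (fscale r p) \<subseteq> Poly_Mapping.keys p"
      by (auto simp: in_keys_iff lookup_fscale)
    then show "lin s g (fscale r p) = s r (lin s g p)"
      by (subst (1 2) lin_superset[OF assms, of "Poly_Mapping.keys p"])
        (auto simp: lookup_fscale scale_sum_right)
  qed
qed

lemma fsum_basis: "p = (\<Sum>w\<in>Poly_Mapping.keys p. fscale (Poly_Mapping.lookup p w) (basis w))"
proof (rule poly_mapping_eqI)
  fix k
  show "Poly_Mapping.lookup p k = Poly_Mapping.lookup
     (\<Sum>w\<in>Poly_Mapping.keys p. fscale (Poly_Mapping.lookup p w) (basis w)) k"
    by (simp add: lookup_sum lookup_fscale lookup_single when_def in_keys_iff if_distrib[of "(*) _"] cong: if_cong)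
qed

lemma module_hom_eq_lin:
  assumes "module_hom fscale s f"
  shows "f p = lin s (\<lambda>w. f (basis w)) p"
proof -
  interpret module_hom fscale s f by fact
  show ?thesis
    by (subst fsum_basis) (simp add: sum scale lin_def)
qed

lemma module_hom_eqI:
  assumes "module_hom fscale s f" "module_hom fscale s g"
    and "\<And>w. f (basis w) = g (basis w)"
  shows "f p = g p"
  by (subst (1 2) module_hom_eq_lin[of s]) (simp_all add: assms)

lemma module_hom_mem_span:
  assumes "module_hom fscale s f" "module.subspace s S"
    and "\<And>x. x \<in> G \<Longrightarrow> f x \<in> S" and "p \<in> fm.span G"
  shows "f p \<in> S"
proof -
  interpret module_hom fscale s f by fact
  have "fm.span G \<subseteq> {x. f x \<in> S}"
    by (rule fm.span_minimal) (use assms subspace_linear_preimage in auto)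
  then show ?thesis using assms by auto
qed

lemma module_hom_mem:
  assumes "module_hom fscale s f" "module.subspace s S" "\<And>w. f (basis w) \<in> S"
  shows "f p \<in> S"
proof (rule module_hom_mem_span[OF assms(1,2)])
  show "p \<in> fm.span (range basis)"
    by (subst fsum_basis) (intro fm.span_sum fm.span_scale fm.span_base, simp)
qed (use assms in auto)

lemma module_hom_zero_fun: "module s \<Longrightarrow> module s' \<Longrightarrow> module_hom s s' (\<lambda>x. 0)"
  by (simp add: module_pair.intro module_pair.module_hom_zero)

lemma module_hom_sum_fun:
  "module s \<Longrightarrow> module s' \<Longrightarrow> (\<And>i. i \<in> I \<Longrightarrow> module_hom s s' (f i)) \<Longrightarrow>
    module_hom s s' (\<lambda>x. \<Sum>i\<in>I. f i x)"
  by (rule module_pair.module_hom_sum) (auto simp: module_pair.intro)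

lemma module_hom_imp_module: "module_hom s s' f \<Longrightarrow> module s" "module_hom s s' f \<Longrightarrow> module s'"
  by (auto simp: module_hom_def)

lemma module_hom_plus:
  "module_hom s s' f \<Longrightarrow> module_hom s s' g \<Longrightarrow> module_hom s s' (\<lambda>x. f x + g x)"
  using module_pair.module_hom_add[of s s' f g] by (auto simp: module_hom_def module_pair_def)

lemma module_hom_minus:
  "module_hom s s' f \<Longrightarrow> module_hom s s' g \<Longrightarrow> module_hom s s' (\<lambda>x. f x - g x)"
  using module_pair.module_hom_sub[of s s' f g] by (auto simp: module_hom_def module_pair_def)

lemma module_hom_comp:
  "module_hom s1 s2 f \<Longrightarrow> module_hom s2 s3 g \<Longrightarrow> module_hom s1 s3 (\<lambda>x. g (f x))"
  using module_hom_compose[of s1 s2 f s3 g] by (simp add: o_def)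

lemma module_hom_scaled:
  "module_hom s s' f \<Longrightarrow> module_hom s s' (\<lambda>x. s' c (f x))"
  using module_pair.module_hom_scale[of s s' f c] by (auto simp: module_hom_def module_pair_def)

lemma module_hom_same: "module s \<Longrightarrow> module_hom s s (\<lambda>x. x)"
  by (rule module.module_hom_ident)

lemma module_hom_lin_var:
  assumes "\<And>w. module_hom s fscale (g w)" "module s"
  shows "module_hom s fscale (\<lambda>q. lin fscale (\<lambda>w. g w q) p)"
  unfolding lin_def
  by (intro module_hom_sum_fun module_hom_scaled assms module_fscale)

section \<open>Tensors in free modules\<close>

lemma tens_basis [simp]: "tens (basis u) (basis v) = basis (u, v)"
  by (simp add: tens_def module_fscale)

lemma module_hom_tens_left: "flinear (\<lambda>p. tens p q)"
  unfolding tens_def by (simp add: module_fscale)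

lemma module_hom_tens_right: "flinear (\<lambda>q. tens p q)"
  unfolding tens_def by (intro module_hom_lin_var) (simp_all add: module_fscale)

lemmas tens_simps =
  module_hom.add[OF module_hom_tens_left] module_hom.add[OF module_hom_tens_right]
  module_hom.diff[OF module_hom_tens_left] module_hom.diff[OF module_hom_tens_right]
  module_hom.neg[OF module_hom_tens_left] module_hom.neg[OF module_hom_tens_right]
  module_hom.scale[OF module_hom_tens_left] module_hom.scale[OF module_hom_tens_right]
  module_hom.zero[OF module_hom_tens_left] module_hom.zero[OF module_hom_tens_right]

lemma bilinear_tens_eqI:
  assumes "module_hom fscale s F" "\<And>q. module_hom fscale s (\<lambda>p. G p q)"
    "\<And>p. module_hom fscale s (\<lambda>q. G p q)"
    and "\<And>u v. F (basis (u, v)) = G (basis u) (basis v)"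
  shows "F (tens p q) = G p q"
proof -
  have 1: "F (tens (basis u) q) = G (basis u) q" for u
    by (rule module_hom_eqI[of s]) (use assms in \<open>auto intro: module_hom_comp[OF module_hom_tens_right]\<close>)
  show ?thesis
    by (rule module_hom_eqI[of s "\<lambda>p. F (tens p q)"])
       (use assms 1 in \<open>auto intro: module_hom_comp[OF module_hom_tens_left]\<close>)
qed

section \<open>Congruences\<close>

lemma subspace_tc_rel [simp, intro]: "fm.subspace (tc_rel V)"
  by (simp add: tc_rel_def)

lemma subspace_tc2_rel [simp, intro]: "fm.subspace (tc2_rel V)"
  by (simp add: tc2_rel_def)

lemma subspace_tc_comp [simp, intro]: "fm.subspace (tc_comp V n)"
  by (simp add: tc_comp_def)

lemma tc_eq_refl [simp, intro]: "tc_eq V p p"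
  by (simp add: tc_eq_def fm.subspace_0)

lemma tc_eq_sym: "tc_eq V p q \<Longrightarrow> tc_eq V q p"
  using fm.subspace_neg[OF subspace_tc_rel, of "p - q" V] by (simp add: tc_eq_def)

lemma tc_eq_trans [trans]: "tc_eq V p q \<Longrightarrow> tc_eq V q r \<Longrightarrow> tc_eq V p r"
  using fm.subspace_add[OF subspace_tc_rel, of "p - q" V "q - r"] by (simp add: tc_eq_def)

lemma tc_eq_add: "tc_eq V p q \<Longrightarrow> tc_eq V p' q' \<Longrightarrow> tc_eq V (p + p') (q + q')"
  using fm.subspace_add[OF subspace_tc_rel, of "p - q" V "p' - q'"] by (simp add: tc_eq_def algebra_simps)

lemma tc_eq_diff: "tc_eq V p q \<Longrightarrow> tc_eq V p' q' \<Longrightarrow> tc_eq V (p - p') (q - q')"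
  using fm.subspace_diff[OF subspace_tc_rel, of "p - q" V "p' - q'"] by (simp add: tc_eq_def algebra_simps)

lemma tc_eq_sum: "(\<And>i. i \<in> I \<Longrightarrow> tc_eq V (f i) (g i)) \<Longrightarrow> tc_eq V (sum f I) (sum g I)"
  using fm.subspace_sum[OF subspace_tc_rel, of I "\<lambda>i. f i - g i" V] by (simp add: tc_eq_def sum_subtractf)

lemma tc_eq_0_iff: "tc_eq V p 0 \<longleftrightarrow> p \<in> tc_rel V"
  by (simp add: tc_eq_def)

lemma tc2_eq_refl [simp, intro]: "tc2_eq V p p"
  by (simp add: tc2_eq_def fm.subspace_0)

lemma tc2_eq_sym: "tc2_eq V p q \<Longrightarrow> tc2_eq V q p"
  using fm.subspace_neg[OF subspace_tc2_rel, of "p - q" V] by (simp add: tc2_eq_def)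

lemma tc2_eq_trans [trans]: "tc2_eq V p q \<Longrightarrow> tc2_eq V q r \<Longrightarrow> tc2_eq V p r"
  using fm.subspace_add[OF subspace_tc2_rel, of "p - q" V "q - r"] by (simp add: tc2_eq_def)

lemma tc2_eq_add: "tc2_eq V p q \<Longrightarrow> tc2_eq V p' q' \<Longrightarrow> tc2_eq V (p + p') (q + q')"
  using fm.subspace_add[OF subspace_tc2_rel, of "p - q" V "p' - q'"] by (simp add: tc2_eq_def algebra_simps)

lemma tc2_eq_diff: "tc2_eq V p q \<Longrightarrow> tc2_eq V p' q' \<Longrightarrow> tc2_eq V (p - p') (q - q')"
  using fm.subspace_diff[OF subspace_tc2_rel, of "p - q" V "p' - q'"] by (simp add: tc2_eq_def algebra_simps)

lemma tc2_eq_sum: "(\<And>i. i \<in> I \<Longrightarrow> tc2_eq V (f i) (g i)) \<Longrightarrow> tc2_eq V (sum f I) (sum g I)"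
  using fm.subspace_sum[OF subspace_tc2_rel, of I "\<lambda>i. f i - g i" V] by (simp add: tc2_eq_def sum_subtractf)

lemma tc_eq_eq_trans [trans]:
  "tc_eq V p q \<Longrightarrow> q = r \<Longrightarrow> tc_eq V p r" "p = q \<Longrightarrow> tc_eq V q r \<Longrightarrow> tc_eq V p r"
  by simp_all

lemma tc2_eq_eq_trans [trans]:
  "tc2_eq V p q \<Longrightarrow> q = r \<Longrightarrow> tc2_eq V p r" "p = q \<Longrightarrow> tc2_eq V q r \<Longrightarrow> tc2_eq V p r"
  by simp_all

lemma tens_rel_left: "p \<in> tc_rel V \<Longrightarrow> tens p q \<in> tc2_rel V"
  unfolding tc2_rel_def by (auto intro!: fm.span_base)

lemma tens_rel_right: "q \<in> tc_rel V \<Longrightarrow> tens p q \<in> tc2_rel V"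
  unfolding tc2_rel_def by (auto intro!: fm.span_base)

lemma tc2_eq_tens:
  assumes "tc_eq V p p'" "tc_eq V q q'"
  shows "tc2_eq V (tens p q) (tens p' q')"
proof -
  have "tens (p - p') q \<in> tc2_rel V" "tens p' (q - q') \<in> tc2_rel V"
    using assms by (auto simp: tc_eq_def intro: tens_rel_left tens_rel_right)
  from fm.subspace_add[OF subspace_tc2_rel this] show ?thesis
    by (simp add: tc2_eq_def tens_simps)
qed

section \<open>Words\<close>

lemma rel_Nil: "basis [] \<in> tc_rel V"
  unfolding tc_rel_def by (rule fm.span_base) simp

lemma rel_add: "basis (u @ [x + y] @ v) - basis (u @ [x] @ v) - basis (u @ [y] @ v) \<in> tc_rel V"
  unfolding tc_rel_def by (rule fm.span_base) blast

lemma rel_scale: "basis (u @ [gscale V r x] @ v) - fscale r (basis (u @ [x] @ v)) \<in> tc_rel V"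
  unfolding tc_rel_def by (rule fm.span_base) blast

lemma tc_eq_word_add: "tc_eq V (basis (u @ [x + y] @ v)) (basis (u @ [x] @ v) + basis (u @ [y] @ v))"
  using rel_add[of u x y v V] by (simp add: tc_eq_def algebra_simps)

lemma tc_eq_word_scale: "tc_eq V (basis (u @ [gscale V r x] @ v)) (fscale r (basis (u @ [x] @ v)))"
  using rel_scale[of u V r x v] by (simp add: tc_eq_def)

lemma tc_eq_word_zero: "tc_eq V (basis (u @ [0] @ v)) 0"
  using tc_eq_word_add[of V u 0 0 v] by (simp add: tc_eq_def) (metis fm.subspace_neg minus_minus subspace_tc_rel)

lemma tc_eq_word_neg: "tc_eq V (basis (u @ [- x] @ v)) (- basis (u @ [x] @ v))"
proof -
  have "tc_eq V (basis (u @ [x] @ v) + basis (u @ [- x] @ v)) 0"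
    using tc_eq_trans[OF tc_eq_sym[OF tc_eq_word_add[of V u x "- x" v]]] tc_eq_word_zero[of V u v] by simp
  then show ?thesis by (simp add: tc_eq_def algebra_simps)
qed

lemma tc_eq_word_diff: "tc_eq V (basis (u @ [x - y] @ v)) (basis (u @ [x] @ v) - basis (u @ [y] @ v))"
  using tc_eq_trans[OF tc_eq_word_add[of V u x "- y" v] tc_eq_add[OF tc_eq_refl tc_eq_word_neg]] by simp

lemmas tc_eq_single =
  tc_eq_word_add[of _ "[]" _ _ "[]", simplified] tc_eq_word_scale[of _ "[]" _ _ "[]", simplified]
  tc_eq_word_zero[of _ "[]" "[]", simplified] tc_eq_word_diff[of _ "[]" _ _ "[]", simplified]

text \<open>The three kinds of generators of the relations give the three conditions: a map descends to the
  tensor coalgebra as soon as it is multilinear on words modulo \<open>S\<close>.\<close>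

lemma tc_rel_induct [consumes 3]:
  assumes "p \<in> tc_rel V" "module_hom fscale s f" "module.subspace s S"
    and "f (basis []) \<in> S"
    and "\<And>u x y v. f (basis (u @ [x + y] @ v)) - f (basis (u @ [x] @ v)) - f (basis (u @ [y] @ v)) \<in> S"
    and "\<And>u r x v. f (basis (u @ [gscale V r x] @ v)) - s r (f (basis (u @ [x] @ v))) \<in> S"
  shows "f p \<in> S"
proof -
  interpret module_hom fscale s f by fact
  show ?thesis
    using assms(1) unfolding tc_rel_def
    by (rule module_hom_mem_span[OF assms(2,3), rotated]) (auto simp: diff scale assms(4-) [simplified])
qed

text \<open>Left multiplication by a letter. The empty word is a relation, so it has to be sent to \<open>0\<close> and not
  to the one-letter word; otherwise the map would not descend to the tensor coalgebra.\<close>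

definition pcons :: "'a \<Rightarrow> ('a list \<Rightarrow>\<^sub>0 'r::comm_ring_1) \<Rightarrow> ('a list \<Rightarrow>\<^sub>0 'r)" where
  "pcons x = lin fscale (\<lambda>w. if w = [] then 0 else basis (x # w))"

lemma module_hom_pcons: "flinear (pcons x)"
  by (simp add: pcons_def module_fscale)

lemma pcons_basis [simp]: "pcons x (basis w) = (if w = [] then 0 else basis (x # w))"
  by (simp add: pcons_def module_fscale)

lemma pcons_rel: "p \<in> tc_rel V \<Longrightarrow> pcons x p \<in> tc_rel V"
  by (erule tc_rel_induct[OF _ module_hom_pcons])
    (use rel_add[of "x # _" _ _ _ V] rel_scale[of "x # _" V] in \<open>auto simp: fm.subspace_0\<close>)

lemma pcons_cong: "tc_eq V p q \<Longrightarrow> tc_eq V (pcons x p) (pcons x q)"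
  using pcons_rel[of "p - q" V x] by (simp add: tc_eq_def module_hom.diff[OF module_hom_pcons])

lemma pcons_add_left: "tc_eq V (pcons (x + y) p) (pcons x p + pcons y p)"
proof -
  have "flinear (\<lambda>p. pcons (x + y) p - (pcons x p + pcons y p))"
    by (intro module_hom_minus module_hom_plus module_hom_pcons)
  then have "pcons (x + y) p - (pcons x p + pcons y p) \<in> tc_rel V"
    by (rule module_hom_mem) (use tc_eq_word_add[of V "[]"] in \<open>auto simp: tc_eq_def fm.subspace_0\<close>)
  then show ?thesis by (simp add: tc_eq_def)
qed

lemma pcons_scale_left: "tc_eq V (pcons (gscale V r x) p) (fscale r (pcons x p))"
proof -
  have "flinear (\<lambda>p. pcons (gscale V r x) p - fscale r (pcons x p))"
    by (intro module_hom_minus module_hom_pcons module_hom_scaled)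
  then have "pcons (gscale V r x) p - fscale r (pcons x p) \<in> tc_rel V"
    by (rule module_hom_mem) (use tc_eq_word_scale[of V "[]"] in \<open>auto simp: tc_eq_def fm.subspace_0\<close>)
  then show ?thesis by (simp add: tc_eq_def)
qed

lemma pcons_zero_left: "tc_eq V (pcons 0 p) 0"
  using pcons_add_left[of V 0 0 p] fm.subspace_neg[OF subspace_tc_rel, of "- pcons 0 p" V] by (simp add: tc_eq_def)

section \<open>Graded modules and Koszul signs\<close>

lemma graded_module_module [dest]: "graded_module V \<Longrightarrow> module (gscale V)"
  by (simp add: graded_module_def)

lemma graded_module_subspace: "graded_module V \<Longrightarrow> module.subspace (gscale V) (gcomp V n)"
  by (simp add: graded_module_def)

lemma graded_module_zero: "graded_module V \<Longrightarrow> 0 \<in> gcomp V n"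
  using module.subspace_0[OF graded_module_module graded_module_subspace] .

lemma graded_module_decomp:
  assumes "graded_module V" obtains c where "is_decomp V x c"
  using assms unfolding graded_module_def by blast

lemma graded_module_sum_homogeneous:
  assumes "graded_module V"
  obtains K and c :: "int \<Rightarrow> 'a::ab_group_add"
    where "finite K" "\<And>n. c n \<in> gcomp V n" "x = sum c K"
proof -
  obtain c where "is_decomp V x c" using graded_module_decomp[OF assms] .
  then show ?thesis using that[of "Poly_Mapping.keys c" "Poly_Mapping.lookup c"]
    by (simp add: is_decomp_def)
qed

lemma graded_hom_eqI:
  assumes "graded_module V" "module_hom (gscale V) s f" "module_hom (gscale V) s g"
    and "\<And>n x. x \<in> gcomp V n \<Longrightarrow> f x = g x"
  shows "f x = g x"
proof -
  obtain K c where "finite K" "\<And>n. c n \<in> gcomp V n" "x = sum c K"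
    using graded_module_sum_homogeneous[OF assms(1)] by metis
  then show ?thesis
    using assms(4) by (auto simp: module_hom.sum[OF assms(2)] module_hom.sum[OF assms(3)] intro!: sum.cong)
qed

lemma gsign_eq:
  assumes "graded_module V" "is_decomp V x c"
  shows "gsign V x = (\<Sum>n\<in>Poly_Mapping.keys c.
    if even n then Poly_Mapping.lookup c n else - Poly_Mapping.lookup c n)"
proof -
  have "(THE c. is_decomp V x c) = c"
    using assms unfolding graded_module_def by (intro the1_equality) auto
  then show ?thesis by (simp add: gsign_def)
qed

lemma gsign_homogeneous:
  assumes "graded_module V" "x \<in> gcomp V n"
  shows "gsign V x = (if even n then x else - x)"
proof -
  have "is_decomp V x (Poly_Mapping.single n x)"
    using assms graded_module_zero[OF assms(1)]
    by (cases "x = 0") (auto simp: is_decomp_def lookup_single when_def)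
  from gsign_eq[OF assms(1) this] show ?thesis by (cases "x = 0") auto
qed

lemma is_decomp_add:
  assumes V: "graded_module V" and "is_decomp V x c" "is_decomp V y d"
  shows "is_decomp V (x + y) (c + d)"
proof -
  interpret module "gscale V" using V by auto
  let ?K = "Poly_Mapping.keys c \<union> Poly_Mapping.keys d"
  have 1: "(\<Sum>n\<in>Poly_Mapping.keys (c + d). Poly_Mapping.lookup (c + d) n) = (\<Sum>n\<in>?K. Poly_Mapping.lookup (c + d) n)"
    by (rule sum.mono_neutral_left) (use Poly_Mapping.keys_add[of c d] in \<open>auto simp: in_keys_iff\<close>)
  have 2: "(\<Sum>n\<in>Poly_Mapping.keys c. Poly_Mapping.lookup c n) = (\<Sum>n\<in>?K. Poly_Mapping.lookup c n)"
    by (rule sum.mono_neutral_left) (auto simp: in_keys_iff)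
  have 3: "(\<Sum>n\<in>Poly_Mapping.keys d. Poly_Mapping.lookup d n) = (\<Sum>n\<in>?K. Poly_Mapping.lookup d n)"
    by (rule sum.mono_neutral_left) (auto simp: in_keys_iff)
  show ?thesis
    using assms graded_module_subspace[OF V]
    by (auto simp: is_decomp_def 1[unfolded lookup_add sum.distrib] 2 3 lookup_add sum.distrib intro!: subspace_add)
qed

lemma is_decomp_scale:
  assumes V: "graded_module V" and "is_decomp V x c"
  shows "is_decomp V (gscale V r x) (Poly_Mapping.map (gscale V r) c)"
proof -
  interpret module "gscale V" using V by auto
  have l: "Poly_Mapping.lookup (Poly_Mapping.map (gscale V r) c) n = gscale V r (Poly_Mapping.lookup c n)" for n
    by (simp add: Poly_Mapping.map.rep_eq when_def)
  have 1: "(\<Sum>n\<in>Poly_Mapping.keys (Poly_Mapping.map (gscale V r) c). gscale V r (Poly_Mapping.lookup c n))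
     = (\<Sum>n\<in>Poly_Mapping.keys c. gscale V r (Poly_Mapping.lookup c n))"
    by (rule sum.mono_neutral_left) (auto simp: in_keys_iff l)
  show ?thesis
    using assms graded_module_subspace[OF V]
    by (auto simp: is_decomp_def l 1 scale_sum_right intro!: subspace_scale)
qed

lemma module_hom_gsign:
  assumes V: "graded_module V"
  shows "module_hom (gscale V) (gscale V) (gsign V)"
proof -
  interpret module "gscale V" using V by auto
  define g where "g c = (\<Sum>n\<in>Poly_Mapping.keys c.
    if even n then Poly_Mapping.lookup c n else - Poly_Mapping.lookup c n)" for c :: "int \<Rightarrow>\<^sub>0 'b"
  have gK: "g c = (\<Sum>n\<in>K. if even n then Poly_Mapping.lookup c n else - Poly_Mapping.lookup c n)"
    if "finite K" "Poly_Mapping.keys c \<subseteq> K" for c K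
    unfolding g_def using that by (intro sum.mono_neutral_left) (auto simp: in_keys_iff)
  show ?thesis
  proof
    fix x y :: 'b and r
    obtain c d where cd: "is_decomp V x c" "is_decomp V y d"
      using graded_module_decomp[OF V] by metis
    let ?K = "Poly_Mapping.keys c \<union> Poly_Mapping.keys d"
    have "g (c + d) = g c + g d"
      using Poly_Mapping.keys_add[of c d] 
      by (subst (1 2 3) gK[of ?K]) (auto simp: lookup_add sum.distrib[symmetric] intro!: sum.cong)
    then show "gsign V (x + y) = gsign V x + gsign V y"
      using gsign_eq[OF V] cd is_decomp_add[OF V cd] by (simp add: g_def)
    have l: "Poly_Mapping.lookup (Poly_Mapping.map (gscale V r) c) n = gscale V r (Poly_Mapping.lookup c n)" for n
      by (simp add: Poly_Mapping.map.rep_eq when_def)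
    have "g (Poly_Mapping.map (gscale V r) c) = gscale V r (g c)"
      by (subst (1 2) gK[of "Poly_Mapping.keys c"])
        (auto simp: in_keys_iff l scale_sum_right intro!: sum.cong)
    then show "gsign V (gscale V r x) = gscale V r (gsign V x)"
      using gsign_eq[OF V cd(1)] gsign_eq[OF V is_decomp_scale[OF V cd(1), of r]] by (simp only: g_def)
  qed
qed

lemma gsign_gcomp: "graded_module V \<Longrightarrow> x \<in> gcomp V n \<Longrightarrow> gsign V x \<in> gcomp V n"
  by (simp add: gsign_homogeneous module.subspace_neg[OF graded_module_module graded_module_subspace])

lemma gsign_gsign [simp]: "graded_module V \<Longrightarrow> gsign V (gsign V x) = x"
  by (rule graded_hom_eqI[of V "gscale V" "\<lambda>x. gsign V (gsign V x)"])
    (auto intro: module_hom_comp module_hom_gsign module_hom_same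
      simp: gsign_homogeneous gsign_gcomp module_hom.neg[OF module_hom_gsign])

abbreviation pm :: "int \<Rightarrow> 'a::ab_group_add \<Rightarrow> 'a" where
  "pm n x \<equiv> if even n then x else - x"

lemma module_hom_tc_sign: "flinear (tc_sign V)"
  by (simp add: tc_sign_def module_fscale)

lemma tc_sign_basis [simp]: "tc_sign V (basis w) = basis (map (gsign V) w)"
  by (simp add: tc_sign_def module_fscale)

lemma tc_sign_rel:
  assumes "graded_module V" "p \<in> tc_rel V"
  shows "tc_sign V p \<in> tc_rel V"
  using assms(2) module_hom_tc_sign subspace_tc_rel
proof (rule tc_rel_induct)
  fix u v x y r
  show "tc_sign V (basis (u @ [x + y] @ v)) - tc_sign V (basis (u @ [x] @ v)) -
       tc_sign V (basis (u @ [y] @ v)) \<in> tc_rel V"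
    using rel_add by (simp add: module_hom.add[OF module_hom_gsign[OF assms(1)]])
  show "tc_sign V (basis (u @ [gscale V r x] @ v)) - fscale r (tc_sign V (basis (u @ [x] @ v))) \<in> tc_rel V"
    using rel_scale by (simp add: module_hom.scale[OF module_hom_gsign[OF assms(1)]])
qed (use rel_Nil in simp)

lemma tc_sign_tc_sign [simp]:
  assumes "graded_module V" shows "tc_sign V (tc_sign V p) = p"
proof (rule module_hom_eqI[where f = "\<lambda>p. tc_sign V (tc_sign V p)"])
  show "flinear (\<lambda>p. tc_sign V (tc_sign V p))"
    by (rule module_hom_comp[OF module_hom_tc_sign module_hom_tc_sign])
  have "gsign V \<circ> gsign V = id" using assms by auto
  then show "tc_sign V (tc_sign V (basis w)) = basis w" for w by simp
qed (rule module_hom_same[OF module_fscale])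

lemma tc_sign_homogeneous_word:
  assumes V: "graded_module V" and w: "list_all2 (\<lambda>x d. x \<in> gcomp V d) w ds"
  shows "tc_eq V (basis (u @ map (gsign V) w)) (pm (sum_list ds) (basis (u @ w)))"
  using w
proof (induction w ds arbitrary: u)
  case Nil
  then show ?case by simp
next
  case (Cons x w d ds)
  have 1: "tc_eq V (basis (u @ map (gsign V) (x # w))) (pm (sum_list ds) (basis (u @ gsign V x # w)))"
    using Cons.IH[of "u @ [gsign V x]"] by (simp split: if_splits)
  have "gsign V x = pm d x" using gsign_homogeneous[OF V] Cons by simp
  then have "tc_eq V (basis (u @ gsign V x # w)) (pm d (basis (u @ x # w)))"
    using tc_eq_word_neg[of V u x w] by simp
  then have "tc_eq V (pm (sum_list ds) (basis (u @ gsign V x # w))) (pm (sum_list ds) (pm d (basis (u @ x # w))))"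
    using tc_eq_diff[of V 0 0] by simp
  from tc_eq_trans[OF 1 this] show ?case
    by (simp split: if_splits)
qed

lemma tc_comp_span_induct [consumes 3, case_names rel word]:
  assumes "p \<in> tc_comp V n" "module_hom fscale s f" "module.subspace s S"
    and "\<And>p. p \<in> tc_rel V \<Longrightarrow> f p \<in> S"
    and "\<And>w ds. list_all2 (\<lambda>x d. x \<in> gcomp V d) w ds \<Longrightarrow> n = sum_list ds \<Longrightarrow> f (basis w) \<in> S"
  shows "f p \<in> S"
  using assms(1) unfolding tc_comp_def
  by (rule module_hom_mem_span[OF assms(2,3), rotated]) (auto simp: assms(4,5))

lemma tc_rel_comp: "p \<in> tc_rel V \<Longrightarrow> p \<in> tc_comp V n"
  unfolding tc_comp_def by (rule fm.span_base) simp

lemma word_tc_comp: "list_all2 (\<lambda>x d. x \<in> gcomp V d) w ds \<Longrightarrow> basis w \<in> tc_comp V (sum_list ds)"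
  unfolding tc_comp_def by (rule fm.span_base) blast

lemma tc_comp_cong: "tc_eq V p q \<Longrightarrow> p \<in> tc_comp V n \<longleftrightarrow> q \<in> tc_comp V n"
  using fm.subspace_add[OF subspace_tc_comp, of "p - q" V n q]
    fm.subspace_diff[OF subspace_tc_comp, of p V n "p - q"]
  by (auto simp: tc_eq_def tc_rel_comp)

lemma module_hom_pm: "module s' \<Longrightarrow> module_hom s s' f \<Longrightarrow> module_hom s s' (\<lambda>x. pm n (f x))"
  using module_hom_minus[of s s' "\<lambda>x. 0" f]
  by (cases "even n") (auto simp: module_hom_zero_fun module_hom_imp_module)

lemma tc_sign_comp:
  assumes V: "graded_module V" and p: "p \<in> tc_comp V n"
  shows "tc_eq V (tc_sign V p) (pm n p)"
proof -
  have "tc_sign V p - pm n p \<in> tc_rel V"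
    using p 
  proof (rule tc_comp_span_induct)
    show "flinear (\<lambda>p. tc_sign V p - pm n p)"
      by (intro module_hom_minus module_hom_tc_sign module_hom_pm module_hom_same module_fscale)
    show "p \<in> tc_rel V \<Longrightarrow> tc_sign V p - pm n p \<in> tc_rel V" for p
      using tc_sign_rel[OF V] by (auto intro: fm.subspace_add fm.subspace_diff)
    show "tc_sign V (basis w) - pm n (basis w) \<in> tc_rel V"
      if "list_all2 (\<lambda>x d. x \<in> gcomp V d) w ds" "n = sum_list ds" for w ds
      using tc_sign_homogeneous_word[OF V that(1), of "[]"] that(2) by (simp add: tc_eq_def split: if_splits)
  qed simp
  then show ?thesis by (simp add: tc_eq_def)
qed

text \<open>Letters are replaced by the sums of their homogeneous components one after the other, from left to
  right. This reduces statements about signs to homogeneous words, where signs are numbers.\<close>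

lemma homogeneous_span:
  assumes V: "graded_module V"
  shows "p \<in> fm.span (\<Union>n. tc_comp V n)"
proof -
  have w: "basis (u @ v) \<in> fm.span (\<Union>n. tc_comp V n)"
    if "list_all2 (\<lambda>x d. x \<in> gcomp V d) u ds" for u v ds
    using that
  proof (induction v arbitrary: u ds)
    case Nil
    then show ?case using word_tc_comp by (fastforce intro: fm.span_base)
  next
    case (Cons x v)
    obtain K c where K: "finite K" and c: "\<And>n. c n \<in> gcomp V n" and x: "x = sum c K"
      using graded_module_sum_homogeneous[OF V] by metis
    have "basis (u @ [sum c K] @ v) \<in> fm.span (\<Union>n. tc_comp V n)"
      using K
    proof (induction K)
      case empty
      have "basis (u @ [0] @ v) \<in> tc_rel V"
        using tc_eq_word_zero[of V u v] by (simp add: tc_eq_def)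
      then show ?case using tc_rel_comp by (auto intro!: fm.span_base)
    next
      case (insert n K)
      have "basis ((u @ [c n]) @ v) \<in> fm.span (\<Union>n. tc_comp V n)"
        by (rule Cons.IH[of _ "ds @ [n]"]) (use Cons.prems c in \<open>auto intro: list_all2_appendI\<close>)
      moreover have "basis (u @ [c n + sum c K] @ v) - basis (u @ [c n] @ v) - basis (u @ [sum c K] @ v)
          \<in> fm.span (\<Union>n. tc_comp V n)"
        by (rule fm.span_base) (use rel_add tc_rel_comp in fast)
      ultimately have "(basis (u @ [c n + sum c K] @ v) - basis (u @ [c n] @ v) - basis (u @ [sum c K] @ v))
          + basis ((u @ [c n]) @ v) + basis (u @ [sum c K] @ v) \<in> fm.span (\<Union>n. tc_comp V n)"
        using insert.IH by (intro fm.span_add)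
      then show ?case using insert.hyps by simp
    qed
    then show ?case using x by simp
  qed
  show ?thesis
    by (rule module_hom_mem[OF module_hom_same[OF module_fscale]])
      (use w[of "[]" "[]"] in auto)
qed

lemma homogeneous_tc_eqI:
  assumes "graded_module V" "flinear f" "flinear g"
    and "\<And>n p. p \<in> tc_comp V n \<Longrightarrow> tc_eq W (f p) (g p)"
  shows "tc_eq W (f p) (g p)"
proof -
  have "(\<lambda>p. f p - g p) p \<in> tc_rel W"
    by (rule module_hom_mem_span[OF module_hom_minus[OF assms(2,3)] _ _ homogeneous_span[OF assms(1)]])
      (use assms(4) in \<open>auto simp: tc_eq_def\<close>)
  then show ?thesis by (simp add: tc_eq_def)
qed

section \<open>Maps of tensor coalgebras\<close>

lemma tc_hom_module_hom: "tc_hom V W d f \<Longrightarrow> flinear f"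
  by (simp add: tc_hom_def)

lemma tc_hom_rel: "tc_hom V W d f \<Longrightarrow> p \<in> tc_rel V \<Longrightarrow> f p \<in> tc_rel W"
  by (auto simp: tc_hom_def)

lemma tc_hom_comp_mem: "tc_hom V W d f \<Longrightarrow> p \<in> tc_comp V n \<Longrightarrow> f p \<in> tc_comp W (n + d)"
  by (auto simp: tc_hom_def image_subset_iff)

lemma tc_hom_cong: "tc_hom V W d f \<Longrightarrow> tc_eq V p q \<Longrightarrow> tc_eq W (f p) (f q)"
  using tc_hom_rel[of V W d f "p - q"] by (simp add: tc_eq_def module_hom.diff[OF tc_hom_module_hom])

lemma tc_hom_compose:
  assumes "tc_hom V W d f" "tc_hom W X e g"
  shows "tc_hom V X (d + e) (\<lambda>p. g (f p))"
  unfolding tc_hom_def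
proof (intro conjI allI subsetI)
  show "flinear (\<lambda>p. g (f p))"
    using assms by (auto intro: module_hom_comp tc_hom_module_hom)
qed (use assms in \<open>force simp: tc_hom_def add.assoc[symmetric]\<close>)+

lemma tc_hom_id: "tc_hom V V 0 id"
  by (simp add: tc_hom_def module.module_hom_id[OF module_fscale])

lemma tc_hom_diff:
  assumes "tc_hom V W d f" "tc_hom V W d g"
  shows "tc_hom V W d (\<lambda>p. f p - g p)"
  unfolding tc_hom_def
proof (intro conjI allI)
  show "flinear (\<lambda>p. f p - g p)"
    using assms by (auto intro: module_hom_minus tc_hom_module_hom)
qed (use assms in \<open>auto intro!: fm.subspace_diff simp: tc_hom_def image_subset_iff\<close>)

lemma tc_hom_plus:
  assumes "tc_hom V W d f" "tc_hom V W d g"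
  shows "tc_hom V W d (\<lambda>p. f p + g p)"
  unfolding tc_hom_def
proof (intro conjI allI)
  show "flinear (\<lambda>p. f p + g p)"
    using assms by (auto intro: module_hom_plus tc_hom_module_hom)
qed (use assms in \<open>auto intro!: fm.subspace_add simp: tc_hom_def image_subset_iff\<close>)

lemma tc_hom_zero: "tc_hom V W d (\<lambda>p. 0)"
  unfolding tc_hom_def by (auto simp: fm.subspace_0 module_hom_zero_fun module_fscale)

text \<open>The sign acts on the part of degree \<open>n\<close> as \<open>(-1)\<^sup>n\<close>, and a map of degree \<open>d\<close> shifts degrees by \<open>d\<close>. This is
  where the Koszul signs of the final computations come from.\<close>

lemma tc_sign_comm:
  assumes V: "graded_module V" and W: "graded_module W" and f: "tc_hom V W d f"
  shows "tc_eq W (tc_sign W (f p)) (pm d (f (tc_sign V p)))"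
proof (rule homogeneous_tc_eqI[OF V, where f = "\<lambda>p. tc_sign W (f p)" and g = "\<lambda>p. pm d (f (tc_sign V p))"])
  note hf = tc_hom_module_hom[OF f]
  show "flinear (\<lambda>p. tc_sign W (f p))"
    by (rule module_hom_comp[OF hf module_hom_tc_sign])
  show "flinear (\<lambda>p. pm d (f (tc_sign V p)))"
    by (intro module_hom_pm module_fscale module_hom_comp[OF module_hom_tc_sign hf])
  fix n p assume p: "p \<in> tc_comp V n"
  have "tc_eq W (tc_sign W (f p)) (pm (n + d) (f p))"
    by (rule tc_sign_comp[OF W tc_hom_comp_mem[OF f p]])
  also have "pm (n + d) (f p) = pm d (f (pm n p))"
    by (auto simp: module_hom.neg[OF hf])
  also have "tc_eq W \<dots> (pm d (f (tc_sign V p)))"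
    using tc_hom_cong[OF f tc_eq_sym[OF tc_sign_comp[OF V p]]] tc_eq_diff[of W 0 0] by auto
  finally show "tc_eq W (tc_sign W (f p)) (pm d (f (tc_sign V p)))" .
qed

text \<open>The sign that a map of degree \<open>d\<close> produces when it passes its argument.\<close>

definition koszul where
  "koszul V (d::int) p = (if even d then p else tc_sign V p)"

lemma module_hom_koszul: "flinear (koszul V d)"
  by (cases "even d") (auto simp: koszul_def[abs_def] module_hom_tc_sign module_hom_same module_fscale)

lemma tc_hom_sign:
  assumes V: "graded_module V" shows "tc_hom V V 0 (tc_sign V)"
proof -
  have "tc_sign V p \<in> tc_comp V n" if "p \<in> tc_comp V n" for p n
    using tc_comp_cong[OF tc_sign_comp[OF V that], of n] that by (simp add: fm.subspace_neg split: if_splits)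
  then show ?thesis
    using tc_sign_rel[OF V] by (auto simp: tc_hom_def module_hom_tc_sign)
qed

lemma tc_hom_koszul: "graded_module V \<Longrightarrow> tc_hom V V 0 (koszul V d)"
  using tc_hom_id[of V] by (cases "even d") (simp_all add: koszul_def[abs_def] tc_hom_sign id_def)

lemma koszul_word: "\<exists>w'. length w' = length w \<and> koszul V d (basis w) = basis w'"
  by (cases "even d") (auto simp: koszul_def intro: exI[of _ "map (gsign V) w"])

lemma module_hom_tens_map: "flinear (tens_map V d \<alpha> \<beta>)"
  by (simp add: tens_map_def module_fscale)

lemma tens_map_tens:
  assumes "flinear \<alpha>" "flinear \<beta>"
  shows "tens_map V d \<alpha> \<beta> (tens p q) = tens (\<alpha> (koszul V d p)) (\<beta> q)"
proof (rule bilinear_tens_eqI[OF module_hom_tens_map])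
  show "flinear (\<lambda>p. tens (\<alpha> (koszul V d p)) (\<beta> q))" for q
    by (rule module_hom_comp[OF _ module_hom_tens_left]) (rule module_hom_comp[OF module_hom_koszul assms(1)])
  show "flinear (\<lambda>q. tens (\<alpha> (koszul V d p)) (\<beta> q))" for p
    by (rule module_hom_comp[OF assms(2) module_hom_tens_right])
qed (simp add: tens_map_def koszul_def module_fscale)

lemma tens_map_rel:
  assumes V: "graded_module V" and \<alpha>: "tc_hom V W e \<alpha>" and \<beta>: "tc_hom V W e' \<beta>" and "p \<in> tc2_rel V"
  shows "tens_map V d \<alpha> \<beta> p \<in> tc2_rel W"
  using assms(4) unfolding tc2_rel_def[of V]
proof (rule module_hom_mem_span[OF module_hom_tens_map, rotated 2])
  note t = tens_map_tens[OF tc_hom_module_hom[OF \<alpha>] tc_hom_module_hom[OF \<beta>]]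
  fix x assume "x \<in> {tens p q |p q. p \<in> tc_rel V} \<union> {tens p q |p q. q \<in> tc_rel V}"
  then show "tens_map V d \<alpha> \<beta> x \<in> tc2_rel W"
    using tens_rel_left[OF tc_hom_rel[OF \<alpha> tc_hom_rel[OF tc_hom_koszul[OF V]]]]
      tens_rel_right[OF tc_hom_rel[OF \<beta>]]
    by (auto simp: t)
qed simp

lemma tens_map_cong:
  assumes V: "graded_module V" and \<alpha>: "tc_hom V W e \<alpha>" and \<beta>: "tc_hom V W e' \<beta>" and "tc2_eq V p q"
  shows "tc2_eq W (tens_map V d \<alpha> \<beta> p) (tens_map V d \<alpha> \<beta> q)"
  using tens_map_rel[OF assms(1-3), of "p - q" d] assms(4)
  by (simp add: tc2_eq_def module_hom.diff[OF module_hom_tens_map])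

section \<open>Deconcatenation\<close>

lemma module_hom_deconc: "flinear deconc"
  by (simp add: deconc_def module_fscale)

lemma deconc_basis:
  "deconc (basis w) = (\<Sum>i\<in>{1..<length w}. tens (basis (take i w)) (basis (drop i w)))"
  by (simp add: deconc_def module_fscale)

lemma tens_cut:
  "tens (basis (take i (u @ [z] @ v))) (basis (drop i (u @ [z] @ v))) =
    (if i \<le> length u then tens (basis (take i u)) (basis (drop i u @ [z] @ v))
     else tens (basis (u @ [z] @ take (i - Suc (length u)) v)) (basis (drop (i - Suc (length u)) v)))"
proof (cases "i \<le> length u")
  case False
  then obtain m where "i = Suc (length u) + m" using less_imp_Suc_add[of "length u" i] by auto
  then show ?thesis by simp
qed simp

text \<open>Cutting a word with a distinguished letter leaves that letter in one of the two factors, where a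
  multilinearity relation remains one.\<close>

lemma deconc_rel:
  assumes "p \<in> tc_rel V" shows "deconc p \<in> tc2_rel V"
  using assms module_hom_deconc subspace_tc2_rel
proof (rule tc_rel_induct)
  show "deconc (basis []) \<in> tc2_rel V" by (simp add: deconc_basis fm.subspace_0)
next
  fix u v :: "'a list" and x y r
  let ?T = "\<lambda>z i. tens (basis (take i (u @ [z] @ v))) (basis (drop i (u @ [z] @ v)))"
  have "?T (x + y) i - ?T x i - ?T y i \<in> tc2_rel V" for i
    unfolding tens_cut using tens_rel_left[OF rel_add] tens_rel_right[OF rel_add]
    by (cases "i \<le> length u") (simp_all only: tens_simps if_True if_False)
  then have "(\<Sum>i\<in>{1..<length (u @ [x] @ v)}. ?T (x + y) i - ?T x i - ?T y i) \<in> tc2_rel V"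
    by (intro fm.subspace_sum) auto
  then show "deconc (basis (u @ [x + y] @ v)) - deconc (basis (u @ [x] @ v)) - deconc (basis (u @ [y] @ v)) \<in> tc2_rel V"
    by (simp add: deconc_basis sum_subtractf del: sum.op_ivl_Suc)
  have "?T (gscale V r x) i - fscale r (?T x i) \<in> tc2_rel V" for i
    unfolding tens_cut using tens_rel_left[OF rel_scale] tens_rel_right[OF rel_scale]
    by (cases "i \<le> length u") (simp_all only: tens_simps if_True if_False)
  then have "(\<Sum>i\<in>{1..<length (u @ [x] @ v)}. ?T (gscale V r x) i - fscale r (?T x i)) \<in> tc2_rel V"
    by (intro fm.subspace_sum) auto
  then show "deconc (basis (u @ [gscale V r x] @ v)) - fscale r (deconc (basis (u @ [x] @ v))) \<in> tc2_rel V"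
    by (simp add: deconc_basis sum_subtractf fm.scale_sum_right del: sum.op_ivl_Suc)
qed

section \<open>Functionals on the tensor coalgebra\<close>

text \<open>Linear maps of degree \<open>d\<close> from the tensor coalgebra to a graded module; the components of coalgebra
  morphisms, coderivations and homotopies are of this kind, with all arities collected in one map.\<close>

definition tc_fun ::
    "('r::comm_ring_1, 'a::ab_group_add, 'm) graded_mod_scheme \<Rightarrow>
     ('r, 'b::ab_group_add, 'n) graded_mod_scheme \<Rightarrow> int \<Rightarrow> (('a list \<Rightarrow>\<^sub>0 'r) \<Rightarrow> 'b) \<Rightarrow> bool" where
  "tc_fun V W d f \<longleftrightarrow>
     module_hom fscale (gscale W) f \<and> (\<forall>p\<in>tc_rel V. f p = 0) \<and>
     (\<forall>n. f ` tc_comp V n \<subseteq> gcomp W (n + d))"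

lemma tc_fun_module_hom: "tc_fun V W d f \<Longrightarrow> module_hom fscale (gscale W) f"
  by (simp add: tc_fun_def)

lemma tc_fun_rel: "tc_fun V W d f \<Longrightarrow> p \<in> tc_rel V \<Longrightarrow> f p = 0"
  by (simp add: tc_fun_def)

lemma tc_fun_mem: "tc_fun V W d f \<Longrightarrow> p \<in> tc_comp V n \<Longrightarrow> f p \<in> gcomp W (n + d)"
  by (auto simp: tc_fun_def image_subset_iff)

lemma tc_fun_cong: "tc_fun V W d f \<Longrightarrow> tc_eq V p q \<Longrightarrow> f p = f q"
  using tc_fun_rel[of V W d f "p - q"] by (simp add: tc_eq_def module_hom.diff[OF tc_fun_module_hom])

lemma tc_fun_tc_hom:
  assumes "tc_hom V W d f" "tc_fun W X e g" "k = d + e"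
  shows "tc_fun V X k (\<lambda>p. g (f p))"
  unfolding tc_fun_def
proof (intro conjI ballI allI subsetI)
  show "module_hom fscale (gscale X) (\<lambda>p. g (f p))"
    using assms by (auto intro: module_hom_comp tc_hom_module_hom tc_fun_module_hom)
  show "g (f p) = 0" if "p \<in> tc_rel V" for p
    using tc_fun_rel[OF assms(2) tc_hom_rel[OF assms(1) that]] .
  fix n x assume "x \<in> (\<lambda>p. g (f p)) ` tc_comp V n"
  then show "x \<in> gcomp X (n + k)"
    using tc_fun_mem[OF assms(2) tc_hom_comp_mem[OF assms(1)]] assms(3) by (auto simp: add.assoc)
qed

lemma tc_fun_graded_hom:
  assumes "tc_fun V W d f" "graded_hom W X e g" "k = d + e"
  shows "tc_fun V X k (\<lambda>p. g (f p))"
  unfolding tc_fun_def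
proof (intro conjI ballI allI subsetI)
  have g: "module_hom (gscale W) (gscale X) g" using assms(2) by (simp add: graded_hom_def)
  show "module_hom fscale (gscale X) (\<lambda>p. g (f p))"
    using assms g by (auto intro: module_hom_comp tc_fun_module_hom)
  show "g (f p) = 0" if "p \<in> tc_rel V" for p
    using tc_fun_rel[OF assms(1) that] by (simp add: module_hom.zero[OF g])
  fix n x assume "x \<in> (\<lambda>p. g (f p)) ` tc_comp V n"
  then show "x \<in> gcomp X (n + k)"
    using tc_fun_mem[OF assms(1)] assms(2,3) by (auto simp: graded_hom_def add.assoc[symmetric])
qed

lemma tc_fun_plus:
  assumes W: "graded_module W" and "tc_fun V W d f" "tc_fun V W d g"
  shows "tc_fun V W d (\<lambda>p. f p + g p)"
  unfolding tc_fun_def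
proof (intro conjI ballI allI subsetI)
  show "module_hom fscale (gscale W) (\<lambda>p. f p + g p)"
    using assms by (auto intro: module_hom_plus tc_fun_module_hom)
qed (use assms module.subspace_add[OF graded_module_module graded_module_subspace, OF W W]
  in \<open>auto simp: tc_fun_def image_subset_iff\<close>)

lemma tc_fun_diff:
  assumes W: "graded_module W" and "tc_fun V W d f" "tc_fun V W d g"
  shows "tc_fun V W d (\<lambda>p. f p - g p)"
  unfolding tc_fun_def
proof (intro conjI ballI allI subsetI)
  show "module_hom fscale (gscale W) (\<lambda>p. f p - g p)"
    using assms by (auto intro: module_hom_minus tc_fun_module_hom)
qed (use assms module.subspace_diff[OF graded_module_module graded_module_subspace, OF W W]
  in \<open>auto simp: tc_fun_def image_subset_iff\<close>)

lemma module_hom_tc_proj: "module (gscale V) \<Longrightarrow> module_hom fscale (gscale V) (tc_proj V)"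
  by (simp add: tc_proj_def)

lemma tc_proj_basis [simp]:
  "module (gscale V) \<Longrightarrow> tc_proj V (basis w) = (if length w = 1 then hd w else 0)"
  by (simp add: tc_proj_def)

lemma tc_fun_proj:
  assumes V: "graded_module V"
  shows "tc_fun V V 0 (tc_proj V)"
proof -
  interpret module "gscale V" using V by auto
  note h = module_hom_tc_proj[OF module_axioms]
  have 1: "tc_proj V p \<in> {0}" if "p \<in> tc_rel V" for p
    using that h subspace_single_0
    by (rule tc_rel_induct) (auto simp: module_axioms Cons_eq_append_conv)
  have 2: "tc_proj V p \<in> gcomp V n" if "p \<in> tc_comp V n" for p n
    using that h graded_module_subspace[OF V]
  proof (rule tc_comp_span_induct)
    fix w ds assume "list_all2 (\<lambda>x d. x \<in> gcomp V d) w ds" "n = sum_list ds"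
    then show "tc_proj V (basis w) \<in> gcomp V n"
      using graded_module_zero[OF V]
      by (cases w; cases ds) (auto simp: module_axioms)
  qed (use 1 graded_module_zero[OF V] in force)
  show ?thesis using 1 2 h by (auto simp: tc_fun_def)
qed

lemma tc_proj_cong: "graded_module V \<Longrightarrow> tc_eq V p q \<Longrightarrow> tc_proj V p = tc_proj V q"
  by (rule tc_fun_cong[OF tc_fun_proj])

lemma tc_proj_pcons [simp]: 
  assumes "module (gscale V)" shows "tc_proj V (pcons x p) = 0"
  by (rule module_hom_eqI[where f = "\<lambda>p. tc_proj V (pcons x p)"])
   (auto intro: module_hom_comp[OF module_hom_pcons module_hom_tc_proj] module_hom_zero_fun
     simp: assms module_fscale module_hom.zero[OF module_hom_tc_proj])

text \<open>The maps \<open>p \<mapsto> [a p]\<close> and \<open>p \<mapsto> [b p] X q\<close> that insert the value of a functional as a letter are linear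
  only modulo the relations, so the comparison with their linear extensions from words is a congruence.\<close>

lemma tc_eq_linear_extension:
  assumes f: "flinear f"
    and g: "\<And>p q. tc_eq W (g (p + q)) (g p + g q)" "\<And>r p. tc_eq W (g (fscale r p)) (fscale r (g p))"
    and fg: "\<And>w. tc_eq W (f (basis w)) (g (basis w))"
  shows "tc_eq W (f p) (g p)"
proof -
  interpret module_hom fscale fscale f by fact
  have g0: "tc_eq W (g 0) 0" using g(2)[of 0 0] by simp
  have sc: "tc_eq W (fscale r x) (fscale r y)" if "tc_eq W x y" for r x y
    using fm.subspace_scale[OF subspace_tc_rel, of "x - y" W r] that by (simp add: tc_eq_def fm.scale_right_diff_distrib)
  have "tc_eq W (f (\<Sum>w\<in>K. fscale (c w) (basis w))) (g (\<Sum>w\<in>K. fscale (c w) (basis w)))" if "finite K" for K c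
    using that
  proof induction
    case empty
    then show ?case using tc_eq_sym[OF g0] by simp
  next
    case (insert w K)
    have "tc_eq W (fscale (c w) (f (basis w)) + f (\<Sum>w\<in>K. fscale (c w) (basis w)))
      (g (fscale (c w) (basis w)) + g (\<Sum>w\<in>K. fscale (c w) (basis w)))"
      by (rule tc_eq_add[OF tc_eq_trans[OF sc[OF fg] tc_eq_sym[OF g(2)]] insert.IH])
    from tc_eq_trans[OF this tc_eq_sym[OF g(1)]] show ?case
      using insert.hyps by (simp add: add scale)
  qed
  from this[of "Poly_Mapping.keys p" "Poly_Mapping.lookup p"] show ?thesis
    by (simp add: fsum_basis[symmetric])
qed

lemma single_linear_extension:
  assumes "flinear f" "module_hom fscale (gscale W) a"
    and "\<And>w. tc_eq W (f (basis w)) (basis [a (basis w)])"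
  shows "tc_eq W (f p) (basis [a p])"
  by (rule tc_eq_linear_extension[where g = "\<lambda>p. basis [a p]"])
    (use assms tc_eq_single in \<open>auto simp: module_hom.add[OF assms(2)] module_hom.scale[OF assms(2)]\<close>)

lemma single_zero: "tc_eq V (basis [0]) 0"
  using tc_eq_single(3) .

text \<open>The map \<open>p \<otimes> q \<mapsto> b p \<cdot> X q\<close> from the tensor square to the tensor coalgebra, where \<open>b p\<close> is a single
  letter. For \<open>b\<close> the projection and \<open>X\<close> the identity it is a partial inverse of the coproduct.\<close>

definition hprod ::
    "(('a list \<Rightarrow>\<^sub>0 'r::comm_ring_1) \<Rightarrow> 'b) \<Rightarrow> (('a list \<Rightarrow>\<^sub>0 'r) \<Rightarrow> ('b list \<Rightarrow>\<^sub>0 'r)) \<Rightarrow>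
     ('a list \<times> 'a list \<Rightarrow>\<^sub>0 'r) \<Rightarrow> ('b list \<Rightarrow>\<^sub>0 'r)" where
  "hprod b X = lin fscale (\<lambda>(u, v). pcons (b (basis u)) (X (basis v)))"

lemma module_hom_hprod: "flinear (hprod b X)"
  by (simp add: hprod_def module_fscale)

lemma hprod_basis: "hprod b X (basis (u, v)) = pcons (b (basis u)) (X (basis v))"
  by (simp add: hprod_def module_fscale)

lemma hprod_deconc:
  "hprod b X (deconc (basis w)) =
    (\<Sum>i\<in>{1..<length w}. pcons (b (basis (take i w))) (X (basis (drop i w))))"
  by (simp add: deconc_basis module_hom.sum[OF module_hom_hprod] hprod_basis)

lemma hprod_tens:
  assumes b: "module_hom fscale (gscale W) b" and X: "flinear X"
  shows "tc_eq W (hprod b X (tens p q)) (pcons (b p) (X q))"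
proof (rule tc_eq_linear_extension[where f = "\<lambda>p. hprod b X (tens p q)" and g = "\<lambda>p. pcons (b p) (X q)"])
  show "flinear (\<lambda>p. hprod b X (tens p q))"
    by (rule module_hom_comp[OF module_hom_tens_left module_hom_hprod])
  show "tc_eq W (hprod b X (tens (basis w) q)) (pcons (b (basis w)) (X q))" for w
  proof -
    have "hprod b X (tens (basis w) q) = pcons (b (basis w)) (X q)"
      by (rule module_hom_eqI[OF module_hom_comp[OF module_hom_tens_right module_hom_hprod]
            module_hom_comp[OF X module_hom_pcons]]) (simp add: hprod_basis)
    then show ?thesis by simp
  qed
qed (use b pcons_add_left pcons_scale_left in \<open>auto simp: module_hom.add[OF b] module_hom.scale[OF b]\<close>)

lemma hprod_rel:
  assumes b: "module_hom fscale (gscale W) b" "\<And>p. p \<in> tc_rel V \<Longrightarrow> b p = 0"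
    and X: "flinear X" "\<And>p. p \<in> tc_rel V \<Longrightarrow> X p \<in> tc_rel W"
    and p: "p \<in> tc2_rel V"
  shows "hprod b X p \<in> tc_rel W"
  using p unfolding tc2_rel_def
proof (rule module_hom_mem_span[OF module_hom_hprod, rotated 2])
  have *: "hprod b X (tens p q) \<in> tc_rel W" if "pcons (b p) (X q) \<in> tc_rel W" for p q
    using tc_eq_trans[OF hprod_tens[OF b(1) X(1)], of p q 0] that by (simp add: tc_eq_0_iff)
  fix x assume "x \<in> {tens p q |p q. p \<in> tc_rel V} \<union> {tens p q |p q. q \<in> tc_rel V}"
  then show "hprod b X x \<in> tc_rel W"
    using pcons_zero_left[of W] pcons_rel[OF X(2)] by (auto simp: b(2) tc_eq_0_iff intro!: *)
qed simp

lemma hprod_cong: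
  assumes "tc2_eq V p q" and b: "module_hom fscale (gscale W) b" "\<And>p. p \<in> tc_rel V \<Longrightarrow> b p = 0"
    and X: "flinear X" "\<And>p. p \<in> tc_rel V \<Longrightarrow> X p \<in> tc_rel W"
  shows "tc_eq W (hprod b X p) (hprod b X q)"
  using hprod_rel[OF b X, where p = "p - q"] assms(1)
  by (simp add: tc2_eq_def tc_eq_def module_hom.diff[OF module_hom_hprod])

lemma decompose_word:
  assumes V: "graded_module V"
  shows "tc_eq V (basis w) (basis [tc_proj V (basis w)] + hprod (tc_proj V) id (deconc (basis w)))"
proof -
  consider "w = []" | x where "w = [x]" | x v where "w = x # v" "v \<noteq> []"
    by (cases w) blast+
  then show ?thesis
  proof cases
    case 1
    have "tc_eq V (basis []) (basis [0])"
      using tc_eq_trans[OF _ tc_eq_sym[OF single_zero], of V "basis []"] rel_Nil[of V] by (simp add: tc_eq_0_iff)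
    then show ?thesis using 1 V by (simp add: graded_module_module deconc_basis hprod_def module_hom.zero[OF module_hom_lin] module_fscale)
  next
    case 2
    then show ?thesis using V by (simp add: graded_module_module deconc_basis hprod_def module_hom.zero[OF module_hom_lin] module_fscale)
  next
    case 3
    have "tc_eq V (\<Sum>i\<in>{1..<length w}. pcons (tc_proj V (basis (take i w))) (id (basis (drop i w))))
      (\<Sum>i\<in>{1..<length w}. if i = 1 then basis w else 0)"
    proof (rule tc_eq_sum)
      fix i assume "i \<in> {1..<length w}"
      then show "tc_eq V (pcons (tc_proj V (basis (take i w))) (id (basis (drop i w)))) (if i = 1 then basis w else 0)"
        using 3 V pcons_zero_left[of V "basis (drop i w)"] by (auto simp: graded_module_module)
    qed
    also have "(\<Sum>i\<in>{1..<length w}. if i = 1 then basis w else 0) = basis w"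
      using 3 by (subst sum.delta) auto
    finally have "tc_eq V (0 + basis w) (basis [0] + hprod (tc_proj V) id (deconc (basis w)))"
      unfolding hprod_deconc by (rule tc_eq_add[OF tc_eq_sym[OF single_zero] tc_eq_sym])
    then show ?thesis using 3 V by (simp add: graded_module_module)
  qed
qed

text \<open>Among the ways to cut a word of length at least two there is exactly one that leaves a single letter
  on the left, and concatenation undoes that cut. Multiplying all cuts back together would instead give a
  multiple by the number of cuts, which cannot be divided out over an arbitrary ring. All later inductions
  on word length rest on this decomposition.\<close>

lemma decompose:
  assumes V: "graded_module V"
  shows "tc_eq V p (basis [tc_proj V p] + hprod (tc_proj V) id (deconc p))"
proof -
  have "tc_eq V (p - hprod (tc_proj V) id (deconc p)) (basis [tc_proj V p])"
  proof (rule single_linear_extension[where f = "\<lambda>p. p - hprod (tc_proj V) id (deconc p)"])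
    show "flinear (\<lambda>p. p - hprod (tc_proj V) id (deconc p))"
      by (intro module_hom_minus module_hom_same module_fscale module_hom_comp[OF module_hom_deconc module_hom_hprod])
    show "tc_eq V (basis w - hprod (tc_proj V) id (deconc (basis w))) (basis [tc_proj V (basis w)])" for w
      using decompose_word[OF V, of w] by (simp add: tc_eq_def algebra_simps)
  qed (rule module_hom_tc_proj[OF graded_module_module[OF V]])
  then show ?thesis by (simp add: tc_eq_def algebra_simps)
qed

lemma hprod_proj_cong: "graded_module V \<Longrightarrow> tc2_eq V p q \<Longrightarrow> tc_eq V (hprod (tc_proj V) id p) (hprod (tc_proj V) id q)"
  by (erule hprod_cong)
    (auto simp: module_hom_tc_proj graded_module_module tc_fun_rel[OF tc_fun_proj] module.module_hom_id module_fscale)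

text \<open>The kernel of the reduced coproduct consists of the cogenerators. This is the mechanism by which a
  coproduct computation replaces a computation with components.\<close>

lemma primitive_eq_single:
  assumes V: "graded_module V" and "tc2_eq V (deconc p) 0"
  shows "tc_eq V p (basis [tc_proj V p])"
proof -
  have "tc_eq V (hprod (tc_proj V) id (deconc p)) 0"
    using hprod_proj_cong[OF V assms(2)] by (simp add: module_hom.zero[OF module_hom_hprod])
  from tc_eq_trans[OF decompose[OF V] tc_eq_add[OF tc_eq_refl this]] show ?thesis by simp
qed

section \<open>Coalgebra morphisms and coderivations\<close>

text \<open>One notion covers three: a homotopy map from \<open>\<phi>\<close> to \<open>\<psi>\<close> is the case \<open>d = 1\<close>, a coderivation is the case
  \<open>\<phi> = \<psi> = id\<close>, \<open>d = -1\<close>, and a coalgebra morphism \<open>\<phi>\<close> is the case \<open>\<eta> = \<phi>\<close>, \<open>\<psi> = 0\<close>, \<open>d = 0\<close>. Recursion,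
  uniqueness and existence are proved once for all of them.\<close>

definition gcoder ::
    "('r::comm_ring_1, 'a::ab_group_add, 'm) graded_mod_scheme \<Rightarrow>
     ('r, 'b::ab_group_add, 'n) graded_mod_scheme \<Rightarrow> int \<Rightarrow>
     (('a list \<Rightarrow>\<^sub>0 'r) \<Rightarrow> ('b list \<Rightarrow>\<^sub>0 'r)) \<Rightarrow> (('a list \<Rightarrow>\<^sub>0 'r) \<Rightarrow> ('b list \<Rightarrow>\<^sub>0 'r)) \<Rightarrow>
     (('a list \<Rightarrow>\<^sub>0 'r) \<Rightarrow> ('b list \<Rightarrow>\<^sub>0 'r)) \<Rightarrow> bool" where
  "gcoder V W d \<phi> \<psi> \<eta> \<longleftrightarrow>
     tc_hom V W 0 \<phi> \<and> tc_hom V W 0 \<psi> \<and> tc_hom V W d \<eta> \<and>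
     (\<forall>p. tc2_eq W (deconc (\<eta> p)) (tens_map V d \<phi> \<eta> (deconc p) + tens_map V 0 \<eta> \<psi> (deconc p)))"

lemma gcoder_hom: "gcoder V W d \<phi> \<psi> \<eta> \<Longrightarrow> tc_hom V W d \<eta>"
  and gcoder_hom_left: "gcoder V W d \<phi> \<psi> \<eta> \<Longrightarrow> tc_hom V W 0 \<phi>"
  and gcoder_hom_right: "gcoder V W d \<phi> \<psi> \<eta> \<Longrightarrow> tc_hom V W 0 \<psi>"
  by (auto simp: gcoder_def)

lemma tens_map_zero_right: "tens_map V d \<alpha> (\<lambda>_. 0) p = 0"
proof -
  have *: "(\<lambda>(u, v). tens (\<alpha> (if even d then basis u else tc_sign V (basis u))) 0) = (\<lambda>_. 0)"
    by (auto simp: tens_simps)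
  show ?thesis unfolding tens_map_def * by (simp add: lin_def)
qed

lemma tc_coalg_hom_iff: "tc_coalg_hom V W \<phi> \<longleftrightarrow> gcoder V W 0 \<phi> (\<lambda>_. 0) \<phi>"
  by (auto simp: tc_coalg_hom_def gcoder_def tens_map_zero_right tc_hom_zero)

lemma tc_coderivation_iff: "tc_coderivation V \<delta> \<longleftrightarrow> gcoder V V (-1) id id \<delta>"
  by (auto simp: tc_coderivation_def gcoder_def tc_hom_id add.commute)

abbreviation coproduct_term where
  "coproduct_term V d \<phi> \<psi> \<eta> w i \<equiv> tens (\<phi> (koszul V d (basis (take i w)))) (\<eta> (basis (drop i w)))
     + tens (\<eta> (basis (take i w))) (\<psi> (basis (drop i w)))"

abbreviation recursion_term where
  "recursion_term V W d \<phi> \<psi> \<eta> w i \<equiv> pcons (tc_proj W (\<phi> (koszul V d (basis (take i w))))) (\<eta> (basis (drop i w)))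
     + pcons (tc_proj W (\<eta> (basis (take i w)))) (\<psi> (basis (drop i w)))"

lemma gcoder_deconc:
  assumes "gcoder V W d \<phi> \<psi> \<eta>"
  shows "tc2_eq W (deconc (\<eta> (basis w)))
    (\<Sum>i\<in>{1..<length w}. coproduct_term V d \<phi> \<psi> \<eta> w i)"
proof -
  note h = tc_hom_module_hom[OF gcoder_hom[OF assms]] tc_hom_module_hom[OF gcoder_hom_left[OF assms]]
     tc_hom_module_hom[OF gcoder_hom_right[OF assms]]
  have "tc2_eq W (deconc (\<eta> (basis w)))
    (tens_map V d \<phi> \<eta> (deconc (basis w)) + tens_map V 0 \<eta> \<psi> (deconc (basis w)))"
    using assms by (simp add: gcoder_def)
  also have "tens_map V d \<phi> \<eta> (deconc (basis w)) + tens_map V 0 \<eta> \<psi> (deconc (basis w)) =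
    (\<Sum>i\<in>{1..<length w}. coproduct_term V d \<phi> \<psi> \<eta> w i)"
    unfolding deconc_basis module_hom.sum[OF module_hom_tens_map] tens_map_tens[OF h(2,1)] tens_map_tens[OF h(1,3)]
    by (simp add: koszul_def sum.distrib)
  finally show ?thesis .
qed

lemma gcoderI:
  assumes "tc_hom V W 0 \<phi>" "tc_hom V W 0 \<psi>" "tc_hom V W d \<eta>"
    and "\<And>w. tc2_eq W (deconc (\<eta> (basis w)))
    (\<Sum>i\<in>{1..<length w}. coproduct_term V d \<phi> \<psi> \<eta> w i)"
  shows "gcoder V W d \<phi> \<psi> \<eta>"
proof -
  note h = tc_hom_module_hom[OF assms(3)] tc_hom_module_hom[OF assms(1)] tc_hom_module_hom[OF assms(2)]
  let ?f = "\<lambda>p. deconc (\<eta> p) - (tens_map V d \<phi> \<eta> (deconc p) + tens_map V 0 \<eta> \<psi> (deconc p))"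
  have "?f p \<in> tc2_rel W" for p
  proof (rule module_hom_mem[where f = ?f])
    show "flinear ?f"
      by (intro module_hom_minus module_hom_plus module_hom_comp[OF module_hom_deconc module_hom_tens_map]
        module_hom_comp[OF h(1) module_hom_deconc])
    show "?f (basis w) \<in> tc2_rel W" for w
      using assms(4)[of w] unfolding deconc_basis[of w] module_hom.sum[OF module_hom_tens_map]
        tens_map_tens[OF h(2,1)] tens_map_tens[OF h(1,3)]
      by (simp add: koszul_def sum.distrib tc2_eq_def)
  qed simp
  then show ?thesis using assms by (simp add: gcoder_def tc2_eq_def)
qed

lemma tc_eq_move: "tc_eq V p (s + r) \<Longrightarrow> tc_eq V (p - s) r"
  by (simp add: tc_eq_def algebra_simps)

text \<open>The decomposition of an element by its projection and its coproduct, applied to \<open>\<eta> w\<close>. The values of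
  \<open>\<eta>\<close> on the right belong to proper parts of the word, so this is a recursion.\<close>

lemma gcoder_recursion:
  assumes W: "graded_module W" and "gcoder V W d \<phi> \<psi> \<eta>"
  shows "tc_eq W (\<eta> (basis w)) (basis [tc_proj W (\<eta> (basis w))] +
    (\<Sum>i\<in>{1..<length w}. recursion_term V W d \<phi> \<psi> \<eta> w i))"
proof -
  let ?S = "\<Sum>i\<in>{1..<length w}. coproduct_term V d \<phi> \<psi> \<eta> w i"
  note ht = hprod_tens[OF module_hom_tc_proj[OF graded_module_module[OF W]] module.module_hom_id[OF module_fscale]]
  have "tc_eq W (hprod (tc_proj W) id (deconc (\<eta> (basis w)))) (hprod (tc_proj W) id ?S)"
    by (rule hprod_proj_cong[OF W gcoder_deconc[OF assms(2)]])
  also have "tc_eq W (hprod (tc_proj W) id ?S) (\<Sum>i\<in>{1..<length w}.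
      pcons (tc_proj W (\<phi> (koszul V d (basis (take i w))))) (id (\<eta> (basis (drop i w))))
       + pcons (tc_proj W (\<eta> (basis (take i w)))) (id (\<psi> (basis (drop i w)))))"
    unfolding module_hom.sum[OF module_hom_hprod] module_hom.add[OF module_hom_hprod]
    by (intro tc_eq_sum tc_eq_add ht)
  finally show ?thesis
    using tc_eq_trans[OF decompose[OF W] tc_eq_add[OF tc_eq_refl]] by simp
qed

text \<open>Apart from the component of \<open>\<eta>\<close>, the recursion for \<open>\<eta>\<close> on a word only uses \<open>\<eta>\<close>, \<open>\<psi>\<close> and the components of \<open>\<phi>\<close> on
  shorter words, so at the first length where the components of two such maps may differ, the maps differ by the
  difference of these components.\<close>

lemma gcoder_variation:
  assumes W: "graded_module W"
    and g: "gcoder V W d \<phi> \<psi> \<eta>" and g': "gcoder V W d \<phi>' \<psi>' \<eta>'"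
    and \<phi>: "\<And>w. length w < n \<Longrightarrow> tc_proj W (\<phi>' (basis w)) = tc_proj W (\<phi> (basis w))"
    and \<psi>: "\<And>w. length w < n \<Longrightarrow> tc_eq W (\<psi>' (basis w)) (\<psi> (basis w))"
    and \<eta>: "\<And>w. length w < n \<Longrightarrow> tc_proj W (\<eta>' (basis w)) = tc_proj W (\<eta> (basis w))"
    and "length w \<le> n"
  shows "tc_eq W (\<eta>' (basis w)) (\<eta> (basis w) + basis [tc_proj W (\<eta>' (basis w)) - tc_proj W (\<eta> (basis w))])"
  using \<open>length w \<le> n\<close>
proof (induction w rule: length_induct)
  case (1 w)
  have s: "tc_eq W (\<eta>' (basis u)) (\<eta> (basis u))" if "length u < length w" for u
  proof -
    have "length u < n" using that 1 by simp
    then have "tc_eq W (\<eta>' (basis u)) (\<eta> (basis u) + basis [0])" using 1 that \<eta>[of u] by auto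
    from tc_eq_trans[OF this tc_eq_add[OF tc_eq_refl single_zero]] show ?thesis by simp
  qed
  let ?R = "\<lambda>\<phi> \<psi> \<eta>. \<Sum>i\<in>{1..<length w}. recursion_term V W d \<phi> \<psi> \<eta> w i"
  have "tc_eq W (?R \<phi>' \<psi>' \<eta>') (?R \<phi> \<psi> \<eta>)"
  proof (rule tc_eq_sum)
    fix i assume i: "i \<in> {1..<length w}"
    then have l: "length (take i w) < n" "length (drop i w) < n" using 1 by auto
    obtain w' where "length w' = length (take i w)" and kw: "koszul V d (basis (take i w)) = basis w'"
      using koszul_word by blast
    with l have w': "length w' < n" "koszul V d (basis (take i w)) = basis w'" by simp_all
    show "tc_eq W (recursion_term V W d \<phi>' \<psi>' \<eta>' w i)
      (recursion_term V W d \<phi> \<psi> \<eta> w i)"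
      unfolding w'(2) \<phi>[OF w'(1)] \<eta>[OF l(1)]
      by (intro tc_eq_add pcons_cong \<psi> l s) (use i in auto)
  qed
  then have "tc_eq W (\<eta>' (basis w) - basis [tc_proj W (\<eta>' (basis w))]) (\<eta> (basis w) - basis [tc_proj W (\<eta> (basis w))])"
    using tc_eq_move[OF gcoder_recursion[OF W g', of w]] tc_eq_sym[OF tc_eq_move[OF gcoder_recursion[OF W g, of w]]]
    by (blast intro: tc_eq_trans)
  then have "tc_eq W (\<eta>' (basis w)) (\<eta> (basis w) + (basis [tc_proj W (\<eta>' (basis w))] - basis [tc_proj W (\<eta> (basis w))]))"
    by (simp add: tc_eq_def algebra_simps)
  from tc_eq_trans[OF this tc_eq_add[OF tc_eq_refl tc_eq_sym[OF tc_eq_single(4)]]] show ?case .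
qed

section \<open>Gluing maps along word length\<close>

definition glue :: "('r::comm_ring_1 \<Rightarrow> 'b::ab_group_add \<Rightarrow> 'b) \<Rightarrow> (nat \<Rightarrow> ('a list \<Rightarrow>\<^sub>0 'r) \<Rightarrow> 'b) \<Rightarrow> ('a list \<Rightarrow>\<^sub>0 'r) \<Rightarrow> 'b" where
  "glue s f = lin s (\<lambda>w. f (length w) (basis w))"

lemma glue_basis [simp]: "module s \<Longrightarrow> glue s f (basis w) = f (length w) (basis w)"
  by (simp add: glue_def)

lemma module_hom_glue: "module s \<Longrightarrow> module_hom fscale s (glue s f)"
  by (simp add: glue_def)

text \<open>The words in a multilinearity relation all have the same length, so gluing different maps on different
  lengths is compatible with the relations.\<close>

lemma glue_rel:
  assumes s: "module s" and f: "\<And>n. module_hom fscale s (f n)"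
    and S: "module.subspace s S" "\<And>n p. p \<in> tc_rel V \<Longrightarrow> f n p \<in> S" and p: "p \<in> tc_rel V"
  shows "glue s f p \<in> S"
  using p module_hom_glue[OF s] S(1)
proof (rule tc_rel_induct)
  fix u v x y r
  show "glue s f (basis (u @ [x + y] @ v)) - glue s f (basis (u @ [x] @ v)) - glue s f (basis (u @ [y] @ v)) \<in> S"
    using S(2)[OF rel_add[of u x y v V], of "Suc (length u + length v)"] by (simp add: s module_hom.diff[OF f])
  show "glue s f (basis (u @ [gscale V r x] @ v)) - s r (glue s f (basis (u @ [x] @ v))) \<in> S"
    using S(2)[OF rel_scale[of u V r x v], of "Suc (length u + length v)"]
    by (simp add: s module_hom.diff[OF f] module_hom.scale[OF f])
qed (use S(2)[OF rel_Nil] in \<open>simp add: s\<close>)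

lemma glue_comp:
  assumes s: "module s" and f: "\<And>n. module_hom fscale s (f n)"
    and K: "module.subspace s K" "\<And>n p. p \<in> tc_comp V m \<Longrightarrow> f n p \<in> K" and p: "p \<in> tc_comp V m"
  shows "glue s f p \<in> K"
  using p module_hom_glue[OF s] K(1)
proof (rule tc_comp_span_induct)
  show "p \<in> tc_rel V \<Longrightarrow> glue s f p \<in> K" for p
    by (rule glue_rel[OF s f K(1)]) (use K(2)[OF tc_rel_comp] in auto)
  show "glue s f (basis w) \<in> K" if "list_all2 (\<lambda>x d. x \<in> gcomp V d) w ds" "m = sum_list ds" for w ds
    using K(2) word_tc_comp[OF that(1)] that(2) by (simp add: s)
qed

lemma tc_hom_glue:
  assumes "\<And>n. tc_hom V W d (f n)"
  shows "tc_hom V W d (glue fscale f)"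
  unfolding tc_hom_def
proof (intro conjI allI subsetI)
  note h = tc_hom_module_hom[OF assms]
  show "flinear (glue fscale f)" by (rule module_hom_glue[OF module_fscale])
  show "x \<in> tc_rel W" if "x \<in> glue fscale f ` tc_rel V" for x
    using that glue_rel[OF module_fscale h subspace_tc_rel tc_hom_rel[OF assms]] by auto
  show "x \<in> tc_comp W (n + d)" if "x \<in> glue fscale f ` tc_comp V n" for x n
    using that glue_comp[OF module_fscale h subspace_tc_comp tc_hom_comp_mem[OF assms]] by auto
qed

lemma tc_fun_glue:
  assumes W: "graded_module W" and "\<And>n. tc_fun V W d (f n)"
  shows "tc_fun V W d (glue (gscale W) f)"
  unfolding tc_fun_def
proof (intro conjI allI ballI subsetI)
  note h = tc_fun_module_hom[OF assms(2)]
  have m: "module (gscale W)" using W by auto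
  show "module_hom fscale (gscale W) (glue (gscale W) f)" by (rule module_hom_glue[OF m])
  show "glue (gscale W) f p = 0" if "p \<in> tc_rel V" for p
    using glue_rel[OF m h module.subspace_single_0[OF m] _ that] tc_fun_rel[OF assms(2)] by auto
  show "x \<in> gcomp W (n + d)" if "x \<in> glue (gscale W) f ` tc_comp V n" for x n
    using that glue_comp[OF m h graded_module_subspace[OF W] tc_fun_mem[OF assms(2)]] by auto
qed

section \<open>Construction from components\<close>

text \<open>The recursion \<open>X w = [a w] + \<Sum> b w\<^sub>1 \<cdot> X w\<^sub>2 + a w\<^sub>1 \<cdot> Y w\<^sub>2\<close>, summed over the cuts \<open>w = w\<^sub>1 w\<^sub>2\<close>. It is unfolded
  in steps, and a word is evaluated after one step more than its length, because each step is visibly a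
  composite of maps that respect the relations and the degrees.\<close>

primrec wrec_steps ::
    "(('a list \<Rightarrow>\<^sub>0 'r::comm_ring_1) \<Rightarrow> 'b) \<Rightarrow> (('a list \<Rightarrow>\<^sub>0 'r) \<Rightarrow> 'b) \<Rightarrow>
     (('a list \<Rightarrow>\<^sub>0 'r) \<Rightarrow> ('b list \<Rightarrow>\<^sub>0 'r)) \<Rightarrow> nat \<Rightarrow> ('a list \<Rightarrow>\<^sub>0 'r) \<Rightarrow> ('b list \<Rightarrow>\<^sub>0 'r)" where
  "wrec_steps a b Y 0 = (\<lambda>p. 0)"
| "wrec_steps a b Y (Suc n) = (\<lambda>p. lin fscale (\<lambda>w. basis [a (basis w)]) p
     + hprod b (wrec_steps a b Y n) (deconc p) + hprod a Y (deconc p))"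

definition wrec ::
    "(('a list \<Rightarrow>\<^sub>0 'r::comm_ring_1) \<Rightarrow> 'b) \<Rightarrow> (('a list \<Rightarrow>\<^sub>0 'r) \<Rightarrow> 'b) \<Rightarrow>
     (('a list \<Rightarrow>\<^sub>0 'r) \<Rightarrow> ('b list \<Rightarrow>\<^sub>0 'r)) \<Rightarrow> ('a list \<Rightarrow>\<^sub>0 'r) \<Rightarrow> ('b list \<Rightarrow>\<^sub>0 'r)" where
  "wrec a b Y = glue fscale (\<lambda>n. wrec_steps a b Y (Suc n))"

lemma wrec_steps_stable:
  "length w < m \<Longrightarrow> length w < n \<Longrightarrow> wrec_steps a b Y m (basis w) = wrec_steps a b Y n (basis w)"
proof (induction m arbitrary: n w)
  case (Suc m)
  then obtain k where n: "n = Suc k" by (cases n) auto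
  have "hprod b (wrec_steps a b Y m) (deconc (basis w)) = hprod b (wrec_steps a b Y k) (deconc (basis w))"
    unfolding hprod_deconc
  proof (rule sum.cong)
    fix i assume "i \<in> {1..<length w}"
    then have "wrec_steps a b Y m (basis (drop i w)) = wrec_steps a b Y k (basis (drop i w))"
      using Suc.prems n by (intro Suc.IH) auto
    then show "pcons (b (basis (take i w))) (wrec_steps a b Y m (basis (drop i w))) =
       pcons (b (basis (take i w))) (wrec_steps a b Y k (basis (drop i w)))" by simp
  qed simp
  then show ?case by (simp add: n)
qed simp

lemma wrec_basis:
  "wrec a b Y (basis w) = basis [a (basis w)] +
     (\<Sum>i\<in>{1..<length w}. pcons (b (basis (take i w))) (wrec a b Y (basis (drop i w)))
       + pcons (a (basis (take i w))) (Y (basis (drop i w))))"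
proof -
  have "hprod b (wrec_steps a b Y (length w)) (deconc (basis w)) =
     (\<Sum>i\<in>{1..<length w}. pcons (b (basis (take i w))) (wrec a b Y (basis (drop i w))))"
    unfolding hprod_deconc wrec_def
    by (rule sum.cong) (auto simp: module_fscale simp del: wrec_steps.simps intro!: arg_cong[where f = "pcons _"] wrec_steps_stable)
  moreover have "hprod a Y (deconc (basis w)) =
     (\<Sum>i\<in>{1..<length w}. pcons (a (basis (take i w))) (Y (basis (drop i w))))"
    by (rule hprod_deconc)
  ultimately show ?thesis
    by (simp add: wrec_def[of a b Y] module_fscale sum.distrib add.assoc)
qed

lemma pcons_comp:
  assumes "x \<in> gcomp W m" "p \<in> tc_comp W n"
  shows "pcons x p \<in> tc_comp W (m + n)"
  using assms(2) module_hom_pcons subspace_tc_comp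
proof (rule tc_comp_span_induct)
  fix w ds assume "list_all2 (\<lambda>x d. x \<in> gcomp W d) w ds" "n = sum_list ds"
  then show "pcons x (basis w) \<in> tc_comp W (m + n)"
    using word_tc_comp[of W "x # w" "m # ds"] assms(1) by (auto simp: fm.subspace_0)
qed (rule tc_rel_comp[OF pcons_rel])

lemma tc_hom_hprod:
  assumes b: "tc_fun V W e b" and X: "tc_hom V W d X" and "k = e + d"
  shows "tc_hom V W k (\<lambda>p. hprod b X (deconc p))"
  unfolding tc_hom_def
proof (intro conjI allI subsetI)
  show h: "flinear (\<lambda>p. hprod b X (deconc p))"
    by (rule module_hom_comp[OF module_hom_deconc module_hom_hprod])
  have rel: "hprod b X (deconc p) \<in> tc_rel W" if "p \<in> tc_rel V" for p
    using hprod_rel[OF tc_fun_module_hom[OF b] tc_fun_rel[OF b] tc_hom_module_hom[OF X] tc_hom_rel[OF X] deconc_rel[OF that]] .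
  then show "x \<in> tc_rel W" if "x \<in> (\<lambda>p. hprod b X (deconc p)) ` tc_rel V" for x using that by auto
  fix n x assume "x \<in> (\<lambda>p. hprod b X (deconc p)) ` tc_comp V n"
  then obtain p where p: "p \<in> tc_comp V n" and x: "x = hprod b X (deconc p)" by auto
  show "x \<in> tc_comp W (n + k)"
    unfolding x using p h subspace_tc_comp
  proof (rule tc_comp_span_induct)
    fix w ds assume w: "list_all2 (\<lambda>x d. x \<in> gcomp V d) w ds" "n = sum_list ds"
    show "hprod b X (deconc (basis w)) \<in> tc_comp W (n + k)"
      unfolding hprod_deconc
    proof (rule fm.subspace_sum[OF subspace_tc_comp])
      fix i
      have "basis (take i w) \<in> tc_comp V (sum_list (take i ds))" "basis (drop i w) \<in> tc_comp V (sum_list (drop i ds))"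
        using w(1) by (auto intro!: word_tc_comp list_all2_takeI list_all2_dropI)
      then have "pcons (b (basis (take i w))) (X (basis (drop i w)))
        \<in> tc_comp W ((sum_list (take i ds) + e) + (sum_list (drop i ds) + d))"
        by (intro pcons_comp tc_fun_mem[OF b] tc_hom_comp_mem[OF X])
      moreover have "sum_list (take i ds) + sum_list (drop i ds) = n"
        unfolding w(2) sum_list_append[symmetric] by simp
      then have "(sum_list (take i ds) + e) + (sum_list (drop i ds) + d) = n + k"
        using assms(3) by simp
      ultimately show "pcons (b (basis (take i w))) (X (basis (drop i w))) \<in> tc_comp W (n + k)" by simp
    qed
  qed (use rel tc_rel_comp in auto)
qed

lemma single_comp: "x \<in> gcomp W n \<Longrightarrow> basis [x] \<in> tc_comp W n"
  using word_tc_comp[of W "[x]" "[n]"] by simp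

lemma tc_hom_single:
  assumes a: "tc_fun V W d a"
  shows "tc_hom V W d (lin fscale (\<lambda>w. basis [a (basis w)]))"
proof -
  let ?f = "lin fscale (\<lambda>w. basis [a (basis w)])"
  have h: "flinear ?f" by (simp add: module_fscale)
  have e: "tc_eq W (?f p) (basis [a p])" for p
    by (rule single_linear_extension[OF h tc_fun_module_hom[OF a]]) (simp add: module_fscale)
  have "?f p \<in> tc_rel W" if "p \<in> tc_rel V" for p
    using tc_eq_trans[OF e[of p, unfolded tc_fun_rel[OF a that]] single_zero] by (simp add: tc_eq_0_iff)
  moreover have "?f p \<in> tc_comp W (n + d)" if "p \<in> tc_comp V n" for p n
    using tc_comp_cong[OF e[of p]] single_comp[OF tc_fun_mem[OF a that]] by blast
  ultimately show ?thesis using h by (auto simp: tc_hom_def)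
qed

lemma tc_hom_wrec:
  assumes a: "tc_fun V W d a" and b: "tc_fun V W 0 b" and Y: "tc_hom V W 0 Y"
  shows "tc_hom V W d (wrec a b Y)"
proof -
  have "tc_hom V W d (wrec_steps a b Y n)" for n
  proof (induction n)
    case (Suc n)
    show ?case
      unfolding wrec_steps.simps
      by (intro tc_hom_plus tc_hom_single tc_hom_hprod[OF b Suc] tc_hom_hprod[OF a Y] a) auto
  qed (simp add: tc_hom_zero)
  then show ?thesis unfolding wrec_def by (intro tc_hom_glue)
qed

lemma tc_proj_wrec:
  assumes W: "graded_module W" and a: "tc_fun V W d a" 
  shows "tc_proj W (wrec a b Y p) = a p"
proof (rule module_hom_eqI[where f = "\<lambda>p. tc_proj W (wrec a b Y p)", OF _ tc_fun_module_hom[OF a]])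
  have m: "module (gscale W)" using W by auto
  note pr = module_hom_tc_proj[OF m]
  show "module_hom fscale (gscale W) (\<lambda>p. tc_proj W (wrec a b Y p))"
    by (rule module_hom_comp[OF _ pr]) (simp add: wrec_def module_hom_glue module_fscale)
  show "tc_proj W (wrec a b Y (basis w)) = a (basis w)" for w
    by (subst wrec_basis) (simp add: module_hom.add[OF pr] module_hom.sum[OF pr] m)
qed

section \<open>The coproduct of the constructed map\<close>

definition lcons :: "'a \<Rightarrow> ('a list \<times> 'a list \<Rightarrow>\<^sub>0 'r::comm_ring_1) \<Rightarrow> ('a list \<times> 'a list \<Rightarrow>\<^sub>0 'r)" where
  "lcons x = lin fscale (\<lambda>(u, v). tens (pcons x (basis u)) (basis v))"

lemma module_hom_lcons: "flinear (lcons x)"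
  by (simp add: lcons_def module_fscale)

lemma lcons_tens: "lcons x (tens p q) = tens (pcons x p) q"
  by (rule bilinear_tens_eqI[OF module_hom_lcons])
    (auto intro: module_hom_tens_right module_hom_comp[OF module_hom_pcons module_hom_tens_left]
      simp: lcons_def module_fscale simp del: pcons_basis)

lemma lcons_cong:
  assumes "tc2_eq V p q" shows "tc2_eq V (lcons x p) (lcons x q)"
proof -
  have "lcons x r \<in> tc2_rel V" if "r \<in> tc2_rel V" for r
    by (rule module_hom_mem_span[OF module_hom_lcons subspace_tc2_rel _ that[unfolded tc2_rel_def]])
      (auto simp: lcons_tens intro: tens_rel_left[OF pcons_rel] tens_rel_right)
  from this[of "p - q"] show ?thesis
    using assms by (simp add: tc2_eq_def module_hom.diff[OF module_hom_lcons])
qed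

lemma deconc_pcons: "tc2_eq V (deconc (pcons x p)) (tens (basis [x]) p + lcons x (deconc p))"
proof -
  let ?f = "\<lambda>p. deconc (pcons x p) - (tens (basis [x]) p + lcons x (deconc p))"
  have "?f p \<in> tc2_rel V"
  proof (rule module_hom_mem[where f = ?f])
    show "flinear ?f"
      by (intro module_hom_minus module_hom_plus module_hom_tens_right
          module_hom_comp[OF module_hom_pcons module_hom_deconc] module_hom_comp[OF module_hom_deconc module_hom_lcons])
    fix w
    show "?f (basis w) \<in> tc2_rel V"
    proof (cases "w = []")
      case True
      then show ?thesis
        using tens_rel_right[OF rel_Nil[of V], of "basis [x]"]
        by (simp add: deconc_basis module_hom.zero[OF module_hom_deconc] module_hom.zero[OF module_hom_lcons] fm.subspace_neg)
    next
      case False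
      let ?g = "\<lambda>i. basis (take i (x # w), drop i (x # w))"
      have "(\<Sum>i\<in>{1..<length (x # w)}. ?g i) = ?g 1 + (\<Sum>i\<in>{Suc 1..<length (x # w)}. ?g i)"
        using False by (intro sum.atLeast_Suc_lessThan) auto
      also have "(\<Sum>i\<in>{Suc 1..<length (x # w)}. ?g i) = (\<Sum>i\<in>{1..<length w}. ?g (Suc i))"
        by (simp only: list.size(4) sum.shift_bounds_Suc_ivl add_Suc_right add_0_right One_nat_def)
      finally have A: "deconc (pcons x (basis w)) = tens (basis [x]) (basis w) + (\<Sum>i\<in>{1..<length w}. ?g (Suc i))"
        using False by (simp add: deconc_basis del: sum.op_ivl_Suc)
      have B: "lcons x (deconc (basis w)) = (\<Sum>i\<in>{1..<length w}. ?g (Suc i))"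
        unfolding deconc_basis module_hom.sum[OF module_hom_lcons] lcons_tens
        by (rule sum.cong) auto
      show ?thesis unfolding A B by (simp add: fm.subspace_0)
    qed
  qed simp
  then show ?thesis by (simp add: tc2_eq_def)
qed

lemma deconc_single [simp]: "deconc (basis [x]) = 0"
  by (simp add: deconc_basis)

lemma split_sum_assoc:
  "(\<Sum>i\<in>{1..<length w}. \<Sum>j\<in>{1..<length (drop i w)}.
      f (take i w) (take j (drop i w)) (drop j (drop i w))) =
   (\<Sum>k\<in>{1..<length w}. \<Sum>i\<in>{1..<length (take k w)}.
      f (take i (take k w)) (drop i (take k w)) (drop k w))" (is "?L = ?R")
proof -
  let ?A = "SIGMA i:{1..<length w}. {1..<length (drop i w)}"
  let ?B = "SIGMA k:{1..<length w}. {1..<length (take k w)}"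
  have "?L = (\<Sum>(i,j)\<in>?A. f (take i w) (take j (drop i w)) (drop j (drop i w)))"
    by (rule sum.Sigma) auto
  also have "(\<Sum>(i,j)\<in>?A. f (take i w) (take j (drop i w)) (drop j (drop i w))) =
     (\<Sum>(k,i)\<in>?B. f (take i (take k w)) (drop i (take k w)) (drop k w))"
    by (rule sum.reindex_bij_witness[where i = "\<lambda>(k,i). (i, k - i)" and j = "\<lambda>(i,j). (i + j, i)"])
      (auto simp: min_def take_drop add.commute)
  also have "\<dots> = ?R"
    by (rule sum.Sigma[symmetric]) auto
  finally show ?thesis .
qed

text \<open>Both sides are sums over the ways to cut a word once or twice. Two successive cuts can be made in either
  order, which is the coassociativity in \<open>split_sum_assoc\<close>. The map \<open>P\<close> is \<open>\<phi>\<close> preceded by its Koszul sign, or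
  the constructed map itself in the case of a coalgebra morphism.\<close>

lemma deconc_wrec:
  assumes P: "\<And>w. tc_eq W (P (basis w)) (basis [b (basis w)] +
        (\<Sum>i\<in>{1..<length w}. pcons (b (basis (take i w))) (P (basis (drop i w)))))"
    and Y: "\<And>w. tc2_eq W (deconc (Y (basis w))) (\<Sum>i\<in>{1..<length w}. tens (Y (basis (take i w))) (Y (basis (drop i w))))"
  shows "tc2_eq W (deconc (wrec a b Y (basis w)))
    (\<Sum>i\<in>{1..<length w}. tens (P (basis (take i w))) (wrec a b Y (basis (drop i w)))
       + tens (wrec a b Y (basis (take i w))) (Y (basis (drop i w))))"
proof (induction w rule: length_induct)
  case (1 w)
  let ?X = "wrec a b Y"
  let ?b = "\<lambda>u. b (basis u)" and ?a = "\<lambda>u. a (basis u)"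
  let ?f = "\<lambda>u v z. tens (pcons (?b u) (P (basis v))) (?X (basis z)) + tens (pcons (?b u) (?X (basis v))) (Y (basis z))
     + tens (pcons (?a u) (Y (basis v))) (Y (basis z))"
  let ?g = "\<lambda>i. tens (basis [?b (take i w)]) (?X (basis (drop i w))) + tens (basis [?a (take i w)]) (Y (basis (drop i w)))"
  have "deconc (?X (basis w)) = (\<Sum>i\<in>{1..<length w}. deconc (pcons (?b (take i w)) (?X (basis (drop i w))))
       + deconc (pcons (?a (take i w)) (Y (basis (drop i w)))))"
    by (subst wrec_basis) (simp add: module_hom.add[OF module_hom_deconc] module_hom.sum[OF module_hom_deconc])
  also have "tc2_eq W \<dots> (\<Sum>i\<in>{1..<length w}. ?g i + (\<Sum>j\<in>{1..<length (drop i w)}.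
      ?f (take i w) (take j (drop i w)) (drop j (drop i w))))"
  proof (rule tc2_eq_sum)
    fix i assume i: "i \<in> {1..<length w}"
    have "tc2_eq W (deconc (?X (basis (drop i w)))) (\<Sum>j\<in>{1..<length (drop i w)}.
       tens (P (basis (take j (drop i w)))) (?X (basis (drop j (drop i w))))
       + tens (?X (basis (take j (drop i w)))) (Y (basis (drop j (drop i w)))))"
      by (rule 1[rule_format]) (use i in auto)
    note A = tc2_eq_trans[OF deconc_pcons tc2_eq_add[OF tc2_eq_refl lcons_cong[OF this]], of "?b (take i w)"]
    note B = tc2_eq_trans[OF deconc_pcons tc2_eq_add[OF tc2_eq_refl lcons_cong[OF Y[of "drop i w"]]], of "?a (take i w)"]
    show "tc2_eq W (deconc (pcons (?b (take i w)) (?X (basis (drop i w)))) + deconc (pcons (?a (take i w)) (Y (basis (drop i w)))))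
      (?g i + (\<Sum>j\<in>{1..<length (drop i w)}. ?f (take i w) (take j (drop i w)) (drop j (drop i w))))"
      using tc2_eq_add[OF A B]
      by (simp add: module_hom.sum[OF module_hom_lcons] module_hom.add[OF module_hom_lcons] lcons_tens sum.distrib ac_simps)
  qed
  also have "(\<Sum>i\<in>{1..<length w}. ?g i + (\<Sum>j\<in>{1..<length (drop i w)}. ?f (take i w) (take j (drop i w)) (drop j (drop i w))))
    = (\<Sum>k\<in>{1..<length w}. ?g k + (\<Sum>i\<in>{1..<length (take k w)}. ?f (take i (take k w)) (drop i (take k w)) (drop k w)))"
    using split_sum_assoc[where w = w and f = ?f] by (simp only: sum.distrib)
  also have "tc2_eq W \<dots> (\<Sum>k\<in>{1..<length w}. tens (P (basis (take k w))) (?X (basis (drop k w)))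
       + tens (?X (basis (take k w))) (Y (basis (drop k w))))"
  proof (rule tc2_eq_sum)
    fix k
    let ?u = "take k w"
    have "tc2_eq W (tens (P (basis ?u)) (?X (basis (drop k w))) + tens (?X (basis ?u)) (Y (basis (drop k w))))
       (tens (basis [?b ?u] + (\<Sum>i\<in>{1..<length ?u}. pcons (?b (take i ?u)) (P (basis (drop i ?u))))) (?X (basis (drop k w)))
        + tens (?X (basis ?u)) (Y (basis (drop k w))))"
      by (intro tc2_eq_add tc2_eq_tens P tc_eq_refl tc2_eq_refl)
    also have "tens (basis [?b ?u] + (\<Sum>i\<in>{1..<length ?u}. pcons (?b (take i ?u)) (P (basis (drop i ?u))))) (?X (basis (drop k w)))
        + tens (?X (basis ?u)) (Y (basis (drop k w)))
      = ?g k + (\<Sum>i\<in>{1..<length ?u}. ?f (take i ?u) (drop i ?u) (drop k w))"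
      by (subst wrec_basis[of a b Y ?u])
        (simp only: tens_simps module_hom.sum[OF module_hom_tens_left] sum.distrib ac_simps)
    finally show "tc2_eq W (?g k + (\<Sum>i\<in>{1..<length ?u}. ?f (take i ?u) (drop i ?u) (drop k w)))
      (tens (P (basis (take k w))) (?X (basis (drop k w))) + tens (?X (basis (take k w))) (Y (basis (drop k w))))"
      by (rule tc2_eq_sym)
  qed
  finally show ?case .
qed

text \<open>Taking \<open>b = a = t\<close> and \<open>Y = 0\<close> in the recursion gives the sum over all subdivisions of a word of the words
  of values of \<open>t\<close> on the pieces.\<close>

lemma coalg_hom_exists:
  fixes W :: "('r::comm_ring_1, 'b::ab_group_add, 'n) graded_mod_scheme"
  assumes V: "graded_module V" and W: "graded_module W" and t: "tc_fun V W 0 t"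
  shows "\<exists>\<tau>. tc_coalg_hom V W \<tau> \<and> (\<forall>p. tc_proj W (\<tau> p) = t p)"
proof -
  let ?X = "wrec t t (\<lambda>_. 0)"
  have pc0: "pcons x (0 :: 'b list \<Rightarrow>\<^sub>0 'r) = 0" for x using module_hom.zero[OF module_hom_pcons] .
  have "tc2_eq W (deconc (?X (basis w)))
    (\<Sum>i\<in>{1..<length w}. tens (?X (basis (take i w))) (?X (basis (drop i w)))
       + tens (?X (basis (take i w))) 0)" for w
  proof (rule deconc_wrec)
    show "tc_eq W (?X (basis w)) (basis [t (basis w)] +
        (\<Sum>i\<in>{1..<length w}. pcons (t (basis (take i w))) (?X (basis (drop i w)))))" for w
      by (subst wrec_basis) (simp add: pc0)
  qed (simp add: module_hom.zero[OF module_hom_deconc] tens_simps)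
  then have "gcoder V W 0 ?X (\<lambda>_. 0) ?X"
    by (intro gcoderI tc_hom_wrec t tc_hom_zero) (simp_all add: koszul_def)
  then show ?thesis using tc_proj_wrec[OF W t] by (auto simp: tc_coalg_hom_iff)
qed

definition koszul_letter where
  "koszul_letter V (d::int) x = (if even d then x else gsign V x)"

lemma koszul_basis: "koszul V d (basis w) = basis (map (koszul_letter V d) w)"
  by (simp add: koszul_def koszul_letter_def[abs_def])

lemma gcoder_exists:
  fixes W :: "('r::comm_ring_1, 'b::ab_group_add, 'n) graded_mod_scheme"
  assumes V: "graded_module V" and W: "graded_module W" and h: "tc_fun V W d h"
    and \<phi>: "tc_coalg_hom V W \<phi>" and \<psi>: "tc_coalg_hom V W \<psi>"
  shows "\<exists>\<eta>. gcoder V W d \<phi> \<psi> \<eta> \<and> (\<forall>p. tc_proj W (\<eta> p) = h p)"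
proof -
  let ?b = "\<lambda>p. tc_proj W (\<phi> (koszul V d p))"
  let ?X = "wrec h ?b \<psi>"
  note g = \<phi>[unfolded tc_coalg_hom_iff] \<psi>[unfolded tc_coalg_hom_iff]
  have pc0: "pcons x (0 :: 'b list \<Rightarrow>\<^sub>0 'r) = 0" for x using module_hom.zero[OF module_hom_pcons] .
  have b: "tc_fun V W 0 ?b"
    by (rule tc_fun_tc_hom[OF tc_hom_koszul[OF V] tc_fun_tc_hom[OF gcoder_hom[OF g(1)] tc_fun_proj[OF W]]]) auto
  have "tc2_eq W (deconc (?X (basis w)))
    (\<Sum>i\<in>{1..<length w}. tens (\<phi> (koszul V d (basis (take i w)))) (?X (basis (drop i w)))
       + tens (?X (basis (take i w))) (\<psi> (basis (drop i w))))" for w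
  proof (rule deconc_wrec)
    show "tc_eq W (\<phi> (koszul V d (basis w))) (basis [?b (basis w)] +
        (\<Sum>i\<in>{1..<length w}. pcons (?b (basis (take i w))) (\<phi> (koszul V d (basis (drop i w))))))" for w
      using gcoder_recursion[OF W g(1), of "map (koszul_letter V d) w"]
      by (simp add: koszul_basis take_map drop_map pc0 koszul_letter_def[of V 0, abs_def])
    show "tc2_eq W (deconc (\<psi> (basis w))) (\<Sum>i\<in>{1..<length w}. tens (\<psi> (basis (take i w))) (\<psi> (basis (drop i w))))" for w
      using gcoder_deconc[OF g(2), of w] by (simp add: koszul_def tens_simps)
  qed
  then have "gcoder V W d \<phi> \<psi> ?X"
    by (intro gcoderI tc_hom_wrec h b gcoder_hom[OF g(1)] gcoder_hom[OF g(2)])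
  then show ?thesis using tc_proj_wrec[OF W h] by auto
qed

section \<open>Coproducts of defects\<close>

lemma tc_coalg_hom_hom: "tc_coalg_hom V W \<phi> \<Longrightarrow> tc_hom V W 0 \<phi>"
  by (simp add: tc_coalg_hom_def)

lemma tc_coderivation_hom: "tc_coderivation V \<delta> \<Longrightarrow> tc_hom V V (-1) \<delta>"
  by (simp add: tc_coderivation_def)

lemma coalg_hom_deconc:
  assumes "tc_coalg_hom V W \<phi>"
  shows "tc2_eq W (deconc (\<phi> (basis w))) (\<Sum>i\<in>{1..<length w}. tens (\<phi> (basis (take i w))) (\<phi> (basis (drop i w))))"
  using gcoder_deconc[OF assms[unfolded tc_coalg_hom_iff], of w] by (simp add: koszul_def tens_simps)

lemma coder_deconc:
  assumes "tc_coderivation V \<delta>"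
  shows "tc2_eq V (deconc (\<delta> (basis w))) (\<Sum>i\<in>{1..<length w}.
     tens (\<delta> (basis (take i w))) (basis (drop i w)) + tens (tc_sign V (basis (take i w))) (\<delta> (basis (drop i w))))"
  using gcoder_deconc[OF assms[unfolded tc_coderivation_iff], of w] by (simp add: koszul_def add.commute)

lemma coalg_hom_deconc_tensor:
  assumes V: "graded_module V" and \<phi>: "tc_coalg_hom V W \<phi>"
    and p: "tc2_eq V (deconc p) (\<Sum>i\<in>I. tens (a i) (b i) + tens (c i) (d i))"
  shows "tc2_eq W (deconc (\<phi> p)) (\<Sum>i\<in>I. tens (\<phi> (a i)) (\<phi> (b i)) + tens (\<phi> (c i)) (\<phi> (d i)))"
proof -
  note h = tc_coalg_hom_hom[OF \<phi>]
  note t = tens_map_tens[OF tc_hom_module_hom[OF h] tc_hom_module_hom[OF h]]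
  have "tc2_eq W (deconc (\<phi> p)) (tens_map V 0 \<phi> \<phi> (deconc p))" using \<phi> by (simp add: tc_coalg_hom_def)
  also have "tc2_eq W \<dots> (tens_map V 0 \<phi> \<phi> (\<Sum>i\<in>I. tens (a i) (b i) + tens (c i) (d i)))"
    by (rule tens_map_cong[OF V h h p])
  finally show ?thesis
    by (simp add: module_hom.sum[OF module_hom_tens_map] module_hom.add[OF module_hom_tens_map] t koszul_def)
qed

lemma coder_deconc_tensor:
  assumes V: "graded_module V" and \<delta>: "tc_coderivation V \<delta>"
    and p: "tc2_eq V (deconc p) (\<Sum>i\<in>I. tens (a i) (b i) + tens (c i) (d i))"
  shows "tc2_eq V (deconc (\<delta> p)) (\<Sum>i\<in>I. tens (\<delta> (a i)) (b i) + tens (tc_sign V (a i)) (\<delta> (b i))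
     + tens (\<delta> (c i)) (d i) + tens (tc_sign V (c i)) (\<delta> (d i)))"
proof -
  note h = tc_coderivation_hom[OF \<delta>]
  note hm = tc_hom_module_hom[OF h] module.module_hom_id[OF module_fscale]
  have "tc2_eq V (deconc (\<delta> p)) (tens_map V 0 \<delta> id (deconc p) + tens_map V (-1) id \<delta> (deconc p))"
    using \<delta> by (simp add: tc_coderivation_def)
  also have "tc2_eq V \<dots> (tens_map V 0 \<delta> id (\<Sum>i\<in>I. tens (a i) (b i) + tens (c i) (d i))
      + tens_map V (-1) id \<delta> (\<Sum>i\<in>I. tens (a i) (b i) + tens (c i) (d i)))"
    by (intro tc2_eq_add tens_map_cong[OF V h tc_hom_id p] tens_map_cong[OF V tc_hom_id h p])
  finally show ?thesis
    by (simp add: module_hom.sum[OF module_hom_tens_map] module_hom.add[OF module_hom_tens_map]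
      tens_map_tens[OF hm] tens_map_tens[OF hm(2,1)] koszul_def sum.distrib[symmetric] ac_simps)
qed

lemma gcoder_deconc_tensor:
  assumes V: "graded_module V" and \<eta>: "gcoder V W 1 \<phi> \<psi> \<eta>"
    and p: "tc2_eq V (deconc p) (\<Sum>i\<in>I. tens (a i) (b i) + tens (c i) (d i))"
  shows "tc2_eq W (deconc (\<eta> p)) (\<Sum>i\<in>I. tens (\<phi> (tc_sign V (a i))) (\<eta> (b i)) + tens (\<eta> (a i)) (\<psi> (b i))
     + tens (\<phi> (tc_sign V (c i))) (\<eta> (d i)) + tens (\<eta> (c i)) (\<psi> (d i)))"
proof -
  note h = gcoder_hom[OF \<eta>] gcoder_hom_left[OF \<eta>] gcoder_hom_right[OF \<eta>]
  note hm = h[THEN tc_hom_module_hom]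
  have "tc2_eq W (deconc (\<eta> p)) (tens_map V 1 \<phi> \<eta> (deconc p) + tens_map V 0 \<eta> \<psi> (deconc p))"
    using \<eta> by (simp add: gcoder_def)
  also have "tc2_eq W \<dots> (tens_map V 1 \<phi> \<eta> (\<Sum>i\<in>I. tens (a i) (b i) + tens (c i) (d i))
      + tens_map V 0 \<eta> \<psi> (\<Sum>i\<in>I. tens (a i) (b i) + tens (c i) (d i)))"
    by (intro tc2_eq_add tens_map_cong[OF V h(2,1) p] tens_map_cong[OF V h(1,3) p])
  finally show ?thesis
    by (simp add: module_hom.sum[OF module_hom_tens_map] module_hom.add[OF module_hom_tens_map]
      tens_map_tens[OF hm(2,1)] tens_map_tens[OF hm(1,3)] koszul_def sum.distrib[symmetric] ac_simps)
qed

text \<open>The coproduct of the defect is the sum over all cuts of the defect on one piece tensored with \<open>\<tau>\<close> on the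
  other, so it vanishes together with the defect on shorter words.\<close>

lemma deconc_chain_defect:
  assumes V: "graded_module V" and W: "graded_module W"
    and \<delta>: "tc_coderivation V \<delta>" and \<delta>': "tc_coderivation W \<delta>'" and \<tau>: "tc_coalg_hom V W \<tau>"
    and s: "\<And>u. length u < length w \<Longrightarrow> tc_eq W (\<delta>' (\<tau> (basis u))) (\<tau> (\<delta> (basis u)))"
  shows "tc2_eq W (deconc (\<delta>' (\<tau> (basis w)) - \<tau> (\<delta> (basis w)))) 0"
proof -
  let ?I = "{1..<length w}"
  let ?u = "\<lambda>i. basis (take i w)" and ?v = "\<lambda>i. basis (drop i w)"
  have "tc2_eq W (deconc (\<tau> (basis w))) (\<Sum>i\<in>?I. tens (\<tau> (?u i)) (\<tau> (?v i)) + tens 0 0)"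
    using coalg_hom_deconc[OF \<tau>, of w] by (simp add: tens_simps)
  note A = coder_deconc_tensor[OF W \<delta>' this]
  note B = coalg_hom_deconc_tensor[OF V \<tau> coder_deconc[OF \<delta>, of w]]
  have 0: "\<delta>' 0 = 0" by (rule module_hom.zero[OF tc_hom_module_hom[OF tc_coderivation_hom[OF \<delta>']]])
  have "tc2_eq W (deconc (\<delta>' (\<tau> (basis w)))) (deconc (\<tau> (\<delta> (basis w))))"
  proof (rule tc2_eq_trans[OF tc2_eq_trans[OF A] tc2_eq_sym[OF B]], rule tc2_eq_sum)
    fix i assume i: "i \<in> ?I"
    show "tc2_eq W (tens (\<delta>' (\<tau> (?u i))) (\<tau> (?v i)) + tens (tc_sign W (\<tau> (?u i))) (\<delta>' (\<tau> (?v i)))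
        + tens (\<delta>' 0) 0 + tens (tc_sign W 0) (\<delta>' 0))
      (tens (\<tau> (\<delta> (?u i))) (\<tau> (?v i)) + tens (\<tau> (tc_sign V (?u i))) (\<tau> (\<delta> (?v i))))"
    proof -
      have "tc_eq W (tc_sign W (\<tau> (?u i))) (\<tau> (tc_sign V (?u i)))"
        using tc_sign_comm[OF V W tc_coalg_hom_hom[OF \<tau>], of "?u i"] by simp
      moreover have "tc_eq W (\<delta>' (\<tau> (?u i))) (\<tau> (\<delta> (?u i)))" "tc_eq W (\<delta>' (\<tau> (?v i))) (\<tau> (\<delta> (?v i)))"
        using i by (auto intro!: s)
      ultimately show ?thesis
        unfolding 0 tens_simps add_0_right by (intro tc2_eq_add tc2_eq_tens tc_eq_refl)
    qed
  qed
  then show ?thesis by (simp add: tc2_eq_def module_hom.diff[OF module_hom_deconc])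
qed

text \<open>As for the chain defect, the coproduct of the homotopy defect on a word only involves defects on
  shorter words. Besides the homotopy defect itself the chain defect of \<open>\<psi>\<close> enters, since \<open>\<delta>'\<close> passes \<open>\<psi>\<close> in
  the second factor of \<open>\<eta> \<otimes> \<psi>\<close>; this is why the equations for the isotopy and the homotopy are solved
  together, length by length.\<close>

lemma deconc_homotopy_defect:
  assumes V: "graded_module V" and W: "graded_module W"
    and \<delta>: "tc_coderivation V \<delta>" and \<delta>': "tc_coderivation W \<delta>'"
    and \<phi>: "tc_coalg_hom V W \<phi>" and \<psi>: "tc_coalg_hom V W \<psi>" and \<eta>: "gcoder V W 1 \<phi> \<psi> \<eta>"
    and \<phi>\<delta>: "\<And>p. tc_eq W (\<delta>' (\<phi> p)) (\<phi> (\<delta> p))"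
    and s: "\<And>u. length u < length w \<Longrightarrow> tc_eq W (\<delta>' (\<psi> (basis u))) (\<psi> (\<delta> (basis u)))"
    and E: "\<And>u. length u < length w \<Longrightarrow>
       tc_eq W (\<delta>' (\<eta> (basis u)) + \<eta> (\<delta> (basis u))) (\<psi> (basis u) - \<phi> (basis u))"
  shows "tc2_eq W (deconc (\<psi> (basis w) - \<phi> (basis w) - (\<delta>' (\<eta> (basis w)) + \<eta> (\<delta> (basis w))))) 0"
proof -
  let ?I = "{1..<length w}"
  let ?u = "\<lambda>i. basis (take i w)" and ?v = "\<lambda>i. basis (drop i w)"
  note hm = gcoder_hom[OF \<eta>, THEN tc_hom_module_hom]
  have "tc2_eq W (deconc (\<eta> (basis w))) (\<Sum>i\<in>?I. tens (\<phi> (tc_sign V (?u i))) (\<eta> (?v i)) + tens (\<eta> (?u i)) (\<psi> (?v i)))"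
    using gcoder_deconc[OF \<eta>, of w] by (simp add: koszul_def)
  note A = coder_deconc_tensor[OF W \<delta>' this]
  note B = gcoder_deconc_tensor[OF V \<eta> coder_deconc[OF \<delta>, of w]]
  note C = tc2_eq_diff[OF coalg_hom_deconc[OF \<psi>, of w] coalg_hom_deconc[OF \<phi>, of w]]
  have "tc2_eq W (deconc (\<delta>' (\<eta> (basis w))) + deconc (\<eta> (\<delta> (basis w)))) (deconc (\<psi> (basis w)) - deconc (\<phi> (basis w)))"
  proof (rule tc2_eq_trans[OF tc2_eq_trans[OF tc2_eq_add[OF A B]] tc2_eq_sym[OF C]],
      unfold sum.distrib[symmetric] sum_subtractf[symmetric], rule tc2_eq_sum)
    fix i assume i: "i \<in> ?I"
    have sgn: "tc_eq W (tc_sign W (\<phi> (tc_sign V (?u i)))) (\<phi> (?u i))"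
      using tc_sign_comm[OF V W tc_coalg_hom_hom[OF \<phi>], of "tc_sign V (?u i)"]
      by (simp add: tc_sign_tc_sign[OF V] del: tc_sign_basis)
    have sgn2: "tc_eq W (tc_sign W (\<eta> (?u i))) (- \<eta> (tc_sign V (?u i)))"
      using tc_sign_comm[OF V W gcoder_hom[OF \<eta>], of "?u i"] by simp
    have "tc_eq V (\<delta> (tc_sign V (?u i))) (- tc_sign V (\<delta> (?u i)))"
      using tc_eq_diff[OF tc_eq_refl tc_sign_comm[OF V V tc_coderivation_hom[OF \<delta>], of "?u i"], of 0] 
      by (simp add: tc_eq_def) (metis tc_eq_def tc_eq_sym add.commute diff_minus_eq_add uminus_add_conv_diff)
    then have "tc_eq W (\<phi> (\<delta> (tc_sign V (?u i)))) (\<phi> (- tc_sign V (\<delta> (?u i))))"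
      by (rule tc_hom_cong[OF tc_coalg_hom_hom[OF \<phi>]])
    then have d1: "tc_eq W (\<delta>' (\<phi> (tc_sign V (?u i)))) (- \<phi> (tc_sign V (\<delta> (?u i))))"
      using tc_eq_trans[OF \<phi>\<delta>] by (simp add: module_hom.neg[OF tc_hom_module_hom[OF tc_coalg_hom_hom[OF \<phi>]]])
    have E1: "tc_eq W (\<delta>' (\<eta> (?u i)) + \<eta> (\<delta> (?u i))) (\<psi> (?u i) - \<phi> (?u i))"
      "tc_eq W (\<delta>' (\<eta> (?v i)) + \<eta> (\<delta> (?v i))) (\<psi> (?v i) - \<phi> (?v i))"
      "tc_eq W (\<delta>' (\<psi> (?v i))) (\<psi> (\<delta> (?v i)))"
      using i by (auto intro!: E s)
    let ?L = "tens (\<delta>' (\<phi> (tc_sign V (?u i)))) (\<eta> (?v i))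
        + tens (tc_sign W (\<phi> (tc_sign V (?u i)))) (\<delta>' (\<eta> (?v i)))
        + tens (\<delta>' (\<eta> (?u i))) (\<psi> (?v i)) + tens (tc_sign W (\<eta> (?u i))) (\<delta>' (\<psi> (?v i)))
        + (tens (\<phi> (tc_sign V (\<delta> (?u i)))) (\<eta> (?v i)) + tens (\<eta> (\<delta> (?u i))) (\<psi> (?v i))
        + tens (\<phi> (tc_sign V (tc_sign V (?u i)))) (\<eta> (\<delta> (?v i))) + tens (\<eta> (tc_sign V (?u i))) (\<psi> (\<delta> (?v i))))"
    have "tc2_eq W ?L (tens (- \<phi> (tc_sign V (\<delta> (?u i)))) (\<eta> (?v i))
        + tens (\<phi> (?u i)) (\<delta>' (\<eta> (?v i)))
        + tens (\<delta>' (\<eta> (?u i))) (\<psi> (?v i)) + tens (- \<eta> (tc_sign V (?u i))) (\<psi> (\<delta> (?v i)))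
        + (tens (\<phi> (tc_sign V (\<delta> (?u i)))) (\<eta> (?v i)) + tens (\<eta> (\<delta> (?u i))) (\<psi> (?v i))
        + tens (\<phi> (?u i)) (\<eta> (\<delta> (?v i))) + tens (\<eta> (tc_sign V (?u i))) (\<psi> (\<delta> (?v i)))))"
      unfolding tc_sign_tc_sign[OF V]
      by (intro tc2_eq_add tc2_eq_tens tc_eq_refl d1 sgn sgn2 E1)
    also have "\<dots> = tens (\<phi> (?u i)) (\<delta>' (\<eta> (?v i)) + \<eta> (\<delta> (?v i))) + tens (\<delta>' (\<eta> (?u i)) + \<eta> (\<delta> (?u i))) (\<psi> (?v i))"
      by (simp add: tens_simps)
    also have "tc2_eq W \<dots> (tens (\<phi> (?u i)) (\<psi> (?v i) - \<phi> (?v i)) + tens (\<psi> (?u i) - \<phi> (?u i)) (\<psi> (?v i)))"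
      by (intro tc2_eq_add tc2_eq_tens tc_eq_refl E1)
    also have "tens (\<phi> (?u i)) (\<psi> (?v i) - \<phi> (?v i)) + tens (\<psi> (?u i) - \<phi> (?u i)) (\<psi> (?v i))
       = tens (\<psi> (?u i)) (\<psi> (?v i)) - tens (\<phi> (?u i)) (\<phi> (?v i))"
      by (simp add: tens_simps)
    finally show "tc2_eq W ?L (tens (\<psi> (?u i)) (\<psi> (?v i)) - tens (\<phi> (?u i)) (\<phi> (?v i)))" .
  qed
  from tc2_eq_sym[OF this] show ?thesis
    by (simp add: tc2_eq_def module_hom.diff[OF module_hom_deconc] module_hom.add[OF module_hom_deconc])
qed

section \<open>The filtration by word length\<close>

text \<open>The words of length less than \<open>n\<close>, together with the relations; thus the index \<open>n + 1\<close> belongs to the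
  tensor powers up to order \<open>n\<close>.\<close>

definition tc_fil :: "('r::comm_ring_1, 'a::ab_group_add, 'm) graded_mod_scheme \<Rightarrow> nat \<Rightarrow> ('a list \<Rightarrow>\<^sub>0 'r) set" where
  "tc_fil V n = fm.span (tc_rel V \<union> {basis w | w. length w < n})"

lemma subspace_tc_fil [simp, intro]: "fm.subspace (tc_fil V n)"
  by (simp add: tc_fil_def)

lemma tc_rel_fil: "p \<in> tc_rel V \<Longrightarrow> p \<in> tc_fil V n"
  unfolding tc_fil_def by (rule fm.span_base) simp

lemma word_fil: "length w < n \<Longrightarrow> basis w \<in> tc_fil V n"
  unfolding tc_fil_def by (rule fm.span_base) blast

lemma tc_fil_induct [consumes 3, case_names rel word]:
  assumes "p \<in> tc_fil V n" "module_hom fscale s f" "module.subspace s S"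
    and "\<And>p. p \<in> tc_rel V \<Longrightarrow> f p \<in> S" and "\<And>w. length w < n \<Longrightarrow> f (basis w) \<in> S"
  shows "f p \<in> S"
  using assms(1) unfolding tc_fil_def
  by (rule module_hom_mem_span[OF assms(2,3), rotated]) (auto simp: assms(4,5))

lemma tc_fil_mono: "p \<in> tc_fil V m \<Longrightarrow> m \<le> n \<Longrightarrow> p \<in> tc_fil V n"
  unfolding tc_fil_def using fm.span_mono[of "tc_rel V \<union> {basis w | w. length w < m}" "tc_rel V \<union> {basis w | w. length w < n}"]
  by fastforce

lemma tc_fil_cong: "tc_eq V p q \<Longrightarrow> p \<in> tc_fil V n \<longleftrightarrow> q \<in> tc_fil V n"
  using fm.subspace_add[OF subspace_tc_fil, of "p - q" V n q]
    fm.subspace_diff[OF subspace_tc_fil, of p V n "p - q"]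
  by (auto simp: tc_eq_def tc_rel_fil)

lemma pcons_fil: "p \<in> tc_fil V n \<Longrightarrow> pcons x p \<in> tc_fil V (Suc n)"
  by (erule tc_fil_induct[OF _ module_hom_pcons subspace_tc_fil])
    (auto simp: fm.subspace_0 intro: word_fil tc_rel_fil[OF pcons_rel])

definition fil_pres :: "('r::comm_ring_1, 'a::ab_group_add, 'm) graded_mod_scheme \<Rightarrow>
     ('r, 'b::ab_group_add, 'n) graded_mod_scheme \<Rightarrow> (('a list \<Rightarrow>\<^sub>0 'r) \<Rightarrow> ('b list \<Rightarrow>\<^sub>0 'r)) \<Rightarrow> bool" where
  "fil_pres V W f \<longleftrightarrow> (\<forall>n p. p \<in> tc_fil V n \<longrightarrow> f p \<in> tc_fil W n)"

lemma fil_presD: "fil_pres V W f \<Longrightarrow> p \<in> tc_fil V n \<Longrightarrow> f p \<in> tc_fil W n"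
  by (simp add: fil_pres_def)

lemma fil_presI:
  assumes f: "tc_hom V W d f" and w: "\<And>w. f (basis w) \<in> tc_fil W (Suc (length w))"
  shows "fil_pres V W f"
  unfolding fil_pres_def
proof (intro allI impI)
  fix n p assume "p \<in> tc_fil V n"
  then show "f p \<in> tc_fil W n"
    using tc_hom_module_hom[OF f] subspace_tc_fil
    by (rule tc_fil_induct) (auto intro: tc_rel_fil tc_hom_rel[OF f] tc_fil_mono[OF w])
qed

lemma gcoder_fil_pres:
  assumes W: "graded_module W" and g: "gcoder V W d \<phi> \<psi> \<eta>" and \<psi>: "fil_pres V W \<psi>"
  shows "fil_pres V W \<eta>"
proof (rule fil_presI[OF gcoder_hom[OF g]])
  fix w show "\<eta> (basis w) \<in> tc_fil W (Suc (length w))"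
  proof (induction w rule: length_induct)
    case (1 w)
    show ?case
    proof (cases "w = []")
      case True
      then show ?thesis using tc_hom_rel[OF gcoder_hom[OF g] rel_Nil] tc_rel_fil by auto
    next
      case False
      show ?thesis
        unfolding tc_fil_cong[OF gcoder_recursion[OF W g, of w]]
      proof (intro fm.subspace_add[OF subspace_tc_fil] fm.subspace_sum[OF subspace_tc_fil])
        show "basis [tc_proj W (\<eta> (basis w))] \<in> tc_fil W (Suc (length w))" using False by (intro word_fil) simp
        fix i assume i: "i \<in> {1..<length w}"
        have "\<eta> (basis (drop i w)) \<in> tc_fil W (Suc (length (drop i w)))"
          by (rule 1[rule_format]) (use i in auto)
        from tc_fil_mono[OF pcons_fil[OF this]]
        show "pcons x (\<eta> (basis (drop i w))) \<in> tc_fil W (Suc (length w))" for x using i by auto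
        have "\<psi> (basis (drop i w)) \<in> tc_fil W (Suc (length (drop i w)))"
          by (rule fil_presD[OF \<psi> word_fil]) simp
        from tc_fil_mono[OF pcons_fil[OF this]]
        show "pcons x (\<psi> (basis (drop i w))) \<in> tc_fil W (Suc (length w))" for x using i by auto
      qed
    qed
  qed
qed

lemma fil_pres_zero: "fil_pres V W (\<lambda>_. 0)"
  by (simp add: fil_pres_def fm.subspace_0)

lemma fil_pres_id: "fil_pres V V id"
  by (simp add: fil_pres_def)

lemma coalg_hom_fil_pres: "graded_module W \<Longrightarrow> tc_coalg_hom V W \<phi> \<Longrightarrow> fil_pres V W \<phi>"
  unfolding tc_coalg_hom_iff by (rule gcoder_fil_pres[OF _ _ fil_pres_zero])

lemma coder_fil_pres: "graded_module V \<Longrightarrow> tc_coderivation V \<delta> \<Longrightarrow> fil_pres V V \<delta>"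
  unfolding tc_coderivation_iff by (rule gcoder_fil_pres[OF _ _ fil_pres_id])

lemma add_diff_add_eq: "(a + b) - (c + d) = (a - c) + (b - d :: 'z::ab_group_add)"
  by (simp add: algebra_simps)

text \<open>The induced map on the associated graded of the word length filtration is determined by the linear
  parts: in the recursion, a component of arity at least two replaces at least two letters by one and
  therefore lands in shorter words. So two maps with equal linear components differ by shorter words.\<close>

lemma gcoder_leading:
  assumes W: "graded_module W" and g: "gcoder V W d \<phi> \<psi> \<eta>" and g': "gcoder V W d \<phi>' \<psi>' \<eta>'"
    and \<phi>: "\<And>x. tc_proj W (\<phi> (basis [x])) = tc_proj W (\<phi>' (basis [x]))"
    and \<eta>: "\<And>x. tc_proj W (\<eta> (basis [x])) = tc_proj W (\<eta>' (basis [x]))"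
    and fil: "fil_pres V W \<psi>" "fil_pres V W \<psi>'"
    and \<psi>: "\<And>w. \<psi> (basis w) - \<psi>' (basis w) \<in> tc_fil W (length w)"
  shows "\<eta> (basis w) - \<eta>' (basis w) \<in> tc_fil W (length w)"
proof (induction w rule: length_induct)
  case (1 w)
  note sub = subspace_tc_fil[of W "length w"]
  have long: "pcons x (f (basis (drop i w))) \<in> tc_fil W (length w)"
    if "fil_pres V W f" "2 \<le> i" "i < length w" for f x i
  proof -
    have "f (basis (drop i w)) \<in> tc_fil W (Suc (length (drop i w)))"
      by (rule fil_presD[OF that(1) word_fil]) simp
    from tc_fil_mono[OF pcons_fil[OF this]] show ?thesis using that by auto
  qed
  have short: "pcons x (f (basis (drop 1 w))) - pcons x (f' (basis (drop 1 w))) \<in> tc_fil W (length w)"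
    if "f (basis (drop 1 w)) - f' (basis (drop 1 w)) \<in> tc_fil W (length (drop 1 w))" "1 < length w" for f f' x
  proof -
    have "Suc (length (drop 1 w)) = length w" using that(2) by simp
    with pcons_fil[OF that(1), of x] show ?thesis by (simp only: module_hom.diff[OF module_hom_pcons])
  qed
  note fil\<eta> = gcoder_fil_pres[OF W g fil(1)] gcoder_fil_pres[OF W g' fil(2)]
  show ?case
  proof (cases "w = []")
    case True
    then have "\<eta> (basis w) \<in> tc_rel W" "\<eta>' (basis w) \<in> tc_rel W"
      using tc_hom_rel[OF gcoder_hom[OF g] rel_Nil] tc_hom_rel[OF gcoder_hom[OF g'] rel_Nil] by auto
    then show ?thesis by (intro fm.subspace_diff[OF sub] tc_rel_fil)
  next
    case False
    have "basis [tc_proj W (\<eta> (basis w))] - basis [tc_proj W (\<eta>' (basis w))] \<in> tc_fil W (length w)"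
    proof (cases "length w = 1")
      case True
      then obtain x where "w = [x]" by (auto simp: length_Suc_conv)
      then show ?thesis using \<eta> by (simp add: fm.subspace_0)
    next
      case False
      then show ?thesis using \<open>w \<noteq> []\<close>
        by (intro fm.subspace_diff[OF sub] word_fil) (auto simp: neq_Nil_conv)
    qed
    moreover have "(\<Sum>i\<in>{1..<length w}.
        (recursion_term V W d \<phi> \<psi> \<eta> w i)
      - (recursion_term V W d \<phi>' \<psi>' \<eta>' w i)) \<in> tc_fil W (length w)"
    proof (rule fm.subspace_sum[OF sub])
      fix i assume i: "i \<in> {1..<length w}"
      show "(recursion_term V W d \<phi> \<psi> \<eta> w i)
      - (recursion_term V W d \<phi>' \<psi>' \<eta>' w i) \<in> tc_fil W (length w)"
      proof (cases "i = 1")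
        case True
        then have l: "1 < length w" using i by simp
        obtain x where x: "take i w = [x]" using True False by (cases w) auto
        have "\<eta> (basis (drop 1 w)) - \<eta>' (basis (drop 1 w)) \<in> tc_fil W (length (drop 1 w))"
          by (rule 1[rule_format]) (use l in auto)
        from fm.subspace_add[OF sub short[of \<eta> \<eta>', OF this l] short[of \<psi> \<psi>', OF \<psi> l]]
        show ?thesis
          unfolding x koszul_basis list.map \<phi> \<eta> add_diff_add_eq unfolding True .
      next
        case False
        then have "2 \<le> i" "i < length w" using i by auto
        then show ?thesis
          by (intro fm.subspace_diff[OF sub] fm.subspace_add[OF sub] long fil fil\<eta>)
      qed
    qed
    ultimately have "(basis [tc_proj W (\<eta> (basis w))] + (\<Sum>i\<in>{1..<length w}.
        recursion_term V W d \<phi> \<psi> \<eta> w i))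
     - (basis [tc_proj W (\<eta>' (basis w))] + (\<Sum>i\<in>{1..<length w}.
        recursion_term V W d \<phi>' \<psi>' \<eta>' w i))
      \<in> tc_fil W (length w)"
      unfolding add_diff_add_eq sum_subtractf[symmetric] by (rule fm.subspace_add[OF sub])
    then show ?thesis
      using tc_fil_cong[OF tc_eq_diff[OF gcoder_recursion[OF W g, of w] gcoder_recursion[OF W g', of w]]] by blast
  qed
qed

section \<open>Chain conditions and components\<close>

lemma tc_eq_wordsI:
  assumes "flinear f" "flinear g"
    and "\<And>w. tc_eq W (f (basis w)) (g (basis w))"
  shows "tc_eq W (f p) (g p)"
  using module_hom_mem[OF module_hom_minus[OF assms(1,2)] subspace_tc_rel[of W]] assms(3) by (simp add: tc_eq_def)

lemma tc_eq_primitiveI: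
  assumes W: "graded_module W" and "tc2_eq W (deconc (p - q)) 0" and "tc_proj W p = tc_proj W q"
  shows "tc_eq W p q"
proof -
  have "tc_eq W (p - q) (basis [0])"
    using primitive_eq_single[OF assms(1,2)] assms(3)
    by (simp add: module_hom.diff[OF module_hom_tc_proj[OF graded_module_module[OF W]]])
  from tc_eq_trans[OF this single_zero] show ?thesis by (simp add: tc_eq_def)
qed

text \<open>By induction the defect on a word is primitive, that is, a single letter, and this letter is the
  component of the defect, which vanishes by assumption.\<close>

lemma coalg_chain_map_upto:
  assumes V: "graded_module V" and W: "graded_module W"
    and \<delta>: "tc_coderivation V \<delta>" and \<delta>': "tc_coderivation W \<delta>'" and \<tau>: "tc_coalg_hom V W \<tau>"
    and c: "\<And>w. length w < n \<Longrightarrow> tc_proj W (\<delta>' (\<tau> (basis w))) = tc_proj W (\<tau> (\<delta> (basis w)))"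
    and "length w < n"
  shows "tc_eq W (\<delta>' (\<tau> (basis w))) (\<tau> (\<delta> (basis w)))"
  using \<open>length w < n\<close>
proof (induction w rule: length_induct)
  case (1 w)
  show ?case
    by (rule tc_eq_primitiveI[OF W deconc_chain_defect[OF V W \<delta> \<delta>' \<tau>] c]) (use 1 in auto)
qed

lemma coalg_chain_mapI:
  assumes V: "graded_module V" and W: "graded_module W"
    and \<delta>: "tc_coderivation V \<delta>" and \<delta>': "tc_coderivation W \<delta>'" and \<tau>: "tc_coalg_hom V W \<tau>"
    and c: "\<And>w. tc_proj W (\<delta>' (\<tau> (basis w))) = tc_proj W (\<tau> (\<delta> (basis w)))"
  shows "tc_eq W (\<delta>' (\<tau> p)) (\<tau> (\<delta> p))"
proof (rule tc_eq_wordsI[where f = "\<lambda>p. \<delta>' (\<tau> p)" and g = "\<lambda>p. \<tau> (\<delta> p)"])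
  note h = tc_hom_module_hom[OF tc_coderivation_hom[OF \<delta>]] tc_hom_module_hom[OF tc_coderivation_hom[OF \<delta>']]
    tc_hom_module_hom[OF tc_coalg_hom_hom[OF \<tau>]]
  show "flinear (\<lambda>p. \<delta>' (\<tau> p))" "flinear (\<lambda>p. \<tau> (\<delta> p))"
    by (rule module_hom_comp[OF h(3,2)], rule module_hom_comp[OF h(1,3)])
  show "tc_eq W (\<delta>' (\<tau> (basis w))) (\<tau> (\<delta> (basis w)))" for w
    using coalg_chain_map_upto[OF V W \<delta> \<delta>' \<tau> c, where n = "Suc (length w)" and w = w] by simp
qed

lemma coalg_homotopy_upto:
  assumes V: "graded_module V" and W: "graded_module W"
    and \<delta>: "tc_coderivation V \<delta>" and \<delta>': "tc_coderivation W \<delta>'"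
    and \<phi>: "tc_coalg_hom V W \<phi>" and \<psi>: "tc_coalg_hom V W \<psi>" and \<eta>: "gcoder V W 1 \<phi> \<psi> \<eta>"
    and \<phi>\<delta>: "\<And>p. tc_eq W (\<delta>' (\<phi> p)) (\<phi> (\<delta> p))"
    and s: "\<And>w. length w < n \<Longrightarrow> tc_eq W (\<delta>' (\<psi> (basis w))) (\<psi> (\<delta> (basis w)))"
    and c: "\<And>w. length w < n \<Longrightarrow> tc_proj W (\<psi> (basis w) - \<phi> (basis w)) = tc_proj W (\<delta>' (\<eta> (basis w)) + \<eta> (\<delta> (basis w)))"
    and "length w < n"
  shows "tc_eq W (\<psi> (basis w) - \<phi> (basis w)) (\<delta>' (\<eta> (basis w)) + \<eta> (\<delta> (basis w)))"
  using \<open>length w < n\<close>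
proof (induction w rule: length_induct)
  case (1 w)
  show ?case
    by (rule tc_eq_primitiveI[OF W deconc_homotopy_defect[OF V W \<delta> \<delta>' \<phi> \<psi> \<eta> \<phi>\<delta> s tc_eq_sym] c])
      (use 1 in auto)
qed

lemma coalg_homotopyI:
  assumes V: "graded_module V" and W: "graded_module W"
    and \<delta>: "tc_coderivation V \<delta>" and \<delta>': "tc_coderivation W \<delta>'"
    and \<phi>: "tc_coalg_hom V W \<phi>" and \<psi>: "tc_coalg_hom V W \<psi>" and \<eta>: "gcoder V W 1 \<phi> \<psi> \<eta>"
    and \<phi>\<delta>: "\<And>p. tc_eq W (\<delta>' (\<phi> p)) (\<phi> (\<delta> p))"
    and \<psi>\<delta>: "\<And>p. tc_eq W (\<delta>' (\<psi> p)) (\<psi> (\<delta> p))"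
    and c: "\<And>w. tc_proj W (\<psi> (basis w) - \<phi> (basis w)) = tc_proj W (\<delta>' (\<eta> (basis w)) + \<eta> (\<delta> (basis w)))"
  shows "tc_eq W (\<psi> p - \<phi> p) (\<delta>' (\<eta> p) + \<eta> (\<delta> p))"
proof (rule tc_eq_wordsI[where f = "\<lambda>p. \<psi> p - \<phi> p" and g = "\<lambda>p. \<delta>' (\<eta> p) + \<eta> (\<delta> p)"])
  note h = tc_hom_module_hom[OF tc_coderivation_hom[OF \<delta>]] tc_hom_module_hom[OF tc_coderivation_hom[OF \<delta>']]
    tc_hom_module_hom[OF tc_coalg_hom_hom[OF \<phi>]] tc_hom_module_hom[OF tc_coalg_hom_hom[OF \<psi>]]
    tc_hom_module_hom[OF gcoder_hom[OF \<eta>]]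
  show "flinear (\<lambda>p. \<psi> p - \<phi> p)" by (rule module_hom_minus[OF h(4,3)])
  show "flinear (\<lambda>p. \<delta>' (\<eta> p) + \<eta> (\<delta> p))"
    by (rule module_hom_plus[OF module_hom_comp[OF h(5,2)] module_hom_comp[OF h(1,5)]])
  show "tc_eq W (\<psi> (basis w) - \<phi> (basis w)) (\<delta>' (\<eta> (basis w)) + \<eta> (\<delta> (basis w)))" for w
    using coalg_homotopy_upto[OF V W \<delta> \<delta>' \<phi> \<psi> \<eta> \<phi>\<delta> \<psi>\<delta> c, where n = "Suc (length w)" and w = w] by simp
qed

lemma tc_coalg_hom_id: "tc_coalg_hom V V id"
  unfolding tc_coalg_hom_iff
  by (rule gcoderI) (simp_all add: tc_hom_id tc_hom_zero deconc_basis koszul_def tens_simps)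

lemma tc_coalg_hom_compose:
  assumes W: "graded_module W" and \<phi>: "tc_coalg_hom V W \<phi>" and \<psi>: "tc_coalg_hom W X \<psi>"
  shows "tc_coalg_hom V X (\<lambda>p. \<psi> (\<phi> p))"
  unfolding tc_coalg_hom_iff
proof (rule gcoderI)
  show h: "tc_hom V X 0 (\<lambda>p. \<psi> (\<phi> p))"
    using tc_hom_compose[OF tc_coalg_hom_hom[OF \<phi>] tc_coalg_hom_hom[OF \<psi>]] by simp
  show "tc_hom V X 0 (\<lambda>p. \<psi> (\<phi> p))" by (rule h)
  fix w
  have "tc2_eq W (deconc (\<phi> (basis w))) (\<Sum>i\<in>{1..<length w}. tens (\<phi> (basis (take i w))) (\<phi> (basis (drop i w))) + tens 0 0)"
    using coalg_hom_deconc[OF \<phi>, of w] by (simp add: tens_simps)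
  from coalg_hom_deconc_tensor[OF W \<psi> this]
  show "tc2_eq X (deconc (\<psi> (\<phi> (basis w)))) (\<Sum>i\<in>{1..<length w}.
     tens (\<psi> (\<phi> (koszul V 0 (basis (take i w))))) (\<psi> (\<phi> (basis (drop i w)))) + tens (\<psi> (\<phi> (basis (take i w)))) 0)"
    by (simp add: koszul_def tens_simps module_hom.zero[OF tc_hom_module_hom[OF tc_coalg_hom_hom[OF \<psi>]]])
qed (rule tc_hom_zero)

section \<open>Tensor powers of homotopy equivalences\<close>

text \<open>The tensor powers of a linear map assemble to the coalgebra morphism whose only component is that map.
  Describing it by its component, which is the map composed with the projection, makes all identities
  between tensor powers consequences of identities between the linear maps.\<close>

lemma linear_coalg_hom:
  assumes V: "graded_module V" and W: "graded_module W" and k: "graded_hom V W 0 k"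
  obtains K where "tc_coalg_hom V W K" "\<And>p. tc_proj W (K p) = k (tc_proj V p)"
  using coalg_hom_exists[OF V W tc_fun_graded_hom[OF tc_fun_proj[OF V] k]] by auto

lemma linear_coderivation:
  assumes V: "graded_module V" and b: "graded_hom V V (-1) b"
  obtains d where "tc_coderivation V d" "\<And>p. tc_proj V (d p) = b (tc_proj V p)"
  using gcoder_exists[OF V V tc_fun_graded_hom[OF tc_fun_proj[OF V] b] tc_coalg_hom_id tc_coalg_hom_id]
  by (auto simp: tc_coderivation_iff)

lemma linear_chain_map:
  assumes V: "graded_module V" and W: "graded_module W"
    and d: "tc_coderivation V d" "\<And>p. tc_proj V (d p) = b (tc_proj V p)"
    and d': "tc_coderivation W d'" "\<And>p. tc_proj W (d' p) = b' (tc_proj W p)"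
    and K: "tc_coalg_hom V W K" "\<And>p. tc_proj W (K p) = k (tc_proj V p)"
    and kb: "\<And>x. k (b x) = b' (k x)"
  shows "tc_eq W (d' (K p)) (K (d p))"
  by (rule coalg_chain_mapI[OF V W d(1) d'(1) K(1)]) (simp add: d d' K kb)

text \<open>The homotopy on tensor powers is the signed sum of the maps \<open>k \<otimes> \<dots> \<otimes> k \<otimes> r \<otimes> 1 \<otimes> \<dots> \<otimes> 1\<close>. It appears here as the
  homotopy map from the tensor powers of \<open>k\<close> to the identity with the single component \<open>r\<close>.\<close>

lemma linear_homotopy:
  assumes V: "graded_module V"
    and d: "tc_coderivation V d" "\<And>p. tc_proj V (d p) = b (tc_proj V p)"
    and K: "tc_coalg_hom V V K" "\<And>p. tc_proj V (K p) = k (tc_proj V p)" "\<And>p. tc_eq V (d (K p)) (K (d p))"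
    and r: "graded_hom V V 1 r" "\<And>x. x - k x = b (r x) + r (b x)"
  obtains R where "tc_hom V V 1 R" "fil_pres V V R" "\<And>p. tc_eq V (p - K p) (d (R p) + R (d p))"
proof -
  obtain R where R: "gcoder V V 1 K id R" and c: "\<And>p. tc_proj V (R p) = r (tc_proj V p)"
    using gcoder_exists[OF V V tc_fun_graded_hom[OF tc_fun_proj[OF V] r(1)] K(1) tc_coalg_hom_id] by auto
  note pr = module_hom_tc_proj[OF graded_module_module[OF V]]
  have "tc_eq V (id p - K p) (d (R p) + R (d p))" for p
    by (rule coalg_homotopyI[OF V V d(1) d(1) K(1) tc_coalg_hom_id R K(3)])
      (simp_all add: module_hom.add[OF pr] module_hom.diff[OF pr] d K c r(2)[symmetric])
  with gcoder_hom[OF R] gcoder_fil_pres[OF V R fil_pres_id] show ?thesis by (intro that) auto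
qed

section \<open>Solving the linearized equations\<close>

text \<open>Functionals restricted to words of length at most \<open>n\<close> and vanishing on shorter ones are maps out of the
  tensor power of order \<open>n\<close>. The hypotheses on \<open>d\<close> and \<open>e\<close> say that \<open>(d, e)\<close> is a cycle in the mapping cone of
  precomposition with \<open>K\<close>, from maps out of the tensor power of \<open>W\<close> to maps out of that of \<open>V\<close>. Since \<open>K\<close>
  has the homotopy inverse \<open>L\<close>, this cone is contractible and the cycle is a boundary.

  The witness comes in two steps. First \<open>t\<^sub>0 = d S - e L\<close> bounds \<open>-d\<close>, because \<open>e L\<close> bounds \<open>d K L\<close> and \<open>S\<close>
  compares \<open>K L\<close> with the identity. Then \<open>z = e + t\<^sub>0 K\<close> is a cycle; subtracting the cycle \<open>z L\<close> from \<open>t\<^sub>0\<close>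
  turns \<open>z\<close> into \<open>z - z L K\<close>, which is the boundary of \<open>z R\<close>.\<close>

lemma cone_cycle_is_boundary:
  assumes V: "graded_module V" and W: "graded_module W"
    and b: "graded_hom W W (-1) b"
    and dV: "tc_hom V V (-1) dV" "fil_pres V V dV" and dW: "tc_hom W W (-1) dW" "fil_pres W W dW"
    and K: "tc_hom V W 0 K" "fil_pres V W K" and L: "tc_hom W V 0 L" "fil_pres W V L"
    and Kd: "\<And>p. tc_eq W (dW (K p)) (K (dV p))" and Ld: "\<And>p. tc_eq V (dV (L p)) (L (dW p))"
    and R: "tc_hom V V 1 R" "fil_pres V V R" "\<And>p. tc_eq V (p - L (K p)) (dV (R p) + R (dV p))"
    and S: "tc_hom W W 1 S" "fil_pres W W S" "\<And>p. tc_eq W (p - K (L p)) (dW (S p) + S (dW p))"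
    and d: "tc_fun W W (-1) d" "\<And>p. p \<in> tc_fil W n \<Longrightarrow> d p = 0"
    and e: "tc_fun V W 0 e" "\<And>p. p \<in> tc_fil V n \<Longrightarrow> e p = 0"
    and dc: "\<And>p. p \<in> tc_fil W (Suc n) \<Longrightarrow> b (d p) + d (dW p) = 0"
    and ec: "\<And>p. p \<in> tc_fil V (Suc n) \<Longrightarrow> b (e p) - e (dV p) = d (K p)"
  obtains t s where "tc_fun W W 0 t" "\<And>p. p \<in> tc_fil W n \<Longrightarrow> t p = 0"
    and "tc_fun V W 1 s" "\<And>p. p \<in> tc_fil V n \<Longrightarrow> s p = 0"
    and "\<And>p. p \<in> tc_fil W (Suc n) \<Longrightarrow> d p + b (t p) - t (dW p) = 0"
    and "\<And>p. p \<in> tc_fil V (Suc n) \<Longrightarrow> e p + t (K p) - (b (s p) + s (dV p)) = 0"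
proof -
  have bm: "module_hom (gscale W) (gscale W) b" using b by (simp add: graded_hom_def)
  note ba = module_hom.add[OF bm] module_hom.diff[OF bm] module_hom.neg[OF bm]
  note da = module_hom.add[OF tc_fun_module_hom[OF d(1)]] module_hom.diff[OF tc_fun_module_hom[OF d(1)]]
  define t0 where "t0 p = d (S p) - e (L p)" for p
  define z where "z p = e p + t0 (K p)" for p
  have t0: "tc_fun W W 0 t0"
    unfolding t0_def[abs_def]
    by (intro tc_fun_diff W tc_fun_tc_hom[OF S(1) d(1)] tc_fun_tc_hom[OF L(1) e(1)]) auto
  have z: "tc_fun V W 0 z"
    unfolding z_def[abs_def] by (intro tc_fun_plus W e(1) tc_fun_tc_hom[OF K(1) t0]) auto
  have t0_fil: "t0 p = 0" if "p \<in> tc_fil W n" for p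
    unfolding t0_def using that by (simp add: d(2) e(2) fil_presD[OF S(2)] fil_presD[OF L(2)])
  have z_fil: "z p = 0" if "p \<in> tc_fil V n" for p
    unfolding z_def using that by (simp add: e(2) t0_fil fil_presD[OF K(2)])
  note ea = module_hom.add[OF tc_fun_module_hom[OF e(1)]] module_hom.diff[OF tc_fun_module_hom[OF e(1)]]
  note za = module_hom.add[OF tc_fun_module_hom[OF z]] module_hom.diff[OF tc_fun_module_hom[OF z]]
  note t0a = module_hom.add[OF tc_fun_module_hom[OF t0]] module_hom.diff[OF tc_fun_module_hom[OF t0]]
  have t0c: "b (t0 p) - t0 (dW p) = - d p" if p: "p \<in> tc_fil W (Suc n)" for p
  proof -
    have "b (d (S p)) = - d (dW (S p))"
      using dc[OF fil_presD[OF S(2) p]] by (simp add: eq_neg_iff_add_eq_0)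
    moreover have "b (e (L p)) = e (dV (L p)) + d (K (L p))"
      using ec[OF fil_presD[OF L(2) p]] by (simp add: algebra_simps)
    moreover have "e (dV (L p)) = e (L (dW p))" by (rule tc_fun_cong[OF e(1) Ld])
    moreover have "d p - d (K (L p)) = d (dW (S p)) + d (S (dW p))"
      using tc_fun_cong[OF d(1) S(3)[of p]] by (simp add: da)
    ultimately show ?thesis by (simp add: t0_def ba algebra_simps)
  qed
  have zc: "b (z p) = z (dV p)" if p: "p \<in> tc_fil V (Suc n)" for p
  proof -
    have "b (t0 (K p)) - t0 (dW (K p)) = - d (K p)" by (rule t0c[OF fil_presD[OF K(2) p]])
    moreover have "t0 (dW (K p)) = t0 (K (dV p))" by (rule tc_fun_cong[OF t0 Kd])
    ultimately show ?thesis using ec[OF p] by (simp add: z_def ba algebra_simps)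
  qed
  show ?thesis
  proof (rule that[of "\<lambda>p. t0 p - z (L p)" "\<lambda>p. z (R p)"])
    show "tc_fun W W 0 (\<lambda>p. t0 p - z (L p))"
      by (intro tc_fun_diff W t0 tc_fun_tc_hom[OF L(1) z]) auto
    show "tc_fun V W 1 (\<lambda>p. z (R p))" by (intro tc_fun_tc_hom[OF R(1) z]) auto
    show "t0 p - z (L p) = 0" if "p \<in> tc_fil W n" for p
      using that by (simp add: t0_fil z_fil fil_presD[OF L(2)])
    show "z (R p) = 0" if "p \<in> tc_fil V n" for p using that by (simp add: z_fil fil_presD[OF R(2)])
    show "d p + b (t0 p - z (L p)) - (t0 (dW p) - z (L (dW p))) = 0" if p: "p \<in> tc_fil W (Suc n)" for p
    proof -
      have "z (dV (L p)) = z (L (dW p))" by (rule tc_fun_cong[OF z Ld])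
      then show ?thesis using t0c[OF p] zc[OF fil_presD[OF L(2) p]] by (simp add: ba algebra_simps)
    qed
    show "e p + (t0 (K p) - z (L (K p))) - (b (z (R p)) + z (R (dV p))) = 0" if p: "p \<in> tc_fil V (Suc n)" for p
    proof -
      have "z p - z (L (K p)) = z (dV (R p)) + z (R (dV p))"
        using tc_fun_cong[OF z R(3)[of p]] by (simp add: za)
      then show ?thesis using zc[OF fil_presD[OF R(2) p]] by (simp add: z_def[of p] algebra_simps)
    qed
  qed
qed

section \<open>The obstruction argument\<close>

lemma fil_single:
  assumes f: "tc_hom V W d f" and a: "tc_fun V W e a"
    and w: "\<And>w. length w < n \<Longrightarrow> tc_eq W (f (basis w)) (basis [a (basis w)])"
    and p: "p \<in> tc_fil V n"
  shows "tc_eq W (f p) (basis [a p])"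
proof -
  let ?J = "lin fscale (\<lambda>w. basis [a (basis w)])"
  have J: "tc_hom V W e ?J" by (rule tc_hom_single[OF a])
  have "f p - ?J p \<in> tc_rel W"
    using p module_hom_minus[OF tc_hom_module_hom[OF f] tc_hom_module_hom[OF J]] subspace_tc_rel
  proof (rule tc_fil_induct[where f = "\<lambda>p. f p - ?J p"])
    show "p \<in> tc_rel V \<Longrightarrow> f p - ?J p \<in> tc_rel W" for p
      by (intro fm.subspace_diff[OF subspace_tc_rel] tc_hom_rel[OF f] tc_hom_rel[OF J])
    show "f (basis w) - ?J (basis w) \<in> tc_rel W" if "length w < n" for w
      using w[OF that] by (simp add: module_fscale tc_eq_def)
  qed
  moreover have "tc_eq W (?J p) (basis [a p])"
    by (rule single_linear_extension[OF tc_hom_module_hom[OF J] tc_fun_module_hom[OF a]]) (simp add: module_fscale)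
  ultimately show ?thesis by (auto simp: tc_eq_def[symmetric] intro: tc_eq_trans)
qed

lemma leading_fil:
  assumes f: "tc_hom V W d f" and f': "tc_hom V W d' f'"
    and w: "\<And>w. f (basis w) - f' (basis w) \<in> tc_fil W (length w)"
    and p: "p \<in> tc_fil V (Suc n)"
  shows "f p - f' p \<in> tc_fil W n"
  using p module_hom_minus[OF tc_hom_module_hom[OF f] tc_hom_module_hom[OF f']] subspace_tc_fil
proof (rule tc_fil_induct[where f = "\<lambda>p. f p - f' p"])
  show "p \<in> tc_rel V \<Longrightarrow> f p - f' p \<in> tc_fil W n" for p
    by (intro tc_rel_fil fm.subspace_diff[OF subspace_tc_rel] tc_hom_rel[OF f] tc_hom_rel[OF f'])
  show "length w < Suc n \<Longrightarrow> f (basis w) - f' (basis w) \<in> tc_fil W n" for w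
    by (rule tc_fil_mono[OF w]) simp
qed

lemma tc_fun_fil_zero:
  assumes W: "graded_module W" and a: "tc_fun V W d a" and w: "\<And>w. length w < n \<Longrightarrow> a (basis w) = 0" and p: "p \<in> tc_fil V n"
  shows "a p = 0"
proof -
  have "a p \<in> {0}"
    using p tc_fun_module_hom[OF a] module.subspace_single_0[OF graded_module_module[OF W]]
    by (rule tc_fil_induct) (auto simp: w tc_fun_rel[OF a])
  then show ?thesis by simp
qed

text \<open>The data on the tensor coalgebras: the codifferentials of three A-infinity algebras, the last two with
  the same linear part \<open>bW\<close>, two morphisms \<open>\<kappa>\<close> and \<open>\<chi>\<close> from the first to the second and to the third, a
  homotopy inverse \<open>l\<close> of the linear part \<open>k\<close> of \<open>\<kappa>\<close> and a homotopy \<open>s\<close> between the linear parts of \<open>\<chi>\<close> and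
  \<open>\<kappa>\<close>. The isotopy sought is a morphism \<open>\<tau>\<close> from the second algebra to the third.\<close>

locale isotopy_problem =
  fixes V :: "('r::comm_ring_1, 'a::ab_group_add, 'm) graded_mod_scheme"
    and W :: "('r, 'c::ab_group_add, 'n) graded_mod_scheme"
    and \<delta> \<delta>' \<delta>'' \<kappa> \<chi> and bV :: "'a \<Rightarrow> 'a" and bW :: "'c \<Rightarrow> 'c"
    and k c :: "'a \<Rightarrow> 'c" and l :: "'c \<Rightarrow> 'a" and r :: "'a \<Rightarrow> 'a" and q :: "'c \<Rightarrow> 'c" and s :: "'a \<Rightarrow> 'c"
  assumes V: "graded_module V" and W: "graded_module W"
    and \<delta>: "tc_coderivation V \<delta>" "\<And>p. tc_eq V (\<delta> (\<delta> p)) 0" "\<And>x. tc_proj V (\<delta> (basis [x])) = bV x"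
    and \<delta>': "tc_coderivation W \<delta>'" "\<And>p. tc_eq W (\<delta>' (\<delta>' p)) 0" "\<And>x. tc_proj W (\<delta>' (basis [x])) = bW x"
    and \<delta>'': "tc_coderivation W \<delta>''" "\<And>p. tc_eq W (\<delta>'' (\<delta>'' p)) 0" "\<And>x. tc_proj W (\<delta>'' (basis [x])) = bW x"
    and \<kappa>: "tc_coalg_hom V W \<kappa>" "\<And>p. tc_eq W (\<delta>' (\<kappa> p)) (\<kappa> (\<delta> p))" "\<And>x. tc_proj W (\<kappa> (basis [x])) = k x"
    and \<chi>: "tc_coalg_hom V W \<chi>" "\<And>p. tc_eq W (\<delta>'' (\<chi> p)) (\<chi> (\<delta> p))" "\<And>x. tc_proj W (\<chi> (basis [x])) = c x"
    and bV: "graded_hom V V (-1) bV" and bW: "graded_hom W W (-1) bW"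
    and k: "graded_hom V W 0 k" "\<And>x. k (bV x) = bW (k x)"
    and l: "graded_hom W V 0 l" "\<And>x. l (bW x) = bV (l x)"
    and r: "graded_hom V V 1 r" "\<And>x. x - l (k x) = bV (r x) + r (bV x)"
    and q: "graded_hom W W 1 q" "\<And>x. x - k (l x) = bW (q x) + q (bW x)"
    and s: "graded_hom V W 1 s" "\<And>x. k x - c x = bW (s x) + s (bV x)"
begin

lemmas proj_lin = module_hom.add[OF module_hom_tc_proj[OF graded_module_module[OF W]]]
  module_hom.diff[OF module_hom_tc_proj[OF graded_module_module[OF W]]]
  module_hom.zero[OF module_hom_tc_proj[OF graded_module_module[OF W]]]

text \<open>The functionals \<open>t\<close> and \<open>h\<close> are the components of \<open>\<tau>\<close> and \<open>\<eta>\<close> in all arities; the equations are imposed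
  on words of length less than \<open>n\<close> only.\<close>

definition solves_upto where
  "solves_upto n t h \<tau> \<eta> \<longleftrightarrow>
     tc_fun W W 0 t \<and> tc_fun V W 1 h \<and> (\<forall>x. t (basis [x]) = x) \<and>
     tc_coalg_hom W W \<tau> \<and> (\<forall>p. tc_proj W (\<tau> p) = t p) \<and>
     gcoder V W 1 \<chi> (\<lambda>p. \<tau> (\<kappa> p)) \<eta> \<and> (\<forall>p. tc_proj W (\<eta> p) = h p) \<and>
     (\<forall>w. length w < n \<longrightarrow> tc_eq W (\<delta>'' (\<tau> (basis w))) (\<tau> (\<delta>' (basis w)))) \<and>
     (\<forall>w. length w < n \<longrightarrow>
        tc_eq W (\<tau> (\<kappa> (basis w)) - \<chi> (basis w)) (\<delta>'' (\<eta> (basis w)) + \<eta> (\<delta> (basis w))))"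

text \<open>The equations only have to be verified after projection to single letters.\<close>

lemma solves_uptoI:
  assumes th: "tc_fun W W 0 t" "tc_fun V W 1 h" "\<And>x. t (basis [x]) = x"
    and \<tau>: "tc_coalg_hom W W \<tau>" "\<And>p. tc_proj W (\<tau> p) = t p"
    and \<eta>: "gcoder V W 1 \<chi> (\<lambda>p. \<tau> (\<kappa> p)) \<eta>" "\<And>p. tc_proj W (\<eta> p) = h p"
    and D: "\<And>w. length w < n \<Longrightarrow> tc_proj W (\<delta>'' (\<tau> (basis w))) = tc_proj W (\<tau> (\<delta>' (basis w)))"
    and E: "\<And>w. length w < n \<Longrightarrow>
       tc_proj W (\<tau> (\<kappa> (basis w)) - \<chi> (basis w)) = tc_proj W (\<delta>'' (\<eta> (basis w)) + \<eta> (\<delta> (basis w)))"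
  shows "solves_upto n t h \<tau> \<eta>"
proof -
  have D': "tc_eq W (\<delta>'' (\<tau> (basis w))) (\<tau> (\<delta>' (basis w)))" if "length w < n" for w
    by (rule coalg_chain_map_upto[OF W W \<delta>'(1) \<delta>''(1) \<tau>(1) D that])
  have D'': "tc_eq W (\<delta>'' (\<tau> p)) (\<tau> (\<delta>' p))" if "p \<in> tc_fil W n" for p
  proof -
    note hm = tc_hom_compose[OF tc_coalg_hom_hom[OF \<tau>(1)] tc_coderivation_hom[OF \<delta>''(1)]]
       tc_hom_compose[OF tc_coderivation_hom[OF \<delta>'(1)] tc_coalg_hom_hom[OF \<tau>(1)]]
    have "\<delta>'' (\<tau> p) - \<tau> (\<delta>' p) \<in> tc_rel W"
      using that module_hom_minus[OF hm[THEN tc_hom_module_hom]] subspace_tc_rel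
      by (rule tc_fil_induct) (auto intro!: fm.subspace_diff tc_hom_rel[OF hm(1)] tc_hom_rel[OF hm(2)] D'[unfolded tc_eq_def])
    then show ?thesis by (simp add: tc_eq_def)
  qed
  have s: "tc_eq W (\<delta>'' (\<tau> (\<kappa> (basis w)))) (\<tau> (\<kappa> (\<delta> (basis w))))" if "length w < n" for w
    using tc_eq_trans[OF D''[OF fil_presD[OF coalg_hom_fil_pres[OF W \<kappa>(1)] word_fil[OF that]]]
        tc_hom_cong[OF tc_coalg_hom_hom[OF \<tau>(1)] \<kappa>(2)]] .
  have E': "tc_eq W (\<tau> (\<kappa> (basis w)) - \<chi> (basis w)) (\<delta>'' (\<eta> (basis w)) + \<eta> (\<delta> (basis w)))" if "length w < n" for w
    by (rule coalg_homotopy_upto[OF V W \<delta>(1) \<delta>''(1) \<chi>(1) tc_coalg_hom_compose[OF W \<kappa>(1) \<tau>(1)] \<eta>(1) \<chi>(2) s E that])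
  show ?thesis using assms(1-7) D' E' by (simp add: solves_upto_def)
qed

text \<open>In arity one the isotopy is the identity and the homotopy is the given chain homotopy between the linear
  parts.\<close>

lemma solves_initially: "\<exists>t h \<tau> \<eta>. solves_upto 2 t h \<tau> \<eta>"
proof -
  define h where "h p = s (tc_proj V p)" for p
  have t: "tc_fun W W 0 (tc_proj W)" by (rule tc_fun_proj[OF W])
  have h: "tc_fun V W 1 h" unfolding h_def[abs_def] by (rule tc_fun_graded_hom[OF tc_fun_proj[OF V] s(1)]) simp
  obtain \<tau> where \<tau>: "tc_coalg_hom W W \<tau>" "\<And>p. tc_proj W (\<tau> p) = tc_proj W p"
    using coalg_hom_exists[OF W W t] by auto
  obtain \<eta> where \<eta>: "gcoder V W 1 \<chi> (\<lambda>p. \<tau> (\<kappa> p)) \<eta>" "\<And>p. tc_proj W (\<eta> p) = h p"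
    using gcoder_exists[OF V W h \<chi>(1) tc_coalg_hom_compose[OF W \<kappa>(1) \<tau>(1)]] by auto
  have \<tau>x: "tc_eq W (\<tau> (basis [x])) (basis [x])" for x
    using gcoder_recursion[OF W \<tau>(1)[unfolded tc_coalg_hom_iff], of "[x]"] by (simp add: \<tau> graded_module_module[OF W])
  have \<eta>x: "tc_eq W (\<eta> (basis [x])) (basis [s x])" for x
    using gcoder_recursion[OF W \<eta>(1), of "[x]"] by (simp add: \<eta> h_def graded_module_module[OF V])
  note tc_hom = tc_coalg_hom_hom[OF \<tau>(1)] tc_coderivation_hom[OF \<delta>''(1)] tc_coderivation_hom[OF \<delta>'(1)]
     tc_coderivation_hom[OF \<delta>(1)] gcoder_hom[OF \<eta>(1)] tc_coalg_hom_hom[OF \<kappa>(1)] tc_coalg_hom_hom[OF \<chi>(1)]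
  have "solves_upto 2 (tc_proj W) h \<tau> \<eta>"
  proof (rule solves_uptoI[OF t h _ \<tau> \<eta>])
    show "tc_proj W (basis [x]) = x" for x by (simp add: graded_module_module[OF W])
    fix w :: "'c list" assume "length w < 2"
    then consider "w = []" | x where "w = [x]" by (cases w) auto
    then show "tc_proj W (\<delta>'' (\<tau> (basis w))) = tc_proj W (\<tau> (\<delta>' (basis w)))"
    proof cases
      case 1
      have "\<delta>'' (\<tau> (basis w)) \<in> tc_rel W" "\<tau> (\<delta>' (basis w)) \<in> tc_rel W"
        unfolding 1 by (intro tc_hom_rel[OF tc_hom(1)] tc_hom_rel[OF tc_hom(2)] tc_hom_rel[OF tc_hom(3)] rel_Nil)+
      then show ?thesis by (simp add: tc_fun_rel[OF t])
    next
      case 2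
      then show ?thesis
        using tc_proj_cong[OF W tc_hom_cong[OF tc_hom(2) \<tau>x[of x]]] by (simp add: \<tau> \<delta>'(3) \<delta>''(3))
    qed
  next
    fix w :: "'a list" assume "length w < 2"
    then consider "w = []" | x where "w = [x]" by (cases w) auto
    then show "tc_proj W (\<tau> (\<kappa> (basis w)) - \<chi> (basis w)) = tc_proj W (\<delta>'' (\<eta> (basis w)) + \<eta> (\<delta> (basis w)))"
    proof cases
      case 1
      have "\<tau> (\<kappa> (basis w)) \<in> tc_rel W" "\<chi> (basis w) \<in> tc_rel W"  "\<delta>'' (\<eta> (basis w)) \<in> tc_rel W" "\<eta> (\<delta> (basis w)) \<in> tc_rel W"
        unfolding 1 by (intro tc_hom_rel[OF tc_hom(1)] tc_hom_rel[OF tc_hom(2)] tc_hom_rel[OF tc_hom(4)]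
            tc_hom_rel[OF tc_hom(5)] tc_hom_rel[OF tc_hom(6)] tc_hom_rel[OF tc_hom(7)] rel_Nil)+
      then show ?thesis by (simp add: proj_lin tc_fun_rel[OF t])
    next
      case 2
      then show ?thesis
        using tc_proj_cong[OF W tc_hom_cong[OF tc_hom(2) \<eta>x[of x]]]
        by (simp add: proj_lin \<tau> \<eta> \<kappa>(3) \<chi>(3) \<delta>''(3) h_def \<delta>(3) s(2))
    qed
  qed
  then show ?thesis by blast
qed

text \<open>Changing the components in arity \<open>n\<close> and beyond changes the maps on words of length \<open>n\<close> by single letters.
  For \<open>\<eta>\<close> it matters that \<open>\<tau> \<kappa>\<close> changes only from length \<open>n\<close> on: for words of length \<open>n\<close> the recursion for \<open>\<eta>\<close>
  uses it on shorter words.\<close>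

lemma solution_change:
  assumes 1: "solves_upto n t h \<tau> \<eta>"
    and \<tau>': "tc_coalg_hom W W \<tau>'" "\<And>p. tc_proj W (\<tau>' p) = t' p"
    and \<eta>': "gcoder V W 1 \<chi> (\<lambda>p. \<tau>' (\<kappa> p)) \<eta>'" "\<And>p. tc_proj W (\<eta>' p) = h' p"
    and t': "tc_fun W W 0 t'" "\<And>p. p \<in> tc_fil W n \<Longrightarrow> t' p = t p"
    and h': "tc_fun V W 1 h'" "\<And>p. p \<in> tc_fil V n \<Longrightarrow> h' p = h p"
  shows "p \<in> tc_fil W (Suc n) \<Longrightarrow> tc_eq W (\<tau>' p) (\<tau> p + basis [t' p - t p])"
    and "p' \<in> tc_fil V (Suc n) \<Longrightarrow> tc_eq W (\<eta>' p') (\<eta> p' + basis [h' p' - h p'])"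
proof -
  note t = 1[unfolded solves_upto_def, THEN conjunct1]
  have h: "tc_fun V W 1 h" and \<tau>: "tc_coalg_hom W W \<tau>" "\<And>p. tc_proj W (\<tau> p) = t p"
    and \<eta>: "gcoder V W 1 \<chi> (\<lambda>p. \<tau> (\<kappa> p)) \<eta>" "\<And>p. tc_proj W (\<eta> p) = h p"
    using 1 by (auto simp: solves_upto_def)
  have move: "tc_eq W (a - b) x \<Longrightarrow> tc_eq W a (b + x)" "tc_eq W a (b + x) \<Longrightarrow> tc_eq W (a - b) x" for a b x
    by (auto simp: tc_eq_def algebra_simps)
  have t_diff: "tc_eq W (\<tau>' p) (\<tau> p + basis [t' p - t p])" if "p \<in> tc_fil W (Suc n)" for p
  proof (rule move(1), rule fil_single[OF tc_hom_diff[OF tc_coalg_hom_hom[OF \<tau>'(1)] tc_coalg_hom_hom[OF \<tau>(1)]] tc_fun_diff[OF W t'(1) t] _ that])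
    fix w :: "'c list" assume w: "length w < Suc n"
    have "tc_eq W (\<tau>' (basis w)) (\<tau> (basis w) + basis [tc_proj W (\<tau>' (basis w)) - tc_proj W (\<tau> (basis w))])"
      by (rule gcoder_variation[OF W \<tau>(1)[unfolded tc_coalg_hom_iff] \<tau>'(1)[unfolded tc_coalg_hom_iff], where n = n])
        (use w in \<open>auto simp: \<tau> \<tau>' t'(2) word_fil\<close>)
    then show "tc_eq W (\<tau>' (basis w) - \<tau> (basis w)) (basis [t' (basis w) - t (basis w)])"
      unfolding \<tau> \<tau>' by (rule move(2))
  qed
  then show "p \<in> tc_fil W (Suc n) \<Longrightarrow> tc_eq W (\<tau>' p) (\<tau> p + basis [t' p - t p])" .
  have h_diff: "tc_eq W (\<eta>' p) (\<eta> p + basis [h' p - h p])" if "p \<in> tc_fil V (Suc n)" for p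
  proof (rule move(1), rule fil_single[OF tc_hom_diff[OF gcoder_hom[OF \<eta>'(1)] gcoder_hom[OF \<eta>(1)]] tc_fun_diff[OF W h'(1) h] _ that])
    fix w :: "'a list" assume w: "length w < Suc n"
    have "tc_eq W (\<eta>' (basis w)) (\<eta> (basis w) + basis [tc_proj W (\<eta>' (basis w)) - tc_proj W (\<eta> (basis w))])"
    proof (rule gcoder_variation[OF W \<eta>(1) \<eta>'(1), where n = n])
      fix u :: "'a list" assume u: "length u < n"
      have \<kappa>u: "\<kappa> (basis u) \<in> tc_fil W n" by (rule fil_presD[OF coalg_hom_fil_pres[OF W \<kappa>(1)] word_fil[OF u]])
      then have "tc_eq W (\<tau>' (\<kappa> (basis u))) (\<tau> (\<kappa> (basis u)) + basis [0])"
        using t_diff[OF tc_fil_mono[OF \<kappa>u]] by (simp add: t'(2))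
      from tc_eq_trans[OF this tc_eq_add[OF tc_eq_refl single_zero]]
      show "tc_eq W (\<tau>' (\<kappa> (basis u))) (\<tau> (\<kappa> (basis u)))" by simp
    qed (use w in \<open>auto simp: \<eta> \<eta>' h'(2) word_fil\<close>)
    then show "tc_eq W (\<eta>' (basis w) - \<eta> (basis w)) (basis [h' (basis w) - h (basis w)])"
      unfolding \<eta> \<eta>' by (rule move(2))
  qed
  then show "p' \<in> tc_fil V (Suc n) \<Longrightarrow> tc_eq W (\<eta>' p') (\<eta> p' + basis [h' p' - h p'])" .
qed

lemma group_balance:
  fixes x :: "'z::ab_group_add"
  assumes "a - x - (y + b) + u - (y' + v) = 0"
  shows "a + u - x = (y + y') + (b + v)"
proof -
  have "(a + u - x) - ((y + y') + (b + v)) = a - x - (y + b) + u - (y' + v)" by (simp add: algebra_simps)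
  then show ?thesis using assms by simp
qed

text \<open>The obstruction step. On words of length \<open>n\<close> the defects \<open>D\<close> and \<open>E\<close> are single letters \<open>d\<close> and \<open>e\<close>. The
  identities \<open>\<delta>'' D + D \<delta>' = 0\<close> and \<open>\<delta>'' E - E \<delta> = D \<kappa>\<close> hold because the differentials square to zero and
  \<open>\<kappa>\<close> and \<open>\<chi>\<close> commute with them; read on words of length \<open>n\<close> modulo shorter ones they only involve the linear parts and say that \<open>(d, e)\<close> is a
  cycle in the mapping cone. A bounding pair \<open>(u, v)\<close> is what has to be added to the components.\<close>

lemma solution_extends:
  assumes "2 \<le> n" and sol: "solves_upto n t h \<tau> \<eta>"
  shows "\<exists>t' h' \<tau>' \<eta>'. solves_upto (Suc n) t' h' \<tau>' \<eta>' \<and>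
     (\<forall>p\<in>tc_fil W n. t' p = t p) \<and> (\<forall>p\<in>tc_fil V n. h' p = h p)"
proof -
  have t: "tc_fun W W 0 t" "\<And>x. t (basis [x]) = x"
    and h: "tc_fun V W 1 h" and \<tau>: "tc_coalg_hom W W \<tau>" "\<And>p. tc_proj W (\<tau> p) = t p"
    and \<eta>: "gcoder V W 1 \<chi> (\<lambda>p. \<tau> (\<kappa> p)) \<eta>" "\<And>p. tc_proj W (\<eta> p) = h p"
    and D0: "\<And>w. length w < n \<Longrightarrow> tc_eq W (\<delta>'' (\<tau> (basis w))) (\<tau> (\<delta>' (basis w)))"
    and E0: "\<And>w. length w < n \<Longrightarrow> tc_eq W (\<tau> (\<kappa> (basis w)) - \<chi> (basis w)) (\<delta>'' (\<eta> (basis w)) + \<eta> (\<delta> (basis w)))"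
    using sol by (auto simp: solves_upto_def)
  note \<tau>\<kappa> = tc_coalg_hom_compose[OF W \<kappa>(1) \<tau>(1)]
  note hom = tc_coalg_hom_hom[OF \<tau>(1)] tc_coderivation_hom[OF \<delta>''(1)] tc_coderivation_hom[OF \<delta>'(1)]
     tc_coderivation_hom[OF \<delta>(1)] gcoder_hom[OF \<eta>(1)] tc_coalg_hom_hom[OF \<kappa>(1)] tc_coalg_hom_hom[OF \<chi>(1)]
  note mh = hom[THEN tc_hom_module_hom]
  note mh_lin = mh[THEN module_hom.add] mh[THEN module_hom.diff]
  define D where "D p = \<delta>'' (\<tau> p) - \<tau> (\<delta>' p)" for p
  define E where "E p = \<tau> (\<kappa> p) - \<chi> p - (\<delta>'' (\<eta> p) + \<eta> (\<delta> p))" for p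
  define d where "d p = tc_proj W (D p)" for p
  define e where "e p = tc_proj W (E p)" for p
  have D: "tc_hom W W (-1) D"
    unfolding D_def[abs_def] using tc_hom_compose[OF hom(1,2)] tc_hom_compose[OF hom(3,1)]
    by (intro tc_hom_diff) simp_all
  have E: "tc_hom V W 0 E"
    unfolding E_def[abs_def]
    using tc_hom_compose[OF hom(6,1)] hom(7) tc_hom_compose[OF hom(5,2)] tc_hom_compose[OF hom(4,5)]
    by (intro tc_hom_diff tc_hom_plus) simp_all
  have d: "tc_fun W W (-1) d" unfolding d_def[abs_def] by (rule tc_fun_tc_hom[OF D tc_fun_proj[OF W]]) simp
  have e: "tc_fun V W 0 e" unfolding e_def[abs_def] by (rule tc_fun_tc_hom[OF E tc_fun_proj[OF W]]) simp

  have d0: "d p = 0" if "p \<in> tc_fil W n" for p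
    by (rule tc_fun_fil_zero[OF W d _ that])
      (use tc_proj_cong[OF W D0] in \<open>simp add: d_def D_def proj_lin\<close>)
  have e0: "e p = 0" if "p \<in> tc_fil V n" for p
    by (rule tc_fun_fil_zero[OF W e _ that])
      (use tc_proj_cong[OF W E0] in \<open>simp add: e_def E_def proj_lin\<close>)
  have Dd: "tc_eq W (D p) (basis [d p])" if "p \<in> tc_fil W (Suc n)" for p
  proof (rule fil_single[OF D d _ that])
    fix w :: "'c list" assume "length w < Suc n"
    then show "tc_eq W (D (basis w)) (basis [d (basis w)])"
      unfolding d_def by (intro primitive_eq_single[OF W], unfold D_def)
        (intro deconc_chain_defect[OF W W \<delta>'(1) \<delta>''(1) \<tau>(1)] D0, simp)
  qed
  have \<tau>\<kappa>_chain: "tc_eq W (\<delta>'' (\<tau> (\<kappa> (basis u)))) (\<tau> (\<kappa> (\<delta> (basis u))))" if "length u < n" for u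
  proof -
    have \<kappa>u: "\<kappa> (basis u) \<in> tc_fil W n" by (rule fil_presD[OF coalg_hom_fil_pres[OF W \<kappa>(1)] word_fil[OF that]])
    have "tc_eq W (D (\<kappa> (basis u))) 0"
      using tc_eq_trans[OF Dd[OF tc_fil_mono[OF \<kappa>u]]] single_zero[of W] by (simp add: d0[OF \<kappa>u])
    then have "tc_eq W (\<delta>'' (\<tau> (\<kappa> (basis u)))) (\<tau> (\<delta>' (\<kappa> (basis u))))" by (simp add: D_def tc_eq_def)
    from tc_eq_trans[OF this tc_hom_cong[OF hom(1) \<kappa>(2)]] show ?thesis .
  qed
  have Ee: "tc_eq W (E p) (basis [e p])" if "p \<in> tc_fil V (Suc n)" for p
  proof (rule fil_single[OF E e _ that])
    fix w :: "'a list" assume "length w < Suc n"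
    then show "tc_eq W (E (basis w)) (basis [e (basis w)])"
      unfolding e_def by (intro primitive_eq_single[OF W], unfold E_def)
        (rule deconc_homotopy_defect[OF V W \<delta>(1) \<delta>''(1) \<chi>(1) \<tau>\<kappa> \<eta>(1) \<chi>(2) \<tau>\<kappa>_chain tc_eq_sym[OF E0]], simp_all)
  qed

  \<comment> \<open>The tensor powers of the linear data; for words of length \<open>n\<close> they are the leading parts of \<open>\<delta>\<close>, \<open>\<delta>'\<close>
    and \<open>\<kappa>\<close>.\<close>
  obtain dV where dV: "tc_coderivation V dV" "\<And>p. tc_proj V (dV p) = bV (tc_proj V p)"
    using linear_coderivation[OF V bV] by metis
  obtain dW where dW: "tc_coderivation W dW" "\<And>p. tc_proj W (dW p) = bW (tc_proj W p)"
    using linear_coderivation[OF W bW] by metis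
  obtain K where K: "tc_coalg_hom V W K" "\<And>p. tc_proj W (K p) = k (tc_proj V p)"
    using linear_coalg_hom[OF V W k(1)] by metis
  obtain L where L: "tc_coalg_hom W V L" "\<And>p. tc_proj V (L p) = l (tc_proj W p)"
    using linear_coalg_hom[OF W V l(1)] by metis
  note Kd = linear_chain_map[OF V W dV dW K k(2)]
  note Ld = linear_chain_map[OF W V dW dV L l(2)]
  note LK = tc_coalg_hom_compose[OF W K(1) L(1)]
  note KL = tc_coalg_hom_compose[OF V L(1) K(1)]
  have LKd: "tc_eq V (dV (L (K p))) (L (K (dV p)))" for p
    using tc_eq_trans[OF Ld tc_hom_cong[OF tc_coalg_hom_hom[OF L(1)] Kd]] .
  have KLd: "tc_eq W (dW (K (L p))) (K (L (dW p)))" for p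
    using tc_eq_trans[OF Kd tc_hom_cong[OF tc_coalg_hom_hom[OF K(1)] Ld]] .
  have LKp: "tc_proj V (L (K p)) = l (k (tc_proj V p))" for p by (simp add: K(2) L(2))
  have KLp: "tc_proj W (K (L p)) = k (l (tc_proj W p))" for p by (simp add: K(2) L(2))
  obtain R where R: "tc_hom V V 1 R" "fil_pres V V R" "\<And>p. tc_eq V (p - L (K p)) (dV (R p) + R (dV p))"
    by (rule linear_homotopy[where k = "\<lambda>x. l (k x)", OF V dV LK LKp LKd r]) (rule that; assumption)
  obtain S where S: "tc_hom W W 1 S" "fil_pres W W S" "\<And>p. tc_eq W (p - K (L p)) (dW (S p) + S (dW p))"
    by (rule linear_homotopy[where k = "\<lambda>x. k (l x)", OF W dW KL KLp KLd q]) (rule that; assumption)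

  have leadV: "\<delta> p - dV p \<in> tc_fil V n" if "p \<in> tc_fil V (Suc n)" for p
  proof (rule leading_fil[OF hom(4) tc_coderivation_hom[OF dV(1)] _ that])
    show "\<delta> (basis w) - dV (basis w) \<in> tc_fil V (length w)" for w
      by (rule gcoder_leading[OF V \<delta>(1)[unfolded tc_coderivation_iff] dV(1)[unfolded tc_coderivation_iff]])
        (simp_all add: \<delta>(3) dV(2) graded_module_module[OF V] fil_pres_id fm.subspace_0)
  qed
  have leadW: "\<delta>' p - dW p \<in> tc_fil W n" if "p \<in> tc_fil W (Suc n)" for p
  proof (rule leading_fil[OF hom(3) tc_coderivation_hom[OF dW(1)] _ that])
    show "\<delta>' (basis w) - dW (basis w) \<in> tc_fil W (length w)" for w
      by (rule gcoder_leading[OF W \<delta>'(1)[unfolded tc_coderivation_iff] dW(1)[unfolded tc_coderivation_iff]])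
        (simp_all add: \<delta>'(3) dW(2) graded_module_module[OF W] fil_pres_id fm.subspace_0)
  qed
  have leadK: "\<kappa> p - K p \<in> tc_fil W n" if "p \<in> tc_fil V (Suc n)" for p
  proof (rule leading_fil[OF hom(6) tc_coalg_hom_hom[OF K(1)] _ that])
    show "\<kappa> (basis w) - K (basis w) \<in> tc_fil W (length w)" for w
      by (rule gcoder_leading[OF W \<kappa>(1)[unfolded tc_coalg_hom_iff] K(1)[unfolded tc_coalg_hom_iff]])
        (simp_all add: \<kappa>(3) K(2) graded_module_module[OF V] fil_pres_zero fm.subspace_0)
  qed
  have agree: "a p = a p'" if "p - p' \<in> tc_fil X n" "tc_fun X W m a" "\<And>p. p \<in> tc_fil X n \<Longrightarrow> a p = 0"
    for a p p' m and X :: "('r, 'x::ab_group_add, 'y) graded_mod_scheme"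
    using that(3)[OF that(1)] by (simp add: module_hom.diff[OF tc_fun_module_hom[OF that(2)]])

  \<comment> \<open>Applying the differentials to the defects and dropping shorter words gives the cycle conditions.\<close>
  have dc: "bW (d p) + d (dW p) = 0" if p: "p \<in> tc_fil W (Suc n)" for p
  proof -
    have "tc_eq W (\<delta>'' (\<delta>'' (\<tau> p)) - \<tau> (\<delta>' (\<delta>' p))) (0 - 0)"
    proof (rule tc_eq_diff[OF \<delta>''(2)])
      show "tc_eq W (\<tau> (\<delta>' (\<delta>' p))) 0"
        using tc_hom_cong[OF hom(1) \<delta>'(2)] by (simp add: module_hom.zero[OF mh(1)])
    qed
    moreover have "\<delta>'' (D p) + D (\<delta>' p) = \<delta>'' (\<delta>'' (\<tau> p)) - \<tau> (\<delta>' (\<delta>' p))"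
      by (simp add: D_def mh_lin)
    ultimately have "tc_eq W (\<delta>'' (D p) + D (\<delta>' p)) 0" by simp
    from tc_proj_cong[OF W this] have "tc_proj W (\<delta>'' (D p)) + d (\<delta>' p) = 0" by (simp add: proj_lin d_def)
    moreover have "tc_proj W (\<delta>'' (D p)) = bW (d p)"
      using tc_proj_cong[OF W tc_hom_cong[OF hom(2) Dd[OF p]]] by (simp add: \<delta>''(3))
    moreover have "d (\<delta>' p) = d (dW p)" by (rule agree[OF leadW[OF p] d d0])
    ultimately show ?thesis by simp
  qed
  have ec: "bW (e p) - e (dV p) = d (K p)" if p: "p \<in> tc_fil V (Suc n)" for p
  proof -
    have "\<delta>'' (E p) - E (\<delta> p) = D (\<kappa> p) + (\<tau> (\<delta>' (\<kappa> p)) - \<tau> (\<kappa> (\<delta> p))) - (\<delta>'' (\<chi> p) - \<chi> (\<delta> p))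
       - \<delta>'' (\<delta>'' (\<eta> p)) + \<eta> (\<delta> (\<delta> p))"
      by (simp add: D_def E_def mh_lin algebra_simps)
    also have "tc_eq W \<dots> (D (\<kappa> p) + 0 - 0 - 0 + 0)"
    proof (intro tc_eq_add tc_eq_diff tc_eq_refl)
      show "tc_eq W (\<tau> (\<delta>' (\<kappa> p)) - \<tau> (\<kappa> (\<delta> p))) 0"
        using tc_hom_cong[OF hom(1) \<kappa>(2)[of p]] by (simp add: tc_eq_def)
      show "tc_eq W (\<delta>'' (\<chi> p) - \<chi> (\<delta> p)) 0" using \<chi>(2)[of p] by (simp add: tc_eq_def)
      show "tc_eq W (\<delta>'' (\<delta>'' (\<eta> p))) 0" by (rule \<delta>''(2))
      show "tc_eq W (\<eta> (\<delta> (\<delta> p))) 0"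
        using tc_hom_cong[OF hom(5) \<delta>(2)] by (simp add: module_hom.zero[OF mh(5)])
    qed
    finally have "tc_eq W (\<delta>'' (E p) - E (\<delta> p)) (D (\<kappa> p))" by simp
    from tc_proj_cong[OF W this] have "tc_proj W (\<delta>'' (E p)) - e (\<delta> p) = d (\<kappa> p)"
      by (simp add: proj_lin d_def e_def)
    moreover have "tc_proj W (\<delta>'' (E p)) = bW (e p)"
      using tc_proj_cong[OF W tc_hom_cong[OF hom(2) Ee[OF p]]] by (simp add: \<delta>''(3))
    moreover have "e (\<delta> p) = e (dV p)" by (rule agree[OF leadV[OF p] e e0])
    moreover have "d (\<kappa> p) = d (K p)" by (rule agree[OF leadK[OF p] d d0])
    ultimately show ?thesis by simp
  qed

  obtain u v where u: "tc_fun W W 0 u" "\<And>p. p \<in> tc_fil W n \<Longrightarrow> u p = 0"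
    and v: "tc_fun V W 1 v" "\<And>p. p \<in> tc_fil V n \<Longrightarrow> v p = 0"
    and uD: "\<And>p. p \<in> tc_fil W (Suc n) \<Longrightarrow> d p + bW (u p) - u (dW p) = 0"
    and vE: "\<And>p. p \<in> tc_fil V (Suc n) \<Longrightarrow> e p + u (K p) - (bW (v p) + v (dV p)) = 0"
    by (rule cone_cycle_is_boundary[where n = n, OF V W bW tc_coderivation_hom[OF dV(1)] coder_fil_pres[OF V dV(1)]
        tc_coderivation_hom[OF dW(1)] coder_fil_pres[OF W dW(1)]
        tc_coalg_hom_hom[OF K(1)] coalg_hom_fil_pres[OF W K(1)]
        tc_coalg_hom_hom[OF L(1)] coalg_hom_fil_pres[OF V L(1)] Kd Ld R S d d0 e e0 dc ec]) (assumption+, (rule that; assumption))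

  define t' where "t' p = t p + u p" for p
  define h' where "h' p = h p + v p" for p
  have t': "tc_fun W W 0 t'" unfolding t'_def[abs_def] by (rule tc_fun_plus[OF W t(1) u(1)])
  have h': "tc_fun V W 1 h'" unfolding h'_def[abs_def] by (rule tc_fun_plus[OF W h v(1)])
  have t'_fil: "t' p = t p" if "p \<in> tc_fil W n" for p using u(2)[OF that] by (simp add: t'_def)
  have h'_fil: "h' p = h p" if "p \<in> tc_fil V n" for p using v(2)[OF that] by (simp add: h'_def)
  obtain \<tau>' where \<tau>': "tc_coalg_hom W W \<tau>'" "\<And>p. tc_proj W (\<tau>' p) = t' p"
    using coalg_hom_exists[OF W W t'] by auto
  obtain \<eta>' where \<eta>': "gcoder V W 1 \<chi> (\<lambda>p. \<tau>' (\<kappa> p)) \<eta>'" "\<And>p. tc_proj W (\<eta>' p) = h' p"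
    using gcoder_exists[OF V W h' \<chi>(1) tc_coalg_hom_compose[OF W \<kappa>(1) \<tau>'(1)]] by auto
  have \<tau>'_eq: "tc_eq W (\<tau>' p) (\<tau> p + basis [u p])" if "p \<in> tc_fil W (Suc n)" for p
  proof -
    have "tc_eq W (\<tau>' p) (\<tau> p + basis [t' p - t p])"
      by (rule solution_change(1)[OF sol \<tau>' \<eta>' t' t'_fil h' h'_fil]; (assumption | rule that))
    then show ?thesis by (simp add: t'_def)
  qed
  have \<eta>'_eq: "tc_eq W (\<eta>' p) (\<eta> p + basis [v p])" if "p \<in> tc_fil V (Suc n)" for p
  proof -
    have "tc_eq W (\<eta>' p) (\<eta> p + basis [h' p - h p])"
      by (rule solution_change(2)[OF sol \<tau>' \<eta>' t' t'_fil h' h'_fil]; (assumption | rule that))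
    then show ?thesis by (simp add: h'_def)
  qed
  have \<delta>''\<tau>': "tc_proj W (\<delta>'' (\<tau>' p)) = tc_proj W (\<delta>'' (\<tau> p)) + bW (u p)" if "p \<in> tc_fil W (Suc n)" for p
    using tc_proj_cong[OF W tc_hom_cong[OF hom(2) \<tau>'_eq[OF that]]] by (simp add: mh_lin proj_lin \<delta>''(3))
  have \<delta>''\<eta>': "tc_proj W (\<delta>'' (\<eta>' p)) = tc_proj W (\<delta>'' (\<eta> p)) + bW (v p)" if "p \<in> tc_fil V (Suc n)" for p
    using tc_proj_cong[OF W tc_hom_cong[OF hom(2) \<eta>'_eq[OF that]]] by (simp add: mh_lin proj_lin \<delta>''(3))
  have "solves_upto (Suc n) t' h' \<tau>' \<eta>'"
  proof (rule solves_uptoI[OF t' h' _ \<tau>' \<eta>'])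
    show "t' (basis [x]) = x" for x
      using t'_fil[OF word_fil, of "[x]"] \<open>2 \<le> n\<close> by (simp add: t(2))
    fix w :: "'c list" assume w: "length w < Suc n"
    note p = word_fil[OF w, of W]
    have "tc_proj W (\<tau>' (\<delta>' (basis w))) = tc_proj W (\<tau> (\<delta>' (basis w))) + u (dW (basis w))"
      using agree[OF leadW[OF p] u(1) u(2)] by (simp add: \<tau> \<tau>' t'_def)
    moreover have "tc_proj W (\<delta>'' (\<tau> (basis w))) - tc_proj W (\<tau> (\<delta>' (basis w))) = d (basis w)"
      by (simp add: d_def D_def proj_lin)
    ultimately show "tc_proj W (\<delta>'' (\<tau>' (basis w))) = tc_proj W (\<tau>' (\<delta>' (basis w)))"
      using uD[OF p] \<delta>''\<tau>'[OF p] by (simp add: algebra_simps)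
  next
    fix w :: "'a list" assume w: "length w < Suc n"
    note p = word_fil[OF w, of V]
    have "tc_proj W (\<tau>' (\<kappa> (basis w))) = tc_proj W (\<tau> (\<kappa> (basis w))) + u (K (basis w))"
      using agree[OF leadK[OF p] u(1) u(2)] by (simp add: \<tau> \<tau>' t'_def)
    moreover have "tc_proj W (\<eta>' (\<delta> (basis w))) = tc_proj W (\<eta> (\<delta> (basis w))) + v (dV (basis w))"
      using agree[OF leadV[OF p] v(1) v(2)] by (simp add: \<eta> \<eta>' h'_def)
    moreover have e_w: "e (basis w) = tc_proj W (\<tau> (\<kappa> (basis w))) - tc_proj W (\<chi> (basis w))
       - (tc_proj W (\<delta>'' (\<eta> (basis w))) + tc_proj W (\<eta> (\<delta> (basis w))))"
      by (simp add: e_def E_def proj_lin)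
    ultimately show "tc_proj W (\<tau>' (\<kappa> (basis w)) - \<chi> (basis w)) = tc_proj W (\<delta>'' (\<eta>' (basis w)) + \<eta>' (\<delta> (basis w)))"
      using group_balance[OF vE[OF p, unfolded e_w]] \<delta>''\<eta>'[OF p] by (simp add: proj_lin)
  qed
  then show ?thesis using t'_fil h'_fil by blast
qed

lemma solves_upto_mono: "solves_upto n t h \<tau> \<eta> \<Longrightarrow> m \<le> n \<Longrightarrow> solves_upto m t h \<tau> \<eta>"
  by (auto simp: solves_upto_def)

text \<open>Since the step for length \<open>n\<close> leaves the components on shorter words alone, the successive solutions
  stabilize on every word, and their limit solves the equations.\<close>

theorem solution_exists:
  "\<exists>\<tau> \<eta>. tc_coalg_hom W W \<tau> \<and> (\<forall>x. tc_proj W (\<tau> (basis [x])) = x) \<and>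
     (\<forall>p. tc_eq W (\<delta>'' (\<tau> p)) (\<tau> (\<delta>' p))) \<and> gcoder V W 1 \<chi> (\<lambda>p. \<tau> (\<kappa> p)) \<eta> \<and>
     (\<forall>p. tc_eq W (\<tau> (\<kappa> p) - \<chi> p) (\<delta>'' (\<eta> p) + \<eta> (\<delta> p)))"
proof -
  let ?P = "\<lambda>n x. \<exists>\<tau> \<eta>. solves_upto (n + 2) (fst x) (snd x) \<tau> \<eta>"
  let ?Q = "\<lambda>n x y. (\<forall>p\<in>tc_fil W (n + 2). fst y p = fst x p) \<and> (\<forall>p\<in>tc_fil V (n + 2). snd y p = snd x p)"
  \<comment> \<open>Index \<open>n\<close> carries a solution on words of length at most \<open>n + 1\<close>, so that it may start at \<open>0\<close>.\<close>
  have "\<exists>f. \<forall>n. ?P n (f n) \<and> ?Q n (f n) (f (Suc n))"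
  proof (rule dependent_nat_choice)
    show "\<exists>x. ?P 0 x" using solves_initially by (auto simp: numeral_2_eq_2)
    fix x n assume "?P n x"
    then obtain \<tau> \<eta> where "solves_upto (n + 2) (fst x) (snd x) \<tau> \<eta>" by blast
    from solution_extends[OF _ this] obtain t' h' \<tau>' \<eta>' where "solves_upto (Suc (n + 2)) t' h' \<tau>' \<eta>'"
      "\<forall>p\<in>tc_fil W (n + 2). t' p = fst x p" "\<forall>p\<in>tc_fil V (n + 2). h' p = snd x p" by auto
    then show "\<exists>y. ?P (Suc n) y \<and> ?Q n x y"
      by (intro exI[of _ "(t', h')"] conjI exI[of _ \<tau>'] exI[of _ \<eta>']) simp_all
  qed
  then obtain f where P: "\<And>n. ?P n (f n)" and Q: "\<And>n. ?Q n (f n) (f (Suc n))" by blast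
  define t where "t n = fst (f n)" for n
  define h where "h n = snd (f n)" for n
  have tc_fun_th: "tc_fun W W 0 (t n)" "tc_fun V W 1 (h n)" for n
    using P[of n] by (auto simp: solves_upto_def t_def h_def)
  have tx: "t n (basis [x]) = x" for n x using P[of n] by (auto simp: solves_upto_def t_def)
  have stable: "(\<forall>p\<in>tc_fil W (m + 2). t n p = t m p) \<and> (\<forall>p\<in>tc_fil V (m + 2). h n p = h m p)" if "m \<le> n" for m n
    using that
  proof (induction n rule: dec_induct)
    case (step n)
    have "p \<in> tc_fil W (n + 2)" if "p \<in> tc_fil W (m + 2)" for p by (rule tc_fil_mono[OF that]) (use step in simp)
    moreover have "p \<in> tc_fil V (n + 2)" if "p \<in> tc_fil V (m + 2)" for p by (rule tc_fil_mono[OF that]) (use step in simp)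
    ultimately show ?case using step.IH Q[of n] by (auto simp: t_def h_def)
  qed simp
  define T where "T = glue (gscale W) t"
  define H where "H = glue (gscale W) h"
  have T: "tc_fun W W 0 T" and H: "tc_fun V W 1 H"
    unfolding T_def H_def by (intro tc_fun_glue W tc_fun_th)+
  note mW = graded_module_module[OF W]
  have T_eq: "T p = t n p" if p: "p \<in> tc_fil W (Suc n)" for p n
  proof -
    have "T p - t n p = 0"
    proof (rule tc_fun_fil_zero[OF W tc_fun_diff[OF W T tc_fun_th(1)] _ p])
      fix w :: "'c list" assume "length w < Suc n"
      then have "t n (basis w) = t (length w) (basis w)"
        using stable[of "length w" n] word_fil[of w "length w + 2" W] by auto
      then show "T (basis w) - t n (basis w) = 0" by (simp add: T_def mW)
    qed
    then show ?thesis by simp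
  qed
  have H_eq: "H p = h n p" if p: "p \<in> tc_fil V (Suc n)" for p n
  proof -
    have "H p - h n p = 0"
    proof (rule tc_fun_fil_zero[OF W tc_fun_diff[OF W H tc_fun_th(2)] _ p])
      fix w :: "'a list" assume "length w < Suc n"
      then have "h n (basis w) = h (length w) (basis w)"
        using stable[of "length w" n] word_fil[of w "length w + 2" V] by auto
      then show "H (basis w) - h n (basis w) = 0" by (simp add: H_def mW)
    qed
    then show ?thesis by simp
  qed
  obtain \<tau> where \<tau>: "tc_coalg_hom W W \<tau>" "\<And>p. tc_proj W (\<tau> p) = T p"
    using coalg_hom_exists[OF W W T] by auto
  obtain \<eta> where \<eta>: "gcoder V W 1 \<chi> (\<lambda>p. \<tau> (\<kappa> p)) \<eta>" "\<And>p. tc_proj W (\<eta> p) = H p"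
    using gcoder_exists[OF V W H \<chi>(1) tc_coalg_hom_compose[OF W \<kappa>(1) \<tau>(1)]] by auto
  note hom = tc_coalg_hom_hom[OF \<tau>(1)] tc_coderivation_hom[OF \<delta>''(1)] tc_coderivation_hom[OF \<delta>'(1)]
     tc_coderivation_hom[OF \<delta>(1)] gcoder_hom[OF \<eta>(1)] tc_coalg_hom_hom[OF \<kappa>(1)] tc_coalg_hom_hom[OF \<chi>(1)]
  note mh = hom[THEN tc_hom_module_hom]
  have approx: "\<exists>\<tau>\<^sub>n \<eta>\<^sub>n. solves_upto (Suc n) (t n) (h n) \<tau>\<^sub>n \<eta>\<^sub>n \<and>
     (\<forall>p\<in>tc_fil W (Suc n). tc_eq W (\<tau> p) (\<tau>\<^sub>n p)) \<and> (\<forall>p\<in>tc_fil V (Suc n). tc_eq W (\<eta> p) (\<eta>\<^sub>n p))" for n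
  proof -
    obtain \<tau>\<^sub>n \<eta>\<^sub>n where "solves_upto (n + 2) (t n) (h n) \<tau>\<^sub>n \<eta>\<^sub>n" using P[of n] by (auto simp: t_def h_def)
    then have sol: "solves_upto (Suc n) (t n) (h n) \<tau>\<^sub>n \<eta>\<^sub>n" by (rule solves_upto_mono) simp
    have "tc_eq W (\<tau> p) (\<tau>\<^sub>n p)" if "p \<in> tc_fil W (Suc n)" for p
    proof -
      have p: "p \<in> tc_fil W (Suc (Suc n))" by (rule tc_fil_mono[OF that]) simp
      have "tc_eq W (\<tau> p) (\<tau>\<^sub>n p + basis [T p - t n p])"
        by (rule solution_change(1)[OF sol \<tau> \<eta> T T_eq H H_eq]; (assumption | rule p))
      then show ?thesis
        using tc_eq_trans[OF _ tc_eq_add[OF tc_eq_refl single_zero[of W]]] by (fastforce simp: T_eq[OF that])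
    qed
    moreover have "tc_eq W (\<eta> p) (\<eta>\<^sub>n p)" if "p \<in> tc_fil V (Suc n)" for p
    proof -
      have p: "p \<in> tc_fil V (Suc (Suc n))" by (rule tc_fil_mono[OF that]) simp
      have "tc_eq W (\<eta> p) (\<eta>\<^sub>n p + basis [H p - h n p])"
        by (rule solution_change(2)[OF sol \<tau> \<eta> T T_eq H H_eq]; (assumption | rule p))
      then show ?thesis
        using tc_eq_trans[OF _ tc_eq_add[OF tc_eq_refl single_zero[of W]]] by (fastforce simp: H_eq[OF that])
    qed
    ultimately show ?thesis using sol by blast
  qed
  have "tc_eq W (\<delta>'' (\<tau> p)) (\<tau> (\<delta>' p))" for p
  proof (rule tc_eq_wordsI[where f = "\<lambda>p. \<delta>'' (\<tau> p)" and g = "\<lambda>p. \<tau> (\<delta>' p)"])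
    show "flinear (\<lambda>p. \<delta>'' (\<tau> p))" "flinear (\<lambda>p. \<tau> (\<delta>' p))"
      by (rule module_hom_comp[OF mh(1,2)], rule module_hom_comp[OF mh(3,1)])
    fix w :: "'c list"
    obtain \<tau>\<^sub>n \<eta>\<^sub>n where sol: "solves_upto (Suc (length w)) (t (length w)) (h (length w)) \<tau>\<^sub>n \<eta>\<^sub>n"
      and ap: "\<And>p. p \<in> tc_fil W (Suc (length w)) \<Longrightarrow> tc_eq W (\<tau> p) (\<tau>\<^sub>n p)"
      using approx[of "length w"] by blast
    have p: "basis w \<in> tc_fil W (Suc (length w))" by (rule word_fil) simp
    have "tc_eq W (\<delta>'' (\<tau> (basis w))) (\<delta>'' (\<tau>\<^sub>n (basis w)))" by (rule tc_hom_cong[OF hom(2) ap[OF p]])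
    also have "tc_eq W \<dots> (\<tau>\<^sub>n (\<delta>' (basis w)))" using sol by (simp add: solves_upto_def)
    also have "tc_eq W \<dots> (\<tau> (\<delta>' (basis w)))"
      by (rule tc_eq_sym[OF ap[OF fil_presD[OF coder_fil_pres[OF W \<delta>'(1)] p]]])
    finally show "tc_eq W (\<delta>'' (\<tau> (basis w))) (\<tau> (\<delta>' (basis w)))" .
  qed
  moreover have "tc_eq W (\<tau> (\<kappa> p) - \<chi> p) (\<delta>'' (\<eta> p) + \<eta> (\<delta> p))" for p
  proof (rule tc_eq_wordsI[where f = "\<lambda>p. \<tau> (\<kappa> p) - \<chi> p" and g = "\<lambda>p. \<delta>'' (\<eta> p) + \<eta> (\<delta> p)"])
    show "flinear (\<lambda>p. \<tau> (\<kappa> p) - \<chi> p)"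
      by (rule module_hom_minus[OF module_hom_comp[OF mh(6,1)] mh(7)])
    show "flinear (\<lambda>p. \<delta>'' (\<eta> p) + \<eta> (\<delta> p))"
      by (rule module_hom_plus[OF module_hom_comp[OF mh(5,2)] module_hom_comp[OF mh(4,5)]])
    fix w :: "'a list"
    obtain \<tau>\<^sub>n \<eta>\<^sub>n where sol: "solves_upto (Suc (length w)) (t (length w)) (h (length w)) \<tau>\<^sub>n \<eta>\<^sub>n"
      and ap: "\<And>p. p \<in> tc_fil W (Suc (length w)) \<Longrightarrow> tc_eq W (\<tau> p) (\<tau>\<^sub>n p)"
        "\<And>p. p \<in> tc_fil V (Suc (length w)) \<Longrightarrow> tc_eq W (\<eta> p) (\<eta>\<^sub>n p)"
      using approx[of "length w"] by blast
    have p: "basis w \<in> tc_fil V (Suc (length w))" by (rule word_fil) simp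
    have "tc_eq W (\<tau> (\<kappa> (basis w)) - \<chi> (basis w)) (\<tau>\<^sub>n (\<kappa> (basis w)) - \<chi> (basis w))"
      by (rule tc_eq_diff[OF ap(1)[OF fil_presD[OF coalg_hom_fil_pres[OF W \<kappa>(1)] p]] tc_eq_refl])
    also have "tc_eq W \<dots> (\<delta>'' (\<eta>\<^sub>n (basis w)) + \<eta>\<^sub>n (\<delta> (basis w)))" using sol by (simp add: solves_upto_def)
    also have "tc_eq W \<dots> (\<delta>'' (\<eta> (basis w)) + \<eta> (\<delta> (basis w)))"
      by (rule tc_eq_sym[OF tc_eq_add[OF tc_hom_cong[OF hom(2) ap(2)[OF p]]
            ap(2)[OF fil_presD[OF coder_fil_pres[OF V \<delta>(1)] p]]]])
    finally show "tc_eq W (\<tau> (\<kappa> (basis w)) - \<chi> (basis w)) (\<delta>'' (\<eta> (basis w)) + \<eta> (\<delta> (basis w)))" .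
  qed
  moreover have "tc_proj W (\<tau> (basis [x])) = x" for x
    using T_eq[OF word_fil, of "[x]" 1] tx by (simp add: \<tau>)
  ultimately show ?thesis using \<tau>(1) \<eta>(1) by blast
qed

end

section \<open>Suspension\<close>

lemma gscale_susp [simp]: "gscale (susp A) = gscale A"
  by (simp add: susp_def)

lemma gcomp_susp [simp]: "gcomp (susp A) n = gcomp A (n - 1)"
  by (simp add: susp_def)

lemma graded_hom_susp:
  assumes "graded_hom A B d f" shows "graded_hom (susp A) (susp B) d f"
  unfolding graded_hom_def gscale_susp gcomp_susp
proof (intro conjI allI ballI)
  show "module_hom (gscale A) (gscale B) f" using assms by (simp add: graded_hom_def)
  fix n x assume "x \<in> gcomp A (n - 1)"
  then have "f x \<in> gcomp B ((n - 1) + d)" using assms by (simp add: graded_hom_def)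
  then show "f x \<in> gcomp B (n + d - 1)" by (simp add: algebra_simps)
qed

lemma is_decomp_shift:
  assumes "\<And>n. gcomp V (n + m) = gcomp W n"
  shows "is_decomp V x c \<Longrightarrow> is_decomp W x (Poly_Mapping.map_key (\<lambda>n. n + m) c)"
proof -
  have inj: "inj (\<lambda>n::int. n + m)" by (simp add: inj_def)
  have k: "Poly_Mapping.keys (Poly_Mapping.map_key (\<lambda>n. n + m) c) = (\<lambda>n. n - m) ` Poly_Mapping.keys c"
    by (force simp: keys_map_key[OF inj] image_iff)
  have l: "Poly_Mapping.lookup (Poly_Mapping.map_key (\<lambda>n. n + m) c) n = Poly_Mapping.lookup c (n + m)" for n
    by (simp add: map_key.rep_eq[OF inj])
  have "(\<Sum>n\<in>Poly_Mapping.keys (Poly_Mapping.map_key (\<lambda>n. n + m) c). Poly_Mapping.lookup c (n + m))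
     = (\<Sum>n\<in>Poly_Mapping.keys c. Poly_Mapping.lookup c n)"
    unfolding k by (subst sum.reindex) (auto simp: inj_on_def)
  then show "is_decomp V x c \<Longrightarrow> is_decomp W x (Poly_Mapping.map_key (\<lambda>n. n + m) c)"
    using assms by (auto simp: is_decomp_def l)
qed

lemma graded_module_susp:
  assumes A: "graded_module A" shows "graded_module (susp A)"
  unfolding graded_module_def
proof (intro conjI allI)
  show "module (gscale (susp A))" "module.subspace (gscale (susp A)) (gcomp (susp A) n)" for n
    using A by (auto simp: graded_module_subspace)
  fix x
  have inj: "inj (\<lambda>n::int. n + m)" for m by (simp add: inj_def)
  obtain c where "is_decomp A x c" by (rule graded_module_decomp[OF A])
  then have ex: "is_decomp (susp A) x (Poly_Mapping.map_key (\<lambda>n. n + (- 1)) c)"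
    by (rule is_decomp_shift[rotated]) simp
  show "\<exists>!c. is_decomp (susp A) x c"
  proof (rule ex1I, rule ex)
    fix c' assume c': "is_decomp (susp A) x c'"
    have "is_decomp A x (Poly_Mapping.map_key (\<lambda>n. n + 1) c')"
      "is_decomp A x (Poly_Mapping.map_key (\<lambda>n. n + 1) (Poly_Mapping.map_key (\<lambda>n. n + (- 1)) c))"
      by (rule is_decomp_shift[OF _ c'] is_decomp_shift[OF _ ex]; simp)+
    then have "Poly_Mapping.map_key (\<lambda>n. n + 1) c' = Poly_Mapping.map_key (\<lambda>n. n + 1) (Poly_Mapping.map_key (\<lambda>n. n + (- 1)) c)"
      using A unfolding graded_module_def by blast
    then have "Poly_Mapping.lookup c' (n + 1) = Poly_Mapping.lookup (Poly_Mapping.map_key (\<lambda>n. n + (- 1)) c) (n + 1)" for n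
      by (metis map_key.rep_eq[OF inj] comp_apply)
    from this[of "_ - 1"] show "c' = Poly_Mapping.map_key (\<lambda>n. n + (- 1)) c"
      by (intro poly_mapping_eqI) simp
  qed
qed

lemma module_hom_funpow: "module_hom s s f \<Longrightarrow> module_hom s s (f ^^ n)"
  by (induction n) (auto simp: module_hom_imp_module intro: module_hom_compose module.module_hom_id
    simp del: funpow.simps(2) simp: funpow.simps(2))

lemma gsign_funpow_funpow:
  assumes "graded_module V" shows "(gsign V ^^ n) ((gsign V ^^ n) x) = x"
proof (induction n arbitrary: x)
  case (Suc n)
  then show ?case using assms by (simp add: funpow_swap1[of _ n "_ x", symmetric] funpow_swap1)
qed simp

lemma gsign_funpow_gcomp: "graded_module V \<Longrightarrow> x \<in> gcomp V n \<Longrightarrow> (gsign V ^^ k) x \<in> gcomp V n"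
  by (induction k) (auto intro: gsign_gcomp)

lemma length_desusp_word [simp]: "length (desusp_word V w) = length w"
  by (induction w) auto

lemma desusp_word_desusp_word [simp]:
  "graded_module V \<Longrightarrow> desusp_word V (desusp_word V w) = w"
  by (induction w) (auto simp: gsign_funpow_funpow)

lemma desusp_word_homogeneous:
  "graded_module V \<Longrightarrow> list_all2 (\<lambda>x d. x \<in> gcomp V d) w ds \<Longrightarrow>
    list_all2 (\<lambda>x d. x \<in> gcomp V d) (desusp_word V w) ds"
  by (induction w arbitrary: ds) (auto simp: list_all2_Cons1 gsign_funpow_gcomp)

lemma desusp_word_letter: "\<exists>u' v'. \<forall>x. desusp_word V (u @ [x] @ v) = u' @ [(gsign V ^^ length v) x] @ v'"
proof (induction u)
  case (Cons y u)
  then obtain u' v' where "\<forall>x. desusp_word V (u @ [x] @ v) = u' @ [(gsign V ^^ length v) x] @ v'" by blast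
  then show ?case
    by (intro exI[of _ "(gsign V ^^ (length u + Suc (length v))) y # u'"] exI[of _ v']) simp
qed auto

text \<open>The signs of the desuspension of a word depend only on the position and the degree of each letter, so
  desuspension preserves multilinearity. The suspension raises the degree of a word of length \<open>k\<close> by \<open>k\<close> and
  that of the value by one, whence the degree \<open>k - 1 + d\<close>.\<close>

lemma tc_fun_multilinear:
  fixes A :: "('r::comm_ring_1, 'a::ab_group_add, 'm) graded_mod_scheme"
    and B :: "('r, 'b::ab_group_add, 'n) graded_mod_scheme"
  assumes A: "graded_module A" and B: "graded_module B" and t: "tc_fun (susp A) (susp B) d t"
  shows "multilinear A B k (int k - 1 + d) (\<lambda>w. t (basis (desusp_word (susp A) w)))"
  unfolding multilinear_def
proof (intro conjI allI impI)
  note sA = graded_module_susp[OF A]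
  fix u v :: "'a list"
  obtain u' v' where d: "\<And>x. desusp_word (susp A) (u @ [x] @ v) = u' @ [(gsign (susp A) ^^ length v) x] @ v'"
    using desusp_word_letter[of "susp A" u v] by blast
  have g: "module_hom (gscale A) (gscale A) (gsign (susp A) ^^ length v)"
    using module_hom_funpow[OF module_hom_gsign[OF sA]] by simp
  have th: "module_hom fscale (gscale B) t" using tc_fun_module_hom[OF t] by simp
  have "module_hom (gscale A) (gscale B) (\<lambda>x. t (basis (u' @ [x] @ v')))"
  proof (intro module_hom.intro module_hom_axioms.intro)
    fix x y r
    show "t (basis (u' @ [x + y] @ v')) = t (basis (u' @ [x] @ v')) + t (basis (u' @ [y] @ v'))"
      using tc_fun_cong[OF t tc_eq_word_add] by (simp only: module_hom.add[OF th])
    show "t (basis (u' @ [gscale A r x] @ v')) = gscale B r (t (basis (u' @ [x] @ v')))"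
      using tc_fun_cong[OF t tc_eq_word_scale] by (simp only: module_hom.scale[OF th] gscale_susp)
  qed (use A B in auto)
  from module_hom_comp[OF g this]
  show "module_hom (gscale A) (gscale B) (\<lambda>x. t (basis (desusp_word (susp A) (u @ [x] @ v))))"
    by (simp only: d)
next
  fix w ds assume w: "length w = k \<and> list_all2 (\<lambda>x n. x \<in> gcomp A n) w ds"
  then have "list_all2 (\<lambda>x n. x \<in> gcomp (susp A) n) w (map (\<lambda>d. d + 1) ds)"
    by (simp add: list_all2_map2)
  note w' = word_tc_comp[OF desusp_word_homogeneous[OF graded_module_susp[OF A] this]]
  have "length ds = k" using w by (auto dest: list_all2_lengthD)
  then have "sum_list (map (\<lambda>d. d + 1) ds) = sum_list ds + int k"
    by (simp add: sum_list_addf sum_list_triv)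
  with tc_fun_mem[OF t w'] show "t (basis (desusp_word (susp A) w)) \<in> gcomp B (sum_list ds + (int k - 1 + d))"
    by (simp add: algebra_simps)
qed

section \<open>A-infinity algebras and morphisms\<close>

lemma chain_complexD:
  assumes "chain_complex A"
  shows "graded_module A" "graded_hom A A (-1) (bd A)" "bd A (bd A x) = 0"
  using assms by (auto simp: chain_complex_def)

lemma ainf_algebra_complex: "ainf_algebra A \<mu> \<Longrightarrow> chain_complex A"
  by (simp add: ainf_algebra_def)

text \<open>With equal components the correction term of \<open>gcoder_variation\<close> is zero on every word.\<close>

lemma gcoder_unique:
  assumes W: "graded_module W" and g: "gcoder V W d \<phi> \<psi> \<eta>" "gcoder V W d \<phi>' \<psi>' \<eta>'"
    and c: "\<And>w. w \<noteq> [] \<Longrightarrow> tc_proj W (\<phi>' (basis w)) = tc_proj W (\<phi> (basis w))" "\<And>w. tc_eq W (\<psi>' (basis w)) (\<psi> (basis w))"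
      "\<And>w. w \<noteq> [] \<Longrightarrow> tc_proj W (\<eta>' (basis w)) = tc_proj W (\<eta> (basis w))"
  shows "tc_eq W (\<eta>' p) (\<eta> p)"
proof (rule tc_eq_wordsI[OF gcoder_hom[OF g(2), THEN tc_hom_module_hom] gcoder_hom[OF g(1), THEN tc_hom_module_hom]])
  have nil: "tc_proj W (f (basis [])) = 0" if "tc_hom V W m f" for f m
    using tc_fun_rel[OF tc_fun_proj[OF W] tc_hom_rel[OF that rel_Nil]] .
  have c': "tc_proj W (\<phi>' (basis w)) = tc_proj W (\<phi> (basis w))" "tc_proj W (\<eta>' (basis w)) = tc_proj W (\<eta> (basis w))" for w
    using c(1,3)[of w] nil[OF gcoder_hom[OF g(1)]] nil[OF gcoder_hom[OF g(2)]]
      nil[OF gcoder_hom_left[OF g(1)]] nil[OF gcoder_hom_left[OF g(2)]] by (cases "w = []"; simp)+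
  show "tc_eq W (\<eta>' (basis w)) (\<eta> (basis w))" for w
  proof -
    have "tc_eq W (\<eta>' (basis w)) (\<eta> (basis w) + basis [0])"
      using gcoder_variation[OF W g c'(1) c(2) c'(2) order_refl, of w] by (simp add: c')
    from tc_eq_trans[OF this tc_eq_add[OF tc_eq_refl single_zero]] show ?thesis by simp
  qed
qed

lemma ainf_coalg_hom_unique:
  assumes B: "graded_module B" and "ainf_coalg_hom A B F \<phi>" "ainf_coalg_hom A B F \<phi>'"
  shows "tc_eq (susp B) (\<phi>' p) (\<phi> p)"
  by (rule gcoder_unique[where d = 0 and \<phi> = \<phi> and \<phi>' = \<phi>' and \<psi> = "\<lambda>_. 0" and \<psi>' = "\<lambda>_. 0" and \<eta> = \<phi> and \<eta>' = \<phi>', OF graded_module_susp[OF B]])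
    (use assms in \<open>auto simp: ainf_coalg_hom_def tc_coalg_hom_iff has_components_def\<close>)

lemma ainf_coder_unique:
  assumes A: "graded_module A" and "ainf_coder A \<mu> \<delta>" "ainf_coder A \<mu> \<delta>'"
  shows "tc_eq (susp A) (\<delta>' p) (\<delta> p)"
  by (rule gcoder_unique[where d = "- 1" and \<phi> = id and \<phi>' = id and \<psi> = id and \<psi>' = id and \<eta> = \<delta> and \<eta>' = \<delta>', OF graded_module_susp[OF A]])
    (use assms in \<open>auto simp: ainf_coder_def tc_coderivation_iff has_components_def\<close>)

lemma ainf_coder_square_zero:
  assumes A: "ainf_algebra A \<mu>" and \<delta>: "ainf_coder A \<mu> \<delta>"
  shows "tc_eq (susp A) (\<delta> (\<delta> p)) 0"
proof -
  obtain \<delta>' where \<delta>': "ainf_coder A \<mu> \<delta>'" "tc_eq (susp A) (\<delta>' (\<delta>' p)) 0"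
    using A by (auto simp: ainf_algebra_def)
  note u = ainf_coder_unique[OF chain_complexD(1)[OF ainf_algebra_complex[OF A]] \<delta>'(1) \<delta>]
  have "tc_hom (susp A) (susp A) (-1) \<delta>'" using \<delta>'(1) by (simp add: ainf_coder_def tc_coderivation_def)
  from tc_eq_trans[OF u tc_hom_cong[OF this u]] \<delta>'(2) show ?thesis by (blast intro: tc_eq_trans)
qed

text \<open>By uniqueness the chain condition does not depend on the representatives that witness it.\<close>

lemma ainf_morphism_chain:
  assumes F: "ainf_morphism A \<mu> B \<nu> F" and "ainf_coder A \<mu> \<delta>" "ainf_coder B \<nu> \<delta>'" "ainf_coalg_hom A B F \<phi>"
  shows "tc_eq (susp B) (\<delta>' (\<phi> p)) (\<phi> (\<delta> p))"
proof -
  have gA: "graded_module A" and gB: "graded_module B"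
    using F by (auto simp: ainf_morphism_def intro!: chain_complexD ainf_algebra_complex)
  obtain d d' f where c: "ainf_coder A \<mu> d" "ainf_coder B \<nu> d'" "ainf_coalg_hom A B F f"
    and e: "tc_eq (susp B) (d' (f p)) (f (d p))"
    using F by (auto simp: ainf_morphism_def)
  have h: "tc_hom (susp B) (susp B) (-1) \<delta>'" "tc_hom (susp A) (susp B) 0 \<phi>"
    using assms by (auto simp: ainf_coder_def tc_coderivation_def ainf_coalg_hom_def tc_coalg_hom_def)
  have "tc_eq (susp B) (\<delta>' (\<phi> p)) (\<delta>' (f p))"
    by (rule tc_hom_cong[OF h(1) ainf_coalg_hom_unique[OF gB c(3) assms(4)]])
  also have "tc_eq (susp B) \<dots> (d' (f p))" by (rule ainf_coder_unique[OF gB c(2) assms(3)])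
  also note e
  also have "tc_eq (susp B) (f (d p)) (\<phi> (d p))" by (rule ainf_coalg_hom_unique[OF gB assms(4) c(3)])
  also have "tc_eq (susp B) \<dots> (\<phi> (\<delta> p))"
    by (rule tc_hom_cong[OF h(2) ainf_coder_unique[OF gA assms(2) c(1)]])
  finally show ?thesis .
qed

text \<open>The composite family is defined through chosen representatives; by uniqueness any other representatives
  of the two morphisms have a congruent composite, with the same components.\<close>

lemma ainf_comp_coalg_hom:
  assumes A: "graded_module A" and B: "graded_module B" and C: "graded_module C"
    and \<phi>: "ainf_coalg_hom A B F \<phi>" and \<psi>: "ainf_coalg_hom B C G \<psi>"
  shows "ainf_coalg_hom A C (ainf_comp A B C G F) (\<lambda>p. \<psi> (\<phi> p))"
proof -
  define \<phi>' where "\<phi>' = (SOME \<phi>. ainf_coalg_hom A B F \<phi>)"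
  define \<psi>' where "\<psi>' = (SOME \<psi>. ainf_coalg_hom B C G \<psi>)"
  have \<phi>': "ainf_coalg_hom A B F \<phi>'" unfolding \<phi>'_def by (rule someI[of "ainf_coalg_hom A B F", OF \<phi>])
  have \<psi>': "ainf_coalg_hom B C G \<psi>'" unfolding \<psi>'_def by (rule someI[of "ainf_coalg_hom B C G", OF \<psi>])
  have h: "tc_coalg_hom (susp A) (susp B) \<phi>" "tc_coalg_hom (susp B) (susp C) \<psi>"
    using \<phi> \<psi> by (auto simp: ainf_coalg_hom_def)
  have "tc_eq (susp C) (\<psi>' (\<phi>' p)) (\<psi> (\<phi> p))" for p
    using tc_eq_trans[OF ainf_coalg_hom_unique[OF C \<psi> \<psi>'] tc_hom_cong[OF tc_coalg_hom_hom[OF h(2)] ainf_coalg_hom_unique[OF B \<phi> \<phi>']]] .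
  then have "tc_proj (susp C) (\<psi> (\<phi> (basis w))) = ainf_comp A B C G F (desusp_word (susp A) w)" for w
    unfolding ainf_comp_def Let_def \<phi>'_def[symmetric] \<psi>'_def[symmetric]
      desusp_word_desusp_word[OF graded_module_susp[OF A]]
    by (rule tc_proj_cong[OF graded_module_susp[OF C] tc_eq_sym])
  then show ?thesis
    using tc_coalg_hom_compose[OF graded_module_susp[OF B] h] by (simp add: ainf_coalg_hom_def has_components_def)
qed

lemma multilinear_cong:
  assumes "\<And>w. w \<noteq> [] \<Longrightarrow> F w = G w" "k \<ge> 1"
  shows "multilinear V W k d F \<longleftrightarrow> multilinear V W k d G"
proof -
  have "F w = G w" if "length w = k" for w using assms that by (intro assms(1)) auto
  then show ?thesis using assms(1) by (auto simp: multilinear_def)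
qed

lemma coalg_hom_multilinear:
  assumes A: "graded_module A" and B: "graded_module B"
    and \<theta>: "tc_hom (susp A) (susp B) d \<theta>" "has_components A B F \<theta>" and k: "k \<ge> 1"
  shows "multilinear A B k (int k - 1 + d) F"
proof -
  have "multilinear A B k (int k - 1 + d) (\<lambda>w. tc_proj (susp B) (\<theta> (basis (desusp_word (susp A) w))))"
    by (rule tc_fun_multilinear[OF A B tc_fun_tc_hom[OF \<theta>(1) tc_fun_proj[OF graded_module_susp[OF B]]]]) simp
  moreover have "tc_proj (susp B) (\<theta> (basis (desusp_word (susp A) w))) = F w" if "w \<noteq> []" for w
  proof -
    have "desusp_word (susp A) w \<noteq> []" using that length_desusp_word[of "susp A" w] by (metis length_0_conv)
    then show ?thesis using \<theta>(2) graded_module_susp[OF A] by (simp add: has_components_def)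
  qed
  ultimately show ?thesis by (metis (no_types, lifting) multilinear_cong k)
qed

lemma ainf_comp_morphism:
  assumes F: "ainf_morphism A \<mu> B \<nu> F" and G: "ainf_morphism B \<nu> C \<omega> G"
  shows "ainf_morphism A \<mu> C \<omega> (ainf_comp A B C G F)"
proof -
  have alg: "ainf_algebra A \<mu>" "ainf_algebra B \<nu>" "ainf_algebra C \<omega>"
    using F G by (auto simp: ainf_morphism_def)
  note gr = alg[THEN ainf_algebra_complex, THEN chain_complexD(1)]
  obtain \<delta> \<delta>' \<phi> where d: "ainf_coder A \<mu> \<delta>" "ainf_coder B \<nu> \<delta>'" and \<phi>: "ainf_coalg_hom A B F \<phi>"
    using F by (auto simp: ainf_morphism_def)
  obtain \<delta>'' \<psi> where d'': "ainf_coder C \<omega> \<delta>''" and \<psi>: "ainf_coalg_hom B C G \<psi>"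
    using G by (auto simp: ainf_morphism_def)
  note \<psi>\<phi> = ainf_comp_coalg_hom[OF gr \<phi> \<psi>]
  have h: "tc_hom (susp B) (susp C) 0 \<psi>" "tc_hom (susp A) (susp C) 0 (\<lambda>p. \<psi> (\<phi> p))"
    using \<psi> \<psi>\<phi> by (auto simp: ainf_coalg_hom_def tc_coalg_hom_def)
  have "tc_eq (susp C) (\<delta>'' (\<psi> (\<phi> p))) (\<psi> (\<phi> (\<delta> p)))" for p
    using tc_eq_trans[OF ainf_morphism_chain[OF G d(2) d'' \<psi>] tc_hom_cong[OF h(1) ainf_morphism_chain[OF F d \<phi>]]] .
  moreover have "multilinear A C k (int k - 1) (ainf_comp A B C G F)" if "k \<ge> 1" for k
    using coalg_hom_multilinear[OF gr(1,3) h(2) _ that] \<psi>\<phi> by (simp add: ainf_coalg_hom_def)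
  ultimately show ?thesis
    unfolding ainf_morphism_def using alg d(1) d'' \<psi>\<phi> by blast
qed

section \<open>Homotopy equivalences\<close>

lemma graded_hom_comp:
  assumes "graded_hom U V d f" "graded_hom V W e g" "k = d + e"
  shows "graded_hom U W k (\<lambda>x. g (f x))"
  using assms by (auto simp: graded_hom_def add.assoc[symmetric] intro: module_hom_comp)

lemma graded_hom_plus:
  assumes W: "graded_module W" and "graded_hom V W d f" "graded_hom V W d g"
  shows "graded_hom V W d (\<lambda>x. f x + g x)"
  using assms module.subspace_add[OF graded_module_module[OF W] graded_module_subspace[OF W]]
  by (auto simp: graded_hom_def intro: module_hom_plus)

lemma chain_equivalence_inverse:
  assumes "chain_equivalence A B f"
  obtains g r q where "graded_hom B A 0 g" "\<And>x. g (bd B x) = bd A (g x)"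
    and "graded_hom A A 1 r" "\<And>x. x - g (f x) = bd A (r x) + r (bd A x)"
    and "graded_hom B B 1 q" "\<And>x. x - f (g x) = bd B (q x) + q (bd B x)"
  using assms by (auto simp: chain_equivalence_def chain_homotopic_def chain_map_def)

section \<open>Existence of the isotopy\<close>

lemma tc_proj_ainf_coder:
  "ainf_coder A \<mu> \<delta> \<Longrightarrow> tc_proj (susp A) (\<delta> (basis [x])) = bd A x"
  by (simp add: ainf_coder_def has_components_def)

lemma tc_proj_ainf_coalg_hom:
  "ainf_coalg_hom A B F \<phi> \<Longrightarrow> tc_proj (susp B) (\<phi> (basis [x])) = linear_part F x"
  by (simp add: ainf_coalg_hom_def has_components_def linear_part_def)

lemma tc_eq_coalg_hom_letter:
  assumes W: "graded_module W" and "tc_coalg_hom V W \<phi>"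
  shows "tc_eq W (\<phi> (basis [x])) (basis [tc_proj W (\<phi> (basis [x]))])"
  using gcoder_recursion[OF W assms(2)[unfolded tc_coalg_hom_iff], of "[x]"] by simp

theorem corollary6:
  fixes A :: "('r::comm_ring_1, 'a::ab_group_add) complex"
    and B :: "('r, 'b::ab_group_add) complex"
    and C :: "('r, 'c::ab_group_add) complex"
    and f :: "'a \<Rightarrow> 'b" and g :: "'b \<Rightarrow> 'c" and h :: "'a \<Rightarrow> 'c"
    and \<mu> :: "'a list \<Rightarrow> 'a" and \<nu> :: "'b list \<Rightarrow> 'b" and \<omega>' \<omega>'' :: "'c list \<Rightarrow> 'c"
    and F :: "'a list \<Rightarrow> 'b" and G :: "'b list \<Rightarrow> 'c" and H :: "'a list \<Rightarrow> 'c"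
  assumes "chain_equivalence A B f"
    and "chain_equivalence B C g"
    and "chain_equivalence A C h"
    and "chain_homotopic A C h (g \<circ> f)"
    and "ainf_algebra A \<mu>"
    and "ainf_morphism A \<mu> B \<nu> F" and "linear_part F = f"
    and "ainf_morphism B \<nu> C \<omega>' G" and "linear_part G = g"
    and "ainf_morphism A \<mu> C \<omega>'' H" and "linear_part H = h"
  shows "\<exists>T. ainf_isotopy C \<omega>' \<omega>'' T \<and>
             ainf_homotopic A \<mu> C \<omega>'' (ainf_comp A C C T (ainf_comp A B C G F)) H"
proof -
  note F = assms(6) and G = assms(8) and H = assms(10)
  note GF = ainf_comp_morphism[OF F G]
  have alg: "ainf_algebra A \<mu>" "ainf_algebra B \<nu>" "ainf_algebra C \<omega>'" "ainf_algebra C \<omega>''"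
    using F G H by (auto simp: ainf_morphism_def)
  note cx = alg[THEN ainf_algebra_complex]
  note gr = cx[THEN chain_complexD(1)] and grb = cx[THEN chain_complexD(2)]
  note sgr = gr[THEN graded_module_susp]
  obtain \<phi> where \<phi>: "ainf_coalg_hom A B F \<phi>" using F by (auto simp: ainf_morphism_def)
  obtain \<gamma> where \<gamma>: "ainf_coalg_hom B C G \<gamma>" using G by (auto simp: ainf_morphism_def)
  obtain \<delta> \<delta>'' \<chi> where \<delta>: "ainf_coder A \<mu> \<delta>" and \<delta>'': "ainf_coder C \<omega>'' \<delta>''" and \<chi>: "ainf_coalg_hom A C H \<chi>"
    using H by (auto simp: ainf_morphism_def)
  obtain \<delta>' where \<delta>': "ainf_coder C \<omega>' \<delta>'" using G by (auto simp: ainf_morphism_def)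
  define \<kappa> where "\<kappa> p = \<gamma> (\<phi> p)" for p
  have \<kappa>: "ainf_coalg_hom A C (ainf_comp A B C G F) \<kappa>"
    unfolding \<kappa>_def[abs_def] by (rule ainf_comp_coalg_hom[OF gr(1-3) \<phi> \<gamma>])

  have fg: "graded_hom A B 0 f" "\<And>x. f (bd A x) = bd B (f x)" "graded_hom B C 0 g" "\<And>x. g (bd B x) = bd C (g x)"
    using assms(1,2) by (auto simp: chain_equivalence_def chain_map_def)
  obtain f' rf qf where f': "graded_hom B A 0 f'" "\<And>x. f' (bd B x) = bd A (f' x)"
    and rf: "graded_hom A A 1 rf" "\<And>x. x - f' (f x) = bd A (rf x) + rf (bd A x)"
    and qf: "graded_hom B B 1 qf" "\<And>x. x - f (f' x) = bd B (qf x) + qf (bd B x)"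
    by (rule chain_equivalence_inverse[OF assms(1)]) (rule that; assumption)
  obtain g' rg qg where g': "graded_hom C B 0 g'" "\<And>x. g' (bd C x) = bd B (g' x)"
    and rg: "graded_hom B B 1 rg" "\<And>x. x - g' (g x) = bd B (rg x) + rg (bd B x)"
    and qg: "graded_hom C C 1 qg" "\<And>x. x - g (g' x) = bd C (qg x) + qg (bd C x)"
    by (rule chain_equivalence_inverse[OF assms(2)]) (rule that; assumption)
  have lin: "module_hom (gscale A) (gscale B) f" "module_hom (gscale B) (gscale C) g"
     "module_hom (gscale B) (gscale A) f'" "module_hom (gscale C) (gscale B) g'"
     "module_hom (gscale A) (gscale A) (bd A)" "module_hom (gscale C) (gscale C) (bd C)"
    using fg f' g' grb by (auto simp: graded_hom_def)
  note la = lin[THEN module_hom.add] lin[THEN module_hom.diff]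
  obtain s where s: "graded_hom A C 1 s" "\<And>x. g (f x) - h x = bd C (s x) + s (bd A x)"
    using assms(4) by (auto simp: chain_homotopic_def)
  \<comment> \<open>Homotopies for the composite of the two homotopy equivalences and its inverse \<open>f' g'\<close>.\<close>
  define r where "r x = rf x + f' (rg (f x))" for x
  define q where "q x = qg x + g (qf (g' x))" for x
  have r: "graded_hom A A 1 r" unfolding r_def[abs_def]
    by (intro graded_hom_plus gr rf graded_hom_comp[OF graded_hom_comp[OF fg(1) rg(1)] f'(1)]) auto
  have q: "graded_hom C C 1 q" unfolding q_def[abs_def]
    by (intro graded_hom_plus gr qg graded_hom_comp[OF graded_hom_comp[OF g'(1) qf(1)] fg(3)]) auto
  have rx: "x - f' (g' (g (f x))) = bd A (r x) + r (bd A x)" for x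
  proof -
    have "x - f' (g' (g (f x))) = (x - f' (f x)) + f' (f x - g' (g (f x)))" by (simp add: la)
    also have "\<dots> = bd A (r x) + r (bd A x)"
      unfolding rf(2) rg(2) by (simp add: r_def la fg f' algebra_simps)
    finally show ?thesis .
  qed
  have qx: "x - g (f (f' (g' x))) = bd C (q x) + q (bd C x)" for x
  proof -
    have "x - g (f (f' (g' x))) = (x - g (g' x)) + g (g' x - f (f' (g' x)))" by (simp add: la)
    also have "\<dots> = bd C (q x) + q (bd C x)"
      unfolding qg(2) qf(2) by (simp add: q_def la fg g' algebra_simps)
    finally show ?thesis .
  qed

  have letter: "tc_proj (susp C) (\<kappa> (basis [x])) = g (f x)" for x
  proof -
    have "tc_coalg_hom (susp A) (susp B) \<phi>" "tc_hom (susp B) (susp C) 0 \<gamma>"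
      using \<phi> \<gamma> by (auto simp: ainf_coalg_hom_def tc_coalg_hom_def)
    from tc_proj_cong[OF sgr(3) tc_hom_cong[OF this(2) tc_eq_coalg_hom_letter[OF sgr(2) this(1)]]]
    show ?thesis
      by (simp add: \<kappa>_def tc_proj_ainf_coalg_hom[OF \<phi>] tc_proj_ainf_coalg_hom[OF \<gamma>] assms(7,9))
  qed
  have coder: "tc_coderivation (susp A) \<delta>" "tc_coderivation (susp C) \<delta>'" "tc_coderivation (susp C) \<delta>''"
    using \<delta> \<delta>' \<delta>'' by (auto simp: ainf_coder_def)
  have coalg: "tc_coalg_hom (susp A) (susp C) \<kappa>" "tc_coalg_hom (susp A) (susp C) \<chi>"
    using \<kappa> \<chi> by (auto simp: ainf_coalg_hom_def)
  have "isotopy_problem (susp A) (susp C) \<delta> \<delta>' \<delta>'' \<kappa> \<chi> (bd A) (bd C)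
    (\<lambda>x. g (f x)) h (\<lambda>x. f' (g' x)) r q s"
    by (unfold_locales; (rule sgr coder coalg letter graded_hom_susp[OF r] graded_hom_susp[OF q] graded_hom_susp[OF s(1)]
      rx qx s(2) ainf_coder_square_zero[OF alg(1) \<delta>] ainf_coder_square_zero[OF alg(3) \<delta>'] ainf_coder_square_zero[OF alg(4) \<delta>'']
      ainf_morphism_chain[OF GF \<delta> \<delta>' \<kappa>] ainf_morphism_chain[OF H \<delta> \<delta>'' \<chi>]
      grb[THEN graded_hom_susp] graded_hom_susp[OF graded_hom_comp[OF fg(1,3)]] graded_hom_susp[OF graded_hom_comp[OF g'(1) f'(1)]]
      tc_proj_ainf_coder[OF \<delta>] tc_proj_ainf_coder[OF \<delta>'] tc_proj_ainf_coder[OF \<delta>'']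
      | simp add: fg f' g' tc_proj_ainf_coalg_hom[OF \<chi>] assms(11))+)
  from isotopy_problem.solution_exists[OF this]
  obtain \<tau> \<eta> where \<tau>: "tc_coalg_hom (susp C) (susp C) \<tau>" and \<tau>x: "\<And>x. tc_proj (susp C) (\<tau> (basis [x])) = x"
    and \<tau>\<delta>: "\<And>p. tc_eq (susp C) (\<delta>'' (\<tau> p)) (\<tau> (\<delta>' p))"
    and \<eta>: "gcoder (susp A) (susp C) 1 \<chi> (\<lambda>p. \<tau> (\<kappa> p)) \<eta>"
    and \<eta>\<delta>: "\<And>p. tc_eq (susp C) (\<tau> (\<kappa> p) - \<chi> p) (\<delta>'' (\<eta> p) + \<eta> (\<delta> p))"
    by blast
  define T where "T w = tc_proj (susp C) (\<tau> (basis (desusp_word (susp C) w)))" for w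
  define E where "E w = tc_proj (susp C) (\<eta> (basis (desusp_word (susp A) w)))" for w
  have T: "ainf_coalg_hom C C T \<tau>"
    using \<tau> by (simp add: ainf_coalg_hom_def has_components_def T_def sgr)
  have E: "has_components A C E \<eta>"
    by (simp add: has_components_def E_def sgr)
  have T_mult: "multilinear C C k (int k - 1) T" if "1 \<le> k" for k
    using coalg_hom_multilinear[OF gr(3,3) tc_coalg_hom_hom[OF \<tau>] _ that] T by (simp add: ainf_coalg_hom_def)
  have TC: "ainf_morphism C \<omega>' C \<omega>'' T"
    unfolding ainf_morphism_def using alg T_mult \<delta>' \<delta>'' T \<tau>\<delta> by blast
  have iso: "ainf_isotopy C \<omega>' \<omega>'' T"
    using TC by (auto simp: ainf_isotopy_def linear_part_def T_def \<tau>x)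
  have "ainf_homotopy A \<mu> C \<omega>'' (ainf_comp A C C T (ainf_comp A B C G F)) H E"
    unfolding ainf_homotopy_def
  proof (intro conjI exI allI impI)
    show "multilinear A C k (int k) E" if "1 \<le> k" for k
      using coalg_hom_multilinear[OF gr(1,3) gcoder_hom[OF \<eta>] E that] by simp
    show "ainf_coalg_hom A C (ainf_comp A C C T (ainf_comp A B C G F)) (\<lambda>p. \<tau> (\<kappa> p))"
      by (rule ainf_comp_coalg_hom[OF gr(1,3,3) \<kappa> T])
    show "tc_homotopy_map (susp A) (susp C) \<chi> (\<lambda>p. \<tau> (\<kappa> p)) \<eta>"
      using \<eta> by (simp add: tc_homotopy_map_def gcoder_def)
  qed (rule \<delta> \<delta>'' \<chi> E \<eta>\<delta>)+
  with ainf_comp_morphism[OF GF TC] H have "ainf_homotopic A \<mu> C \<omega>'' (ainf_comp A C C T (ainf_comp A B C G F)) H"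
    unfolding ainf_homotopic_def by blast
  with iso show ?thesis by blast
qed

end
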